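(* For $\alpha\in(0,\pi/2)$ let $\Pi_\alpha\subset\mathbb{R}^3$ be the layer of unit width constructed from a trihedral angle with vertex $O'$, two of whose vertex angles (plane angles at $O'$) are right angles and whose third vertex angle equals $\alpha$. Then there exists $\alpha_0>0$ such that for all $\alpha\in(0,\alpha_0)$ the Dirichlet spectral problem for the Laplace operator in $\Pi_\alpha$ has no eigenvalues below the threshold of the essential spectrum, i.e. the Dirichlet Laplacian $\mathfrak{A}_{\Pi_\alpha}$ has no eigenvalues in $(-\infty,\inf\sigma_{ess}(\mathfrak{A}_{\Pi_\alpha}))$.
   Context: Trihedral angle: let $P_1'P_2'P_3'$ be a triangle in $\mathbb{R}^3$ lying in a plane that does not contain the point $O'$, and let $\ell_j'$ be the ray from $O'$ through $P_j'$. The trihedral angle with vertex $O'$ is $\Upsilon'=\operatorname{conv}\{\ell_j' : 1\le j\le 3\}$ (convex hull of the union of the rays), with boundary $\Gamma'=\partial\Upsilon'$ consisting of the three faces $\operatorname{conv}\{\ell_j',\ell_{j+1}'\}$ (indices modulo $3$). The vertex angles are $\alpha_j=\angle P_j'O'P_{j+1}'$. The trihedral angle with two right vertex angles and third vertex angle $\alpha$ is unique up to isometry. Layer of unit width constructed from $\Upsilon'$: $\Pi=\{x\in\Upsilon' : \operatorname{dist}(x,\Gamma')\in(0,1)\}$. Operator: $\mathfrak{A}_\Pi$ is the positive self-adjoint operator in $L_2(\Pi)$ generated by the closed positive definite sesquilinear form $\mathfrak{a}_\Pi[u,v]=(\nabla u,\nabla v)_{L_2(\Pi)}$ with domain $H^1_0(\Pi)$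 (functions in $H^1(\Pi)$ with zero trace on $\partial\Pi$), i.e. the Dirichlet Laplacian $-\Delta$; $\sigma_{ess}$ denotes the essential spectrum (the spectrum minus the isolated eigenvalues of finite multiplicity). The threshold of the essential spectrum is $\inf\sigma_{ess}(\mathfrak{A}_\Pi)$. *)

theory Defs
  imports "HOL-Analysis.Analysis"
begin

section \<open>Square-integrable functions\<close>

text \<open>
  Elements of $L_2(\Omega)$ are represented by functions on the whole space; only their values
  almost everywhere on \<open>\<Omega>\<close> matter.
\<close>

definition L2 :: "'a::euclidean_space set \<Rightarrow> ('a \<Rightarrow> complex) set" where
  "L2 \<Omega> = {f \<in> borel_measurable (lebesgue_on \<Omega>). integrable (lebesgue_on \<Omega>) (\<lambda>x. (norm (f x))\<^sup>2)}"

definition L2_inner :: "'a::euclidean_space set \<Rightarrow> ('a \<Rightarrow> complex) \<Rightarrow> ('a \<Rightarrow> complex) \<Rightarrow> complex" where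
  "L2_inner \<Omega> f g = (LINT x|lebesgue_on \<Omega>. f x * cnj (g x))"

definition L2_norm :: "'a::euclidean_space set \<Rightarrow> ('a \<Rightarrow> complex) \<Rightarrow> real" where
  "L2_norm \<Omega> f = sqrt (LINT x|lebesgue_on \<Omega>. (norm (f x))\<^sup>2)"

section \<open>Sobolev spaces\<close>

primrec Ck :: "nat \<Rightarrow> ('a::euclidean_space \<Rightarrow> 'b::real_normed_vector) \<Rightarrow> bool" where
  "Ck 0 f \<longleftrightarrow> continuous_on UNIV f"
| "Ck (Suc k) f \<longleftrightarrow> (\<forall>x. f differentiable (at x)) \<and>
     (\<forall>b\<in>Basis. Ck k (\<lambda>x. frechet_derivative f (at x) b))"

definition test_functions :: "'a::euclidean_space set \<Rightarrow> ('a \<Rightarrow> complex) set" where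
  "test_functions \<Omega> =
     {\<phi>. (\<forall>k. Ck k \<phi>) \<and> compact (closure {x. \<phi> x \<noteq> 0}) \<and> closure {x. \<phi> x \<noteq> 0} \<subseteq> \<Omega>}"

definition is_weak_partial ::
    "'a::euclidean_space set \<Rightarrow> 'a \<Rightarrow> ('a \<Rightarrow> complex) \<Rightarrow> ('a \<Rightarrow> complex) \<Rightarrow> bool" where
  "is_weak_partial \<Omega> b u g \<longleftrightarrow>
     (\<forall>\<phi>\<in>test_functions \<Omega>.
        (LINT x|lebesgue_on \<Omega>. u x * frechet_derivative \<phi> (at x) b) =
        - (LINT x|lebesgue_on \<Omega>. g x * \<phi> x))"

definition H1 :: "'a::euclidean_space set \<Rightarrow> ('a \<Rightarrow> complex) set" where
  "H1 \<Omega> = {u \<in> L2 \<Omega>. \<forall>b\<in>Basis. \<exists>g\<in>L2 \<Omega>. is_weak_partial \<Omega> b u g}"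

text \<open>
  For open \<open>\<Omega>\<close> and \<open>u \<in> H1 \<Omega>\<close> the weak partial derivative is unique up to null sets, so the
  choice below does not affect any of the integrals it occurs in.
\<close>

definition weak_partial :: "'a::euclidean_space set \<Rightarrow> 'a \<Rightarrow> ('a \<Rightarrow> complex) \<Rightarrow> 'a \<Rightarrow> complex" where
  "weak_partial \<Omega> b u = (SOME g. g \<in> L2 \<Omega> \<and> is_weak_partial \<Omega> b u g)"

definition dirichlet_form ::
    "'a::euclidean_space set \<Rightarrow> ('a \<Rightarrow> complex) \<Rightarrow> ('a \<Rightarrow> complex) \<Rightarrow> complex" where
  "dirichlet_form \<Omega> u v = (\<Sum>b\<in>Basis. L2_inner \<Omega> (weak_partial \<Omega> b u) (weak_partial \<Omega> b v))"

definition H1_norm :: "'a::euclidean_space set \<Rightarrow> ('a \<Rightarrow> complex) \<Rightarrow> real" where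
  "H1_norm \<Omega> u = sqrt ((L2_norm \<Omega> u)\<^sup>2 + (\<Sum>b\<in>Basis. (L2_norm \<Omega> (weak_partial \<Omega> b u))\<^sup>2))"

text \<open>
  $H^1_0(\Omega)$ is the $H^1$-closure of $C_c^\infty(\Omega)$; for a Lipschitz domain these are
  the functions in $H^1(\Omega)$ with zero trace on the boundary.
\<close>

definition H1_0 :: "'a::euclidean_space set \<Rightarrow> ('a \<Rightarrow> complex) set" where
  "H1_0 \<Omega> = {u \<in> H1 \<Omega>. \<exists>\<phi>. (\<forall>n. \<phi> n \<in> test_functions \<Omega>) \<and>
     (\<lambda>n::nat. H1_norm \<Omega> (\<lambda>x. u x - \<phi> n x)) \<longlonglongrightarrow> 0}"

section \<open>Unbounded operators on $L_2(\Omega)$ and their spectra\<close>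

text \<open>
  Operators are given by their graphs, i.e. sets of pairs of representatives of elements of
  $L_2(\Omega)$.  The Dirichlet Laplacian is the operator generated by the closed form
  \<^const>\<open>dirichlet_form\<close> with domain \<^const>\<open>H1_0\<close>: $u$ is mapped to $f$ iff
  $a[u,v] = (f,v)$ for all $v$ in the form domain.
\<close>

definition dirichlet_laplacian ::
    "'a::euclidean_space set \<Rightarrow> (('a \<Rightarrow> complex) \<times> ('a \<Rightarrow> complex)) set" where
  "dirichlet_laplacian \<Omega> =
     {(u, f). u \<in> H1_0 \<Omega> \<and> f \<in> L2 \<Omega> \<and> (\<forall>v\<in>H1_0 \<Omega>. dirichlet_form \<Omega> u v = L2_inner \<Omega> f v)}"

text \<open>\<open>T - z\<close> maps the domain of \<open>T\<close> onto $L_2(\Omega)$ and is injective with bounded inverse.\<close>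

definition resolvent_set ::
    "'a::euclidean_space set \<Rightarrow> (('a \<Rightarrow> complex) \<times> ('a \<Rightarrow> complex)) set \<Rightarrow> complex set" where
  "resolvent_set \<Omega> T =
     {z. (\<forall>f\<in>L2 \<Omega>. \<exists>u. (u, \<lambda>x. f x + z * u x) \<in> T) \<and>
         (\<exists>C. \<forall>(u, g)\<in>T. L2_norm \<Omega> u \<le> C * L2_norm \<Omega> (\<lambda>x. g x - z * u x))}"

definition op_spectrum ::
    "'a::euclidean_space set \<Rightarrow> (('a \<Rightarrow> complex) \<times> ('a \<Rightarrow> complex)) set \<Rightarrow> complex set" where
  "op_spectrum \<Omega> T = - resolvent_set \<Omega> T"

definition op_eigenspace ::
    "(('a::euclidean_space \<Rightarrow> complex) \<times> ('a \<Rightarrow> complex)) set \<Rightarrow> complex \<Rightarrow> ('a \<Rightarrow> complex) set" where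
  "op_eigenspace T z = {u. (u, \<lambda>x. z * u x) \<in> T}"

definition is_eigenvalue ::
    "'a::euclidean_space set \<Rightarrow> (('a \<Rightarrow> complex) \<times> ('a \<Rightarrow> complex)) set \<Rightarrow> complex \<Rightarrow> bool" where
  "is_eigenvalue \<Omega> T z \<longleftrightarrow>
     (\<exists>u\<in>op_eigenspace T z. \<not> (AE x in lebesgue_on \<Omega>. u x = 0))"

definition finite_multiplicity ::
    "'a::euclidean_space set \<Rightarrow> (('a \<Rightarrow> complex) \<times> ('a \<Rightarrow> complex)) set \<Rightarrow> complex \<Rightarrow> bool" where
  "finite_multiplicity \<Omega> T z \<longleftrightarrow>
     (\<exists>B. finite B \<and> B \<subseteq> op_eigenspace T z \<and>
        (\<forall>u\<in>op_eigenspace T z. \<exists>c. AE x in lebesgue_on \<Omega>. u x = (\<Sum>e\<in>B. c e * e x)))"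

definition essential_spectrum ::
    "'a::euclidean_space set \<Rightarrow> (('a \<Rightarrow> complex) \<times> ('a \<Rightarrow> complex)) set \<Rightarrow> complex set" where
  "essential_spectrum \<Omega> T = op_spectrum \<Omega> T -
     {z. is_eigenvalue \<Omega> T z \<and> finite_multiplicity \<Omega> T z \<and> \<not> z islimpt op_spectrum \<Omega> T}"

text \<open>
  The spectrum of a self-adjoint operator is real, so taking real parts only changes the type.
  The infimum is taken in the extended reals, where it is \<open>\<infinity>\<close> for an empty set.
\<close>

definition ess_threshold ::
    "'a::euclidean_space set \<Rightarrow> (('a \<Rightarrow> complex) \<times> ('a \<Rightarrow> complex)) set \<Rightarrow> ereal" where
  "ess_threshold \<Omega> T = (INF z\<in>essential_spectrum \<Omega> T. ereal (Re z))"

section \<open>Trihedral angles and layers\<close>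

text \<open>Arithmetic on the index type \<open>3\<close> is modulo 3, so \<open>P (j + 1)\<close> is the cyclic successor.\<close>

definition is_trihedral :: "real^3 \<Rightarrow> (3 \<Rightarrow> real^3) \<Rightarrow> bool" where
  "is_trihedral V P \<longleftrightarrow>
     \<not> collinear (range P) \<and> V \<notin> affine hull (range P)"

definition ray :: "'a::real_vector \<Rightarrow> 'a \<Rightarrow> 'a set" where
  "ray V Q = {V + t *\<^sub>R (Q - V) |t. t \<ge> 0}"

definition trihedral_angle :: "real^3 \<Rightarrow> (3 \<Rightarrow> real^3) \<Rightarrow> (real^3) set" where
  "trihedral_angle V P = convex hull (\<Union>j. ray V (P j))"

definition angle :: "'a::real_inner \<Rightarrow> 'a \<Rightarrow> 'a \<Rightarrow> real" where
  "angle A V B = arccos ((A - V) \<bullet> (B - V) / (norm (A - V) * norm (B - V)))"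

definition vertex_angle :: "real^3 \<Rightarrow> (3 \<Rightarrow> real^3) \<Rightarrow> 3 \<Rightarrow> real" where
  "vertex_angle V P j = angle (P j) V (P (j + 1))"

definition unit_layer :: "real^3 \<Rightarrow> (3 \<Rightarrow> real^3) \<Rightarrow> (real^3) set" where
  "unit_layer V P =
     {x \<in> trihedral_angle V P. infdist x (frontier (trihedral_angle V P)) \<in> {0<..<1}}"

end

theory Submission
  imports Defs "HOL-Computational_Algebra.Polynomial"
begin

text \<open>
  Let \<open>z\<close> be the distance to the face with vertex angle \<open>\<alpha>\<close>. The horizontal sections of the layer at
  heights \<open>z \<ge> 1\<close> are a fixed planar broken strip, the points of a sector of angle \<open>\<alpha>\<close> at distance
  less than 1 from its sides. Let \<open>\<Lambda>\<close> be the bottom of the spectrum of its Dirichlet Laplacian. For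
  small \<open>\<alpha>\<close> a long rectangle of width almost 2 fits into the strip, hence \<open>\<Lambda> \<le> 4\<close>.

  Every test function has Rayleigh quotient at least \<open>\<Lambda>\<close>. Above height 1 this holds on each horizontal
  section. Below height 1, a function vanishing at one end of an interval of length \<open>L\<close> satisfies the
  inequality \<open>2 / L\<^sup>2 \<integral>\<bar>f\<bar>\<^sup>2 \<le> \<integral>\<bar>f'\<bar>\<^sup>2\<close>. Over the strip the vertical segments from the ground and the
  horizontal segments orthogonal to the nearest inclined face, all of length at most 1, contribute
  \<open>2 + 2 = 4\<close>; over the rest of the sector the function vanishes at both ends of the unit vertical
  segments, and two halves of length \<open>1 / 2\<close> contribute 8. So there is no eigenvalue below \<open>\<Lambda>\<close>.

  Conversely every \<open>\<mu> > \<Lambda>\<close> lies in the spectrum: the product of an almost minimiser on the strip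
  with a wide wave packet of frequency \<open>sqrt (\<mu> - \<Lambda>)\<close> along the edge is an approximate eigenfunction.
  Such \<open>\<mu>\<close> are limit points of the spectrum, hence essential, and the threshold is at most \<open>\<Lambda>\<close>.
\<close>

section \<open>Smooth functions\<close>

text \<open>The planar operator on the broken strip is never constructed: \<Lambda> is
  \<open>strip_bottom\<close>, the largest constant in an inequality for test functions of the layer
  restricted to heights above 1. Hence no minimiser is at hand, only functions whose energy is close
  to \<Lambda> times their mass, and these need not be approximate eigenfunctions in the L2 sense.
  Cauchy-Schwarz for the nonnegative form energy minus \<Lambda> times mass helps: near-minimality
  makes the residual small as a functional on H1, which is why Weyl's criterion is set up for forms.
  The threshold is never computed; it is enough that \<Lambda> separates it from all eigenvalues.
  The crude constant 2 / L^2 (the sharp one is pi^2 / (4 L^2)) suffices because an interval of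
  length 2 has first Dirichlet eigenvalue pi^2 / 4, well below 4. Smallness of \<alpha> enters only
  through \<Lambda> \<le> 4; the geometry uses \<alpha> < pi / 2, which keeps distinct inner normals
  from forming acute angles.\<close>

definition smooth :: "('a::euclidean_space \<Rightarrow> 'b::real_normed_vector) \<Rightarrow> bool" where
  "smooth f \<longleftrightarrow> (\<forall>k. Ck k f)"

abbreviation pd :: "'a::euclidean_space \<Rightarrow> ('a \<Rightarrow> 'b::real_normed_vector) \<Rightarrow> 'a \<Rightarrow> 'b" where
  "pd v f \<equiv> (\<lambda>x. frechet_derivative f (at x) v)"

lemma Ck_Suc_imp: "Ck (Suc k) f \<Longrightarrow> Ck k f"
proof (induction k arbitrary: f)
  case 0
  then show ?case
    by (auto simp: continuous_on_eq_continuous_at intro: differentiable_imp_continuous_within)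
next
  case (Suc k)
  then show ?case by (metis Ck.simps(2))
qed

lemma Ck_has_derivative:
  "Ck (Suc k) f \<Longrightarrow> (f has_derivative (\<lambda>v. pd v f x)) (at x)"
  using frechet_derivative_works by force

lemma Ck_SucI:
  assumes "\<And>x. (f has_derivative D x) (at x)" "\<And>b. b \<in> Basis \<Longrightarrow> Ck k (\<lambda>x. D x b)"
  shows "Ck (Suc k) f"
proof -
  have "frechet_derivative f (at x) = D x" for x
    using assms(1) frechet_derivative_at by metis
  then show ?thesis using assms by (auto simp: differentiable_def)
qed

lemma Ck_const: "Ck k (\<lambda>x. c)"
proof (induction k arbitrary: c)
  case (Suc k)
  show ?case by (rule Ck_SucI[where D = "\<lambda>_ _. 0"]) (auto intro: Suc)
qed auto

lemma Ck_add: "Ck k f \<Longrightarrow> Ck k g \<Longrightarrow> Ck k (\<lambda>x. f x + g x)"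
proof (induction k arbitrary: f g)
  case (Suc k)
  show ?case
  proof (rule Ck_SucI)
    show "((\<lambda>x. f x + g x) has_derivative (\<lambda>v. pd v f x + pd v g x)) (at x)" for x
      using Suc.prems by (intro has_derivative_add Ck_has_derivative)
  qed (use Suc in auto)
qed (auto intro: continuous_intros)

lemma Ck_sum: "(\<And>i. i \<in> I \<Longrightarrow> Ck k (f i)) \<Longrightarrow> Ck k (\<lambda>x. \<Sum>i\<in>I. f i x)"
  by (induction I rule: infinite_finite_induct) (auto intro: Ck_add Ck_const)

lemma Ck_bilinear:
  assumes h: "bounded_bilinear h"
  shows "Ck k f \<Longrightarrow> Ck k g \<Longrightarrow> Ck k (\<lambda>x. h (f x) (g x))"
proof (induction k arbitrary: f g)
  case 0
  then show ?case using bounded_bilinear.continuous_on[OF h] by auto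
next
  case (Suc k)
  show ?case
  proof (rule Ck_SucI)
    show "((\<lambda>x. h (f x) (g x)) has_derivative (\<lambda>v. h (f x) (pd v g x) + h (pd v f x) (g x))) (at x)" for x
      using Suc.prems by (intro bounded_bilinear.FDERIV[OF h] Ck_has_derivative)
    show "Ck k (\<lambda>x. h (f x) (pd b g x) + h (pd b f x) (g x))" if "b \<in> Basis" for b
      using that Suc.prems Ck_Suc_imp[OF Suc.prems(1)] Ck_Suc_imp[OF Suc.prems(2)]
      by (intro Ck_add Suc.IH) auto
  qed
qed

lemma Ck_linear_compose:
  assumes h: "bounded_linear h"
  shows "Ck k f \<Longrightarrow> Ck k (\<lambda>x. h (f x))"
proof (induction k arbitrary: f)
  case 0
  then show ?case using bounded_linear.continuous_on[OF h] by auto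
next
  case (Suc k)
  show ?case
  proof (rule Ck_SucI)
    show "((\<lambda>x. h (f x)) has_derivative (\<lambda>v. h (pd v f x))) (at x)" for x
      using Suc.prems by (intro bounded_linear.has_derivative[OF h] Ck_has_derivative)
  qed (use Suc in auto)
qed

lemma Ck_linear:
  fixes h :: "'a::euclidean_space \<Rightarrow> 'b::real_normed_vector"
  assumes h: "bounded_linear h"
  shows "Ck k h"
proof (cases k)
  case (Suc m)
  show ?thesis unfolding Suc
    by (rule Ck_SucI[OF bounded_linear_imp_has_derivative[OF h]]) (rule Ck_const)
qed (auto intro: linear_continuous_on h)

lemma pd_basis_sum:
  assumes "f differentiable (at x)"
  shows "pd v f x = (\<Sum>i\<in>Basis. (v \<bullet> i) *\<^sub>R pd i f x)"
proof -
  interpret bounded_linear "frechet_derivative f (at x)"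
    using assms frechet_derivative_works has_derivative_bounded_linear by blast
  show ?thesis
    by (subst (1) euclidean_representation[symmetric, of v]) (simp add: sum scaleR)
qed

lemma Ck_affine_compose:
  fixes A :: "'b::euclidean_space \<Rightarrow> 'a::euclidean_space"
  assumes A: "bounded_linear A"
  shows "Ck k f \<Longrightarrow> Ck k (\<lambda>x. f (c + A x))"
proof (induction k arbitrary: f)
  case 0
  have "continuous_on UNIV (\<lambda>x. c + A x)" by (intro continuous_intros linear_continuous_on A)
  with 0 show ?case by (auto intro: continuous_on_compose2[of UNIV f])
next
  case (Suc k)
  have d: "f differentiable (at x)" for x using Suc.prems by auto
  show ?case
  proof (rule Ck_SucI)
    have "((f \<circ> (\<lambda>x. c + A x)) has_derivative ((\<lambda>v. pd v f (c + A x)) \<circ> A)) (at x)" for x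
      by (intro diff_chain_at Ck_has_derivative[OF Suc.prems])
        (auto intro!: derivative_eq_intros bounded_linear_imp_has_derivative A)
    \<comment> \<open>The derivative in direction A v is expanded in the basis, because the
      induction hypothesis covers partial derivatives in basis directions only.\<close>
    then show "((\<lambda>x. f (c + A x)) has_derivative (\<lambda>v. \<Sum>i\<in>Basis. (A v \<bullet> i) *\<^sub>R pd i f (c + A x))) (at x)" for x
      unfolding o_def pd_basis_sum[OF d, symmetric] .
    show "Ck k (\<lambda>x. \<Sum>i\<in>Basis. (A b \<bullet> i) *\<^sub>R pd i f (c + A x))" for b
      using Suc by (intro Ck_sum Ck_bilinear[OF bounded_bilinear_scaleR] Ck_const) auto
  qed
qed

text \<open>The whole tower of derivatives F 0, F 1, ... is supplied as data, and the induction
  climbs it: differentiating F n (g x) yields F (Suc n) (g x) times a derivative of g. A closed form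
  for all derivatives, as for \<open>flat_deriv\<close> or a complex exponential, thus gives
  smoothness at once.\<close>

lemma Ck_real_compose:
  fixes g :: "'a::euclidean_space \<Rightarrow> real" and F :: "nat \<Rightarrow> real \<Rightarrow> 'b::real_normed_vector"
  assumes F: "\<And>n t. (F n has_vector_derivative F (Suc n) t) (at t)"
  shows "Ck k g \<Longrightarrow> Ck k (\<lambda>x. F n (g x))"
proof (induction k arbitrary: n)
  case 0
  have "continuous_on UNIV (F n)"
    using F by (auto intro!: continuous_at_imp_continuous_on has_vector_derivative_continuous)
  with 0 show ?case by (auto intro: continuous_on_compose2[of UNIV "F n"])
next
  case (Suc k)
  show ?case
  proof (rule Ck_SucI)
    show "((\<lambda>x. F n (g x)) has_derivative (\<lambda>v. pd v g x *\<^sub>R F (Suc n) (g x))) (at x)" for x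
      using diff_chain_at[OF Ck_has_derivative[OF Suc.prems, of x], of "F n"] F[of n "g x"]
      by (auto simp: o_def has_vector_derivative_def)
    show "Ck k (\<lambda>x. pd b g x *\<^sub>R F (Suc n) (g x))" if "b \<in> Basis" for b
      using that Suc.prems Ck_Suc_imp[OF Suc.prems]
      by (intro Ck_bilinear[OF bounded_bilinear_scaleR] Suc.IH) auto
  qed
qed

lemma smooth_differentiable: "smooth f \<Longrightarrow> f differentiable (at x)"
  unfolding smooth_def using Ck.simps(2)[of 0 f] by blast

lemma smooth_continuous: "smooth f \<Longrightarrow> continuous_on S f"
  unfolding smooth_def using Ck.simps(1)[of f] continuous_on_subset by blast

lemma smooth_has_derivative: "smooth f \<Longrightarrow> (f has_derivative (\<lambda>v. pd v f x)) (at x)"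
  using smooth_differentiable frechet_derivative_works by blast

lemma smooth_const: "smooth (\<lambda>x. c)"
  by (simp add: smooth_def Ck_const)

lemma smooth_add: "smooth f \<Longrightarrow> smooth g \<Longrightarrow> smooth (\<lambda>x. f x + g x)"
  by (simp add: smooth_def Ck_add)

lemma smooth_scaleR: "smooth f \<Longrightarrow> smooth g \<Longrightarrow> smooth (\<lambda>x. f x *\<^sub>R g x)"
  by (simp add: smooth_def Ck_bilinear[OF bounded_bilinear_scaleR])

lemma smooth_mult:
  fixes f g :: "'a::euclidean_space \<Rightarrow> 'b::real_normed_algebra"
  shows "smooth f \<Longrightarrow> smooth g \<Longrightarrow> smooth (\<lambda>x. f x * g x)"
  by (simp add: smooth_def Ck_bilinear[OF bounded_bilinear_mult])

lemma smooth_prod: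
  fixes f :: "'i \<Rightarrow> 'a::euclidean_space \<Rightarrow> 'b::{real_normed_algebra, comm_ring_1}"
  shows "(\<And>i. i \<in> I \<Longrightarrow> smooth (f i)) \<Longrightarrow> smooth (\<lambda>x. \<Prod>i\<in>I. f i x)"
  by (induction I rule: infinite_finite_induct) (auto intro: smooth_mult smooth_const)

lemma smooth_sum: "(\<And>i. i \<in> I \<Longrightarrow> smooth (f i)) \<Longrightarrow> smooth (\<lambda>x. \<Sum>i\<in>I. f i x)"
  by (simp add: smooth_def Ck_sum)

lemma smooth_linear: "bounded_linear h \<Longrightarrow> smooth h"
  by (simp add: smooth_def Ck_linear)

lemma smooth_linear_compose: "bounded_linear h \<Longrightarrow> smooth f \<Longrightarrow> smooth (\<lambda>x. h (f x))"
  by (simp add: smooth_def Ck_linear_compose)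

lemma smooth_affine_compose:
  fixes A :: "'b::euclidean_space \<Rightarrow> 'a::euclidean_space"
  shows "bounded_linear A \<Longrightarrow> smooth f \<Longrightarrow> smooth (\<lambda>x. f (c + A x))"
  by (simp add: smooth_def Ck_affine_compose)

lemma smooth_real_compose:
  fixes g :: "'a::euclidean_space \<Rightarrow> real" and F :: "nat \<Rightarrow> real \<Rightarrow> 'b::real_normed_vector"
  assumes "\<And>n t. (F n has_vector_derivative F (Suc n) t) (at t)" "smooth g"
  shows "smooth (\<lambda>x. F n (g x))"
proof -
  have "Ck k (\<lambda>x. F n (g x))" for k
  proof (rule Ck_real_compose[where F = F and g = g and k = k and n = n])
    show "Ck k g" using assms(2) by (simp add: smooth_def)
  qed (rule assms(1))
  then show ?thesis by (simp add: smooth_def)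
qed

text \<open>\<open>Ck\<close> speaks of basis directions only, so an arbitrary direction v is
  expanded in the basis.\<close>

lemma smooth_pd:
  assumes "smooth f"
  shows "smooth (pd v f)"
proof -
  have "pd v f = (\<lambda>x. \<Sum>i\<in>Basis. (v \<bullet> i) *\<^sub>R pd i f x)"
    by (rule ext) (rule pd_basis_sum[OF smooth_differentiable[OF assms]])
  moreover have "smooth (pd i f)" if "i \<in> Basis" for i
  proof -
    have "Ck (Suc k) f" for k using assms by (simp only: smooth_def)
    then show ?thesis using that by (simp add: smooth_def)
  qed
  ultimately show ?thesis by (simp add: smooth_sum smooth_scaleR smooth_const)
qed

lemma pd_eqI: "(f has_derivative D) (at x) \<Longrightarrow> pd v f x = D v"
  using frechet_derivative_at by metis

lemma pd_add_direction: "smooth f \<Longrightarrow> pd (a + b) f x = pd a f x + pd b f x"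
  using smooth_has_derivative[of f x] by (simp add: has_derivative_def bounded_linear.linear linear_add)

lemma pd_scaleR_direction: "smooth f \<Longrightarrow> pd (r *\<^sub>R a) f x = r *\<^sub>R pd a f x"
  using smooth_has_derivative[of f x] by (simp add: has_derivative_def bounded_linear.linear linear_scale)

lemma pd_lincomb:
  assumes "smooth f" "smooth g"
  shows "pd v (\<lambda>x. f x + (c::complex) * g x) x = pd v f x + c * pd v g x"
  by (rule pd_eqI, intro has_derivative_add has_derivative_mult_right smooth_has_derivative assms)

lemma pd_mult:
  fixes f g :: "'a::euclidean_space \<Rightarrow> 'b::real_normed_algebra"
  assumes "smooth f" "smooth g"
  shows "pd v (\<lambda>x. f x * g x) x = f x * pd v g x + pd v f x * g x"
  by (rule pd_eqI, intro has_derivative_mult smooth_has_derivative assms)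

lemma pd_cnj:
  assumes "smooth f"
  shows "pd v (\<lambda>x. cnj (f x)) x = cnj (pd v f x)"
  by (rule pd_eqI, intro has_derivative_cnj smooth_has_derivative assms)

subsection \<open>Flat functions\<close>

definition flat :: "real \<Rightarrow> real \<Rightarrow> real" where
  "flat d t = (if t > 0 then exp (- d / t) else 0)"

text \<open>With s = 1 / t, the derivative of p(s) exp(-d s) with respect to t is s^2 (d p(s) -
  p'(s)) exp(-d s). The recursion records this step, \<open>[:0, 0, 1:]\<close> being s^2.\<close>

primrec flat_poly :: "real \<Rightarrow> nat \<Rightarrow> real poly" where
  "flat_poly d 0 = 1"
| "flat_poly d (Suc n) = [:0, 0, 1:] * (smult d (flat_poly d n) - pderiv (flat_poly d n))"

definition flat_deriv :: "real \<Rightarrow> nat \<Rightarrow> real \<Rightarrow> real" where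
  "flat_deriv d n t = (if t > 0 then poly (flat_poly d n) (1 / t) * exp (- d / t) else 0)"

text \<open>Substituting x = 1 / t turns this into the decay of a polynomial times exp(-d x) at
  infinity.\<close>

lemma flat_poly_tendsto:
  assumes "d > 0"
  shows "((\<lambda>t. poly p (1 / t) * exp (- d / t)) \<longlongrightarrow> 0) (at_right (0::real))"
proof -
  have pow: "((\<lambda>x. x ^ n * exp (- (d * x))) \<longlongrightarrow> 0) at_top" for n
  proof -
    have "filterlim (\<lambda>x. d * x) at_top at_top"
      using assms by (simp add: filterlim_tendsto_pos_mult_at_top[OF tendsto_const _ filterlim_ident])
    from filterlim_compose[OF tendsto_power_div_exp_0 this]
    have "((\<lambda>x. (1 / d ^ n) * ((d * x) ^ n / exp (d * x))) \<longlongrightarrow> (1 / d ^ n) * 0) at_top"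
      by (intro tendsto_mult tendsto_const)
    then show ?thesis using assms by (simp add: power_mult_distrib exp_minus field_simps)
  qed
  have "((\<lambda>x. \<Sum>i\<le>degree p. coeff p i * (x ^ i * exp (- (d * x)))) \<longlongrightarrow> (\<Sum>i\<le>degree p. coeff p i * 0)) at_top"
    by (intro tendsto_sum tendsto_mult tendsto_const pow)
  then have "((\<lambda>x. poly p x * exp (- (d * x))) \<longlongrightarrow> 0) at_top"
    by (simp add: poly_altdef sum_distrib_right mult.assoc)
  from filterlim_compose[OF this filterlim_inverse_at_top_right]
  show ?thesis by (simp add: field_simps)
qed

lemma flat_deriv_has_derivative:
  assumes "d > 0"
  shows "(flat_deriv d n has_real_derivative flat_deriv d (Suc n) t) (at t)"
proof -
  consider "t > 0" | "t < 0" | "t = 0" by linarith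
  then show ?thesis
  proof cases
    case 1
    have "((\<lambda>t. poly (flat_poly d n) (1 / t) * exp (- d / t)) has_real_derivative
        flat_deriv d (Suc n) t) (at t)"
      using 1 by (auto intro!: derivative_eq_intros DERIV_chain2[OF poly_DERIV]
        simp: flat_deriv_def field_simps power2_eq_square)
    moreover have "\<forall>\<^sub>F s in nhds t. flat_deriv d n s = poly (flat_poly d n) (1 / s) * exp (- d / s)"
      using eventually_nhds_in_open[of "{0<..}" t] 1
      by (auto simp: flat_deriv_def elim!: eventually_mono)
    ultimately show ?thesis by (subst DERIV_cong_ev[OF refl _ refl])
  next
    case 2
    have "\<forall>\<^sub>F s in nhds t. flat_deriv d n s = 0"
      using eventually_nhds_in_open[of "{..<0}" t] 2
      by (auto simp: flat_deriv_def elim!: eventually_mono)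
    moreover have "((\<lambda>s. 0) has_real_derivative flat_deriv d (Suc n) t) (at t)"
      using 2 by (simp add: flat_deriv_def)
    ultimately show ?thesis by (subst DERIV_cong_ev[OF refl _ refl])
  next
    case 3
    \<comment> \<open>Dividing by h multiplies the polynomial in 1 / h by its variable
      (\<open>pCons 0\<close>), so the difference quotient at 0 is again covered by
      \<open>flat_poly_tendsto\<close>.\<close>
    have "((\<lambda>h. flat_deriv d n h / h) \<longlongrightarrow> 0) (at_right 0)"
    proof (rule Lim_transform_eventually)
      show "((\<lambda>t. poly (pCons 0 (flat_poly d n)) (1 / t) * exp (- d / t)) \<longlongrightarrow> 0) (at_right 0)"
        by (rule flat_poly_tendsto[OF assms])
      show "\<forall>\<^sub>F t in at_right 0. poly (pCons 0 (flat_poly d n)) (1 / t) * exp (- d / t) = flat_deriv d n t / t"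
        by (auto simp: eventually_at_filter flat_deriv_def)
    qed
    moreover have "((\<lambda>h. flat_deriv d n h / h) \<longlongrightarrow> 0) (at_left 0)"
      by (rule Lim_transform_eventually[OF tendsto_const]) (auto simp: eventually_at_filter flat_deriv_def)
    ultimately have "((\<lambda>h. flat_deriv d n h / h) \<longlongrightarrow> 0) (at 0)"
      by (simp add: filterlim_split_at)
    then show ?thesis using 3 by (simp add: DERIV_def flat_deriv_def)
  qed
qed

lemma flat_deriv_0: "flat_deriv d 0 = flat d"
  by (auto simp: flat_deriv_def flat_def)

lemma flat_has_derivative:
  assumes "d > 0"
  shows "(flat d has_real_derivative (if t > 0 then d / t\<^sup>2 * exp (- d / t) else 0)) (at t)"
proof -
  have "flat_deriv d (Suc 0) t = (if t > 0 then d / t\<^sup>2 * exp (- d / t) else 0)"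
    by (simp add: flat_deriv_def power2_eq_square)
  then show ?thesis
    using flat_deriv_has_derivative[OF assms, of 0 t] by (simp only: flat_deriv_0)
qed

lemma smooth_flat:
  assumes "d > 0" "smooth g"
  shows "smooth (\<lambda>x. flat d (g x))"
  using smooth_real_compose[where F = "flat_deriv d", OF _ assms(2), of 0] flat_deriv_has_derivative[OF assms(1)]
  by (simp add: flat_deriv_0 has_real_derivative_iff_has_vector_derivative)

lemma flat_bounds: "0 \<le> flat d t" "d \<ge> 0 \<Longrightarrow> flat d t \<le> 1"
  by (auto simp: flat_def)

subsection \<open>A bump function\<close>

text \<open>
  As \<open>d\<close> tends to 0 this approaches \<open>max 0 (1 - t\<^sup>2)\<close>, while the bound \<open>2 \<bar>t\<bar>\<close> for the derivative
  holds for all \<open>d\<close>, so that Rayleigh quotients can be estimated without a limit.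
\<close>

definition bump :: "real \<Rightarrow> real \<Rightarrow> real" where
  "bump d t = (1 - t\<^sup>2) * flat d (1 - t\<^sup>2)"

lemma smooth_bump:
  assumes "d > 0" "smooth g"
  shows "smooth (\<lambda>x. bump d (g x))"
proof -
  have "smooth (\<lambda>x. 1 + (- 1) * (g x * g x))"
    by (intro smooth_add smooth_mult smooth_const assms)
  then have "smooth (\<lambda>x. 1 - (g x)\<^sup>2)" by (simp add: power2_eq_square)
  then show ?thesis unfolding bump_def
    by (intro smooth_mult smooth_flat assms)
qed

lemma bump_eq_0: "\<bar>t\<bar> \<ge> 1 \<Longrightarrow> bump d t = 0"
  using power_mono[of 1 "\<bar>t\<bar>" 2] by (auto simp: bump_def flat_def)

lemma bump_has_derivative:
  assumes "d > 0"
  shows "(bump d has_real_derivative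
    (if \<bar>t\<bar> < 1 then - 2 * t * (1 + d / (1 - t\<^sup>2)) * exp (- d / (1 - t\<^sup>2)) else 0)) (at t)"
proof -
  have "(bump d has_real_derivative
     ((1 - t\<^sup>2) * ((if 1 - t\<^sup>2 > 0 then d / (1 - t\<^sup>2)\<^sup>2 * exp (- d / (1 - t\<^sup>2)) else 0) * (- 2 * t)) +
      (- 2 * t) * flat d (1 - t\<^sup>2))) (at t)"
  proof -
    have *: "((\<lambda>t. 1 - t\<^sup>2) has_real_derivative - 2 * t) (at t)"
      by (auto intro!: derivative_eq_intros)
    show ?thesis unfolding bump_def
      using DERIV_mult'[OF * DERIV_chain2[OF flat_has_derivative[OF assms] *]] by simp
  qed
  moreover have "(1 - t\<^sup>2) * ((if 1 - t\<^sup>2 > 0 then d / (1 - t\<^sup>2)\<^sup>2 * exp (- d / (1 - t\<^sup>2)) else 0) * (- 2 * t)) +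
      (- 2 * t) * flat d (1 - t\<^sup>2) =
     (if \<bar>t\<bar> < 1 then - 2 * t * (1 + d / (1 - t\<^sup>2)) * exp (- d / (1 - t\<^sup>2)) else 0)"
  proof (cases "\<bar>t\<bar> < 1")
    case True
    define s where "s = 1 - t\<^sup>2"
    have "s > 0" using True abs_square_less_1[of t] by (auto simp: s_def)
    then show ?thesis using True unfolding s_def[symmetric] flat_def
      by (simp add: field_simps power2_eq_square)
  next
    case False
    then have "\<not> 1 - t\<^sup>2 > 0" using abs_square_less_1[of t] by auto
    then show ?thesis using False by (simp add: flat_def)
  qed
  ultimately show ?thesis by simp
qed

text \<open>With s = d / (1 - t^2) the extra factor is (1 + s) exp(-s), which is at most 1 because
  exp s \<ge> 1 + s; hence the bound is uniform in d.\<close>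

lemma bump_deriv_bound:
  fixes t d :: real
  assumes "d > 0"
  shows "\<bar>if \<bar>t\<bar> < 1 then - 2 * t * (1 + d / (1 - t\<^sup>2)) * exp (- d / (1 - t\<^sup>2)) else 0\<bar> \<le> 2 * \<bar>t\<bar>"
proof (cases "\<bar>t\<bar> < 1")
  case True
  define s where "s = d / (1 - t\<^sup>2)"
  have "1 - t\<^sup>2 > 0" using True abs_square_less_1[of t] by auto
  then have "s \<ge> 0" using assms by (simp add: s_def)
  have "(1 + s) * exp (- s) \<le> 1"
    using exp_ge_add_one_self[of s] by (simp add: exp_minus field_simps)
  then have "2 * \<bar>t\<bar> * ((1 + s) * exp (- s)) \<le> 2 * \<bar>t\<bar> * 1"
    by (intro mult_left_mono) auto
  then show ?thesis using True \<open>s \<ge> 0\<close> by (simp add: s_def abs_mult mult.assoc)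
qed auto

text \<open>Follows from exp(-2 d / s) \<ge> 1 - 2 d / s with s = 1 - t^2. The minorant is a
  polynomial, so its integral is explicit.\<close>

lemma bump_lower:
  assumes "\<bar>t\<bar> < 1"
  shows "(1 - t\<^sup>2)\<^sup>2 - 2 * d * (1 - t\<^sup>2) \<le> (bump d t)\<^sup>2"
proof -
  define s where "s = 1 - t\<^sup>2"
  have "s > 0" using assms abs_square_less_1[of t] by (auto simp: s_def)
  have "1 + - 2 * (d / s) \<le> exp (- 2 * (d / s))" by (rule exp_ge_add_one_self)
  also have "\<dots> = (exp (- d / s))\<^sup>2" by (simp flip: exp_of_nat_mult exp_double)
  finally have "s\<^sup>2 * (1 - 2 * (d / s)) \<le> s\<^sup>2 * (exp (- d / s))\<^sup>2" by (intro mult_left_mono) auto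
  moreover have "s\<^sup>2 * (1 - 2 * (d / s)) = s\<^sup>2 - 2 * d * s"
    using \<open>s > 0\<close> by (simp add: power2_eq_square field_simps)
  moreover have "(bump d t)\<^sup>2 = s\<^sup>2 * (exp (- d / s))\<^sup>2"
    using \<open>s > 0\<close> by (simp add: bump_def flat_def power_mult_distrib flip: s_def)
  ultimately show ?thesis unfolding s_def[symmetric] by simp
qed

section \<open>Test functions\<close>

lemma test_functionsI:
  assumes "smooth f" "compact K" "K \<subseteq> \<Omega>" "\<And>x. x \<notin> K \<Longrightarrow> f x = 0"
  shows "f \<in> test_functions \<Omega>"
proof -
  have "closure {x. f x \<noteq> 0} \<subseteq> K"
    using assms by (intro closure_minimal compact_imp_closed) auto
  then show ?thesis
    using assms compact_Int_closed[OF assms(2), of "closure {x. f x \<noteq> 0}"]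
    unfolding test_functions_def smooth_def by (auto simp: Int_absorb1)
qed

lemma test_support:
  assumes "f \<in> test_functions \<Omega>"
  shows "\<exists>K. compact K \<and> K \<subseteq> \<Omega> \<and> (\<forall>x. x \<notin> K \<longrightarrow> f x = 0)"
  using assms closure_subset[of "{x. f x \<noteq> 0}"] unfolding test_functions_def
  by (intro exI[of _ "closure {x. f x \<noteq> 0}"]) auto

lemma test_smooth: "f \<in> test_functions \<Omega> \<Longrightarrow> smooth f"
  by (simp add: test_functions_def smooth_def)

lemma test_eq_0: "f \<in> test_functions \<Omega> \<Longrightarrow> x \<notin> \<Omega> \<Longrightarrow> f x = 0"
  using test_support[of f \<Omega>] by auto

lemma test_continuous: "f \<in> test_functions \<Omega> \<Longrightarrow> continuous_on S f"
  by (rule smooth_continuous[OF test_smooth])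

lemma pd_eq_0:
  assumes "compact K" "\<And>y. y \<notin> K \<Longrightarrow> f y = 0" "x \<notin> K"
  shows "pd v f x = 0"
proof -
  have "(f has_derivative (\<lambda>_. 0)) (at x)"
  proof (rule has_derivative_transform_within_open[of "\<lambda>_. 0" _ _ _ "- K"])
    show "open (- K)" using assms(1) by (simp add: compact_imp_closed open_Compl)
  qed (use assms in auto)
  then show ?thesis by (rule pd_eqI)
qed

lemma test_pd:
  assumes "f \<in> test_functions \<Omega>"
  shows "pd v f \<in> test_functions \<Omega>"
proof -
  obtain K where "compact K" "K \<subseteq> \<Omega>" "\<And>x. x \<notin> K \<Longrightarrow> f x = 0" using test_support[OF assms] by auto
  then show ?thesis
    by (intro test_functionsI[of _ K] smooth_pd test_smooth[OF assms]) (auto intro: pd_eq_0)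
qed

lemma test_lincomb:
  assumes "f \<in> test_functions \<Omega>" "g \<in> test_functions \<Omega>"
  shows "(\<lambda>x. f x + c * g x) \<in> test_functions \<Omega>"
proof -
  obtain K where K: "compact K" "K \<subseteq> \<Omega>" "\<And>x. x \<notin> K \<Longrightarrow> f x = 0" using test_support[OF assms(1)] by auto
  obtain L where L: "compact L" "L \<subseteq> \<Omega>" "\<And>x. x \<notin> L \<Longrightarrow> g x = 0" using test_support[OF assms(2)] by auto
  show ?thesis using K L
    by (intro test_functionsI[of _ "K \<union> L"] smooth_add smooth_mult smooth_const test_smooth[OF assms(1)]
         test_smooth[OF assms(2)]) auto
qed

lemma test_mult:
  assumes "f \<in> test_functions \<Omega>" "smooth g"
  shows "(\<lambda>x. f x * g x) \<in> test_functions \<Omega>"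
proof -
  obtain K where K: "compact K" "K \<subseteq> \<Omega>" "\<And>x. x \<notin> K \<Longrightarrow> f x = 0" using test_support[OF assms(1)] by auto
  show ?thesis
  proof (rule test_functionsI[OF _ K(1,2)])
    show "smooth (\<lambda>x. f x * g x)" by (rule smooth_mult[OF test_smooth[OF assms(1)] assms(2)])
  qed (simp add: K(3))
qed

lemma test_cnj:
  assumes "f \<in> test_functions \<Omega>"
  shows "(\<lambda>x. cnj (f x)) \<in> test_functions \<Omega>"
proof -
  obtain K where K: "compact K" "K \<subseteq> \<Omega>" "\<And>x. x \<notin> K \<Longrightarrow> f x = 0" using test_support[OF assms] by auto
  show ?thesis
  proof (rule test_functionsI[OF _ K(1,2)])
    show "smooth (\<lambda>x. cnj (f x))"
      by (rule smooth_linear_compose[OF bounded_linear_cnj test_smooth[OF assms]])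
  qed (simp add: K(3))
qed

section \<open>Integration over the whole space: compact supports, translations, integration by
  parts\<close>

lemma integrable_compact_support:
  fixes f :: "'a::euclidean_space \<Rightarrow> 'b::{banach, second_countable_topology}"
  assumes "continuous_on UNIV f" "compact K" "\<And>x. x \<notin> K \<Longrightarrow> f x = 0"
  shows "integrable lborel f"
proof -
  have "(\<lambda>x. indicator K x *\<^sub>R f x) = f" using assms(3) by (auto simp: indicator_def)
  then show ?thesis
    using borel_integrable_compact[OF assms(2) continuous_on_subset[OF assms(1)]] by simp
qed

lemma test_integrable: "f \<in> test_functions \<Omega> \<Longrightarrow> integrable lborel f"
  using test_support[of f \<Omega>] test_continuous[of f \<Omega> UNIV] integrable_compact_support[of f] by auto

text \<open>The definitions integrate over \<open>lebesgue_on\<close>, whereas Fubini and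
  translations are applied to \<open>lborel\<close>; this is the bridge.\<close>

lemma borel_integral_lebesgue_on:
  fixes f :: "'a::euclidean_space \<Rightarrow> 'b::{banach, second_countable_topology}"
  assumes "open \<Omega>" "f \<in> borel_measurable borel" "\<And>x. x \<notin> \<Omega> \<Longrightarrow> f x = 0"
  shows "(LINT x|lebesgue_on \<Omega>. f x) = (LINT x|lborel. f x)"
    and "integrable (lebesgue_on \<Omega>) f \<longleftrightarrow> integrable lborel f"
proof -
  have [simp]: "(\<lambda>x. indicator \<Omega> x *\<^sub>R f x) = f" using assms(3) by (auto simp: indicator_def)
  have [measurable]: "\<Omega> \<in> sets lebesgue" using assms(1) by (simp add: borel_open)
  show "(LINT x|lebesgue_on \<Omega>. f x) = (LINT x|lborel. f x)"
    using assms(2) by (simp add: integral_restrict_space integral_completion)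
  show "integrable (lebesgue_on \<Omega>) f \<longleftrightarrow> integrable lborel f"
    using assms(2) by (simp add: integrable_restrict_space integrable_completion)
qed

lemma integral_translation:
  fixes f :: "'a::euclidean_space \<Rightarrow> 'b::{banach, second_countable_topology}"
  assumes "f \<in> borel_measurable borel"
  shows "(LINT x|lborel. f (c + x)) = (LINT x|lborel. f x)"
  using integral_distr[of "(+) c" lborel borel f] assms by (simp add: lborel_distr_plus)

lemma integrable_translation:
  fixes f :: "'a::euclidean_space \<Rightarrow> 'b::{banach, second_countable_topology}"
  assumes "integrable lborel f"
  shows "integrable lborel (\<lambda>x. f (c + x))"
  using integrable_distr[of "(+) c" lborel borel f] assms by (simp add: lborel_distr_plus)

lemma nn_integral_translation:
  fixes f :: "'a::euclidean_space \<Rightarrow> ennreal"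
  assumes "f \<in> borel_measurable borel"
  shows "(\<integral>\<^sup>+x. f (c + x) \<partial>lborel) = (\<integral>\<^sup>+x. f x \<partial>lborel)"
  using nn_integral_distr[of "(+) c" lborel borel f] assms by (simp add: lborel_distr_plus)

lemma pd_line_derivative:
  fixes f :: "'a::euclidean_space \<Rightarrow> 'b::real_normed_vector"
  assumes "smooth f"
  shows "((\<lambda>s. f (x + s *\<^sub>R v)) has_vector_derivative pd v f (x + s *\<^sub>R v)) (at s within S)"
proof -
  have "((\<lambda>s. x + s *\<^sub>R v) has_derivative (\<lambda>h. h *\<^sub>R v)) (at s within S)"
    by (auto intro!: derivative_eq_intros)
  from has_derivative_compose[OF this smooth_has_derivative[OF assms]]
  have "((\<lambda>s. f (x + s *\<^sub>R v)) has_derivative (\<lambda>h. pd (h *\<^sub>R v) f (x + s *\<^sub>R v))) (at s within S)" by simp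
  then show ?thesis
    by (simp add: has_vector_derivative_def pd_scaleR_direction[OF assms])
qed

lemma pd_line_integral:
  fixes f :: "'a::euclidean_space \<Rightarrow> 'b::euclidean_space"
  assumes "smooth f" "a \<le> b"
  shows "(LINT s|lborel. indicator {a..b} s *\<^sub>R pd v f (x + s *\<^sub>R v)) = f (x + b *\<^sub>R v) - f (x + a *\<^sub>R v)"
  by (rule integral_FTC_atLeastAtMost[OF assms(2) pd_line_derivative[OF assms(1)]])
     (intro continuous_on_compose2[OF smooth_continuous[OF smooth_pd[OF assms(1)]]] continuous_intros, auto)

text \<open>By translation invariance f (x + v) - f x has integral 0, and it is the integral over s
  in [0, 1] of the directional derivative at x + s v. After Fubini every s contributes the same
  integral of \<open>pd v f\<close>, so no coordinates adapted to v are introduced.\<close>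

lemma integral_pd_zero:
  fixes f :: "'a::euclidean_space \<Rightarrow> complex"
  assumes "f \<in> test_functions \<Omega>"
  shows "(LINT x|lborel. pd v f x) = 0"
proof -
  note sm = test_smooth[OF assms]
  let ?h = "pd v f"
  obtain K where K: "compact K" "\<And>x. x \<notin> K \<Longrightarrow> f x = 0" using test_support[OF assms] by auto
  have cont: "continuous_on S ?h" for S by (rule smooth_continuous[OF smooth_pd[OF sm]])
  have [measurable]: "?h \<in> borel_measurable borel" "f \<in> borel_measurable borel"
    by (rule borel_measurable_continuous_onI[OF cont],
        rule borel_measurable_continuous_onI[OF smooth_continuous[OF sm]])
  \<comment> \<open>All x with x + s v in K for some s in [0, 1]. This set is compact, so the
    integrand in (x, s) is integrable on the product and Fubini applies.\<close>
  let ?L = "(\<lambda>(y, s). y - s *\<^sub>R v) ` (K \<times> {0..1::real})"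
  have "compact ?L"
    by (intro compact_continuous_image compact_Times K) (auto intro!: continuous_intros simp: split_beta)
  have zero: "?h (x + s *\<^sub>R v) = 0" if "s \<in> {0..1}" "x \<notin> ?L" for x s
  proof (rule pd_eq_0[OF K])
    show "x + s *\<^sub>R v \<notin> K"
    proof
      assume "x + s *\<^sub>R v \<in> K"
      then have "x \<in> ?L" using that(1) by (intro image_eqI[of _ _ "(x + s *\<^sub>R v, s)"]) auto
      then show False using that by simp
    qed
  qed
  have "integrable lborel (\<lambda>p. indicator (?L \<times> {0..1}) p *\<^sub>R ?h (fst p + snd p *\<^sub>R v))"
    by (intro borel_integrable_compact compact_Times \<open>compact ?L\<close> compact_Icc
        continuous_on_compose2[OF cont] continuous_intros) auto
  also have "(\<lambda>p. indicator (?L \<times> {0..1}) p *\<^sub>R ?h (fst p + snd p *\<^sub>R v)) =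
      (\<lambda>(x, s). indicator {0..1} s *\<^sub>R ?h (x + s *\<^sub>R v))"
    using zero by (auto simp: fun_eq_iff indicator_def)
  finally have int: "integrable (lborel \<Otimes>\<^sub>M lborel) (\<lambda>(x, s). indicator {0..1::real} s *\<^sub>R ?h (x + s *\<^sub>R v))"
    by (simp add: lborel_prod)
  have "(LINT s|lborel. (LINT x|lborel. indicator {0..1::real} s *\<^sub>R ?h (x + s *\<^sub>R v)))
     = (LINT x|lborel. (LINT s|lborel. indicator {0..1::real} s *\<^sub>R ?h (x + s *\<^sub>R v)))"
    using lborel_pair.Fubini_integral[OF int] by simp
  also have "\<dots> = (LINT x|lborel. f (v + x) - f x)"
    by (subst pd_line_integral[OF sm]) (auto simp: add.commute)
  also have "\<dots> = 0"
    using integral_translation[of f v] test_integrable[OF assms] integrable_translation[OF test_integrable[OF assms], of v]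
    by simp
  also have "(LINT x|lborel. indicator {0..1::real} s *\<^sub>R ?h (x + s *\<^sub>R v)) = indicator {0..1} s *\<^sub>R (LINT x|lborel. ?h x)" for s
    using integral_translation[of ?h "s *\<^sub>R v"] by (simp add: add.commute)
  then have "(LINT s|lborel. (LINT x|lborel. indicator {0..1::real} s *\<^sub>R ?h (x + s *\<^sub>R v)))
     = (LINT s|lborel. indicator {0..1::real} s *\<^sub>R (LINT x|lborel. ?h x))"
    by (simp only:)
  then have "(LINT s|lborel. (LINT x|lborel. indicator {0..1::real} s *\<^sub>R ?h (x + s *\<^sub>R v)))
     = (LINT x|lborel. ?h x)"
    by simp
  finally show ?thesis by simp
qed

lemma integral_by_parts:
  assumes "f \<in> test_functions \<Omega>" "smooth g"
  shows "(LINT x|lborel. f x * pd v g x) = - (LINT x|lborel. pd v f x * g x)"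
proof -
  have 1: "integrable lborel (\<lambda>x. f x * pd v g x)"
    by (intro test_integrable[OF test_mult[OF assms(1) smooth_pd[OF assms(2)]]])
  have 2: "integrable lborel (\<lambda>x. pd v f x * g x)"
    by (intro test_integrable[OF test_mult[OF test_pd[OF assms(1)] assms(2)]])
  have "0 = (LINT x|lborel. pd v (\<lambda>x. f x * g x) x)"
    using integral_pd_zero[OF test_mult[OF assms]] by simp
  also have "\<dots> = (LINT x|lborel. f x * pd v g x + pd v f x * g x)"
    by (subst pd_mult[OF test_smooth[OF assms(1)] assms(2)]) simp
  also have "\<dots> = (LINT x|lborel. f x * pd v g x) + (LINT x|lborel. pd v f x * g x)"
    using 1 2 by simp
  finally show ?thesis by (simp add: eq_neg_iff_add_eq_0)
qed

section \<open>The space \<open>L2\<close>\<close>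

lemma cmod_power2_eq_Re: "(cmod z)\<^sup>2 = Re (z * cnj z)"
  by (simp only: complex_norm_square[symmetric] Re_complex_of_real)

text \<open>The choice c = -B / C minimises the quadratic; for C = 0 a large negative multiple of B
  would make it negative unless B = 0. Stated for abstract numbers because it serves
  \<open>L2_inner\<close>, integrals over an interval, and the form energy minus mass, of which only
  semidefiniteness is known.\<close>

lemma quadratic_form_cauchy_schwarz:
  fixes A C :: real and B :: complex
  assumes "\<And>c. 0 \<le> A + 2 * Re (cnj c * B) + (cmod c)\<^sup>2 * C" "0 \<le> C"
  shows "cmod B \<le> sqrt A * sqrt C"
proof -
  have r: "Re (cnj (complex_of_real r * B) * B) = r * (cmod B)\<^sup>2" for r
    by (simp add: cmod_power2) (simp add: power2_eq_square algebra_simps)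
  have "(cmod B)\<^sup>2 \<le> A * C"
  proof (cases "C = 0")
    case False
    then have "C > 0" using assms(2) by simp
    have "0 \<le> A + 2 * ((- 1 / C) * (cmod B)\<^sup>2) + (cmod B / C)\<^sup>2 * C"
      using assms(1)[of "complex_of_real (- 1 / C) * B"] \<open>C > 0\<close> unfolding r
      by (simp add: norm_mult norm_divide)
    also have "\<dots> = A - (cmod B)\<^sup>2 / C" using \<open>C > 0\<close> by (simp add: power2_eq_square field_simps)
    finally show ?thesis using \<open>C > 0\<close> by (simp add: field_simps)
  next
    case True
    show ?thesis
    proof (rule ccontr)
      assume "\<not> ?thesis"
      then have pos: "(cmod B)\<^sup>2 > 0" using True by simp
      have "0 \<le> A + 2 * ((- (\<bar>A\<bar> + 1) / (cmod B)\<^sup>2) * (cmod B)\<^sup>2)"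
        using assms(1)[of "complex_of_real (- (\<bar>A\<bar> + 1) / (cmod B)\<^sup>2) * B"] True unfolding r by simp
      also have "\<dots> = A - 2 * (\<bar>A\<bar> + 1)" using pos by simp
      finally have "2 + 2 * \<bar>A\<bar> \<le> A" by (simp add: algebra_simps)
      then show False by (cases "A \<ge> 0") auto
    qed
  qed
  then have "cmod B \<le> sqrt (A * C)" by (simp add: real_le_rsqrt)
  then show ?thesis by (simp add: real_sqrt_mult)
qed

lemma L2_measurable: "f \<in> L2 \<Omega> \<Longrightarrow> f \<in> borel_measurable (lebesgue_on \<Omega>)"
  and L2_integrable: "f \<in> L2 \<Omega> \<Longrightarrow> integrable (lebesgue_on \<Omega>) (\<lambda>x. (cmod (f x))\<^sup>2)"
  by (auto simp: L2_def)

lemma L2_norm_power2: "(L2_norm \<Omega> f)\<^sup>2 = (LINT x|lebesgue_on \<Omega>. (cmod (f x))\<^sup>2)"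
  unfolding L2_norm_def by (simp add: integral_nonneg_AE)

lemma L2_norm_nonneg: "0 \<le> L2_norm \<Omega> f"
  unfolding L2_norm_def by (simp add: integral_nonneg_AE)

lemma cmod_lincomb_power2:
  "(cmod (a + c * b))\<^sup>2 = (cmod a)\<^sup>2 + 2 * Re (cnj c * (a * cnj b)) + (cmod c)\<^sup>2 * (cmod b)\<^sup>2"
  by (simp add: cmod_power2) (simp add: power2_eq_square algebra_simps)

lemma L2_inner_integrable:
  assumes "f \<in> L2 \<Omega>" "g \<in> L2 \<Omega>"
  shows "integrable (lebesgue_on \<Omega>) (\<lambda>x. f x * cnj (g x))"
proof (rule Bochner_Integration.integrable_bound)
  show "integrable (lebesgue_on \<Omega>) (\<lambda>x. (cmod (f x))\<^sup>2 + (cmod (g x))\<^sup>2)"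
    by (intro Bochner_Integration.integrable_add L2_integrable assms)
  note [measurable] = L2_measurable[OF assms(1)] L2_measurable[OF assms(2)]
  have [measurable]: "cnj \<in> borel_measurable borel"
    by (intro borel_measurable_continuous_onI continuous_intros)
  show "(\<lambda>x. f x * cnj (g x)) \<in> borel_measurable (lebesgue_on \<Omega>)" by measurable
  have "a * b \<le> \<bar>a\<^sup>2 + b\<^sup>2\<bar>" if "a \<ge> 0" "b \<ge> 0" for a b :: real
    using sum_squares_bound[of a b] that mult_nonneg_nonneg[of a b] by linarith
  then show "AE x in lebesgue_on \<Omega>. norm (f x * cnj (g x)) \<le> norm ((cmod (f x))\<^sup>2 + (cmod (g x))\<^sup>2)"
    by (simp add: norm_mult)
qed

lemma L2_lincomb:
  assumes "f \<in> L2 \<Omega>" "g \<in> L2 \<Omega>"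
  shows "(\<lambda>x. f x + c * g x) \<in> L2 \<Omega>"
    and "(L2_norm \<Omega> (\<lambda>x. f x + c * g x))\<^sup>2 =
      (L2_norm \<Omega> f)\<^sup>2 + 2 * Re (cnj c * L2_inner \<Omega> f g) + (cmod c)\<^sup>2 * (L2_norm \<Omega> g)\<^sup>2"
proof -
  note [measurable] = L2_measurable[OF assms(1)] L2_measurable[OF assms(2)]
  note i = L2_integrable[OF assms(1)] L2_integrable[OF assms(2)]
     integrable_mult_right[OF L2_inner_integrable[OF assms], of "cnj c"]
  have eq: "(\<lambda>x. (cmod (f x + c * g x))\<^sup>2) =
      (\<lambda>x. (cmod (f x))\<^sup>2 + 2 * Re (cnj c * (f x * cnj (g x))) + (cmod c)\<^sup>2 * (cmod (g x))\<^sup>2)"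
    by (simp add: cmod_lincomb_power2)
  have int: "integrable (lebesgue_on \<Omega>) (\<lambda>x. Re (cnj c * (f x * cnj (g x))))"
    by (intro integrable_Re i)
  have "integrable (lebesgue_on \<Omega>) (\<lambda>x. (cmod (f x + c * g x))\<^sup>2)"
    unfolding eq by (intro Bochner_Integration.integrable_add integrable_mult_right i int)
  then show "(\<lambda>x. f x + c * g x) \<in> L2 \<Omega>" unfolding L2_def by simp
  show "(L2_norm \<Omega> (\<lambda>x. f x + c * g x))\<^sup>2 =
      (L2_norm \<Omega> f)\<^sup>2 + 2 * Re (cnj c * L2_inner \<Omega> f g) + (cmod c)\<^sup>2 * (L2_norm \<Omega> g)\<^sup>2"
  proof -
    have "Re (cnj c * L2_inner \<Omega> f g) = (LINT x|lebesgue_on \<Omega>. Re (cnj c * (f x * cnj (g x))))"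
      unfolding L2_inner_def integral_mult_right_zero[symmetric] by (rule integral_Re[OF i(3), symmetric])
    then show ?thesis
      unfolding L2_norm_power2 eq using i(1,2) int
      by (simp only: Bochner_Integration.integral_add Bochner_Integration.integrable_add
          integrable_mult_right integral_mult_right_zero)
  qed
qed

lemma L2_cauchy_schwarz:
  assumes "f \<in> L2 \<Omega>" "g \<in> L2 \<Omega>"
  shows "cmod (L2_inner \<Omega> f g) \<le> L2_norm \<Omega> f * L2_norm \<Omega> g"
proof -
  have "cmod (L2_inner \<Omega> f g) \<le> sqrt ((L2_norm \<Omega> f)\<^sup>2) * sqrt ((L2_norm \<Omega> g)\<^sup>2)"
    by (rule quadratic_form_cauchy_schwarz) (simp_all only: L2_lincomb(2)[OF assms, symmetric] zero_le_power2)
  then show ?thesis by (simp add: L2_norm_nonneg)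
qed

lemma L2_triangle:
  assumes "f \<in> L2 \<Omega>" "g \<in> L2 \<Omega>"
  shows "L2_norm \<Omega> (\<lambda>x. f x + c * g x) \<le> L2_norm \<Omega> f + cmod c * L2_norm \<Omega> g"
proof (rule power2_le_imp_le)
  have "Re (cnj c * L2_inner \<Omega> f g) \<le> cmod c * cmod (L2_inner \<Omega> f g)"
    by (metis complex_Re_le_cmod complex_mod_cnj norm_mult)
  also have "\<dots> \<le> cmod c * (L2_norm \<Omega> f * L2_norm \<Omega> g)"
    by (intro mult_left_mono L2_cauchy_schwarz assms) auto
  finally show "(L2_norm \<Omega> (\<lambda>x. f x + c * g x))\<^sup>2 \<le> (L2_norm \<Omega> f + cmod c * L2_norm \<Omega> g)\<^sup>2"
    unfolding L2_lincomb(2)[OF assms] power2_sum power_mult_distrib by (simp only: mult.assoc mult.left_commute)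
qed (simp add: L2_norm_nonneg)

lemma test_in_L2:
  assumes "open \<Omega>" "f \<in> test_functions \<Omega>"
  shows "f \<in> L2 \<Omega>"
proof -
  have [measurable]: "f \<in> borel_measurable borel"
    by (intro borel_measurable_continuous_onI test_continuous[OF assms(2)])
  have "integrable lborel (\<lambda>x. f x * cnj (f x))"
    by (intro test_integrable[OF test_mult[OF assms(2) test_smooth[OF test_cnj[OF assms(2)]]]])
  then have "integrable lborel (\<lambda>x. (cmod (f x))\<^sup>2)"
    unfolding cmod_power2_eq_Re by (rule integrable_Re)
  moreover have "f \<in> borel_measurable (lebesgue_on \<Omega>)"
    by (intro measurable_restrict_space1) (simp add: measurable_completion)
  moreover have "integrable (lebesgue_on \<Omega>) (\<lambda>x. (cmod (f x))\<^sup>2) \<longleftrightarrow> integrable lborel (\<lambda>x. (cmod (f x))\<^sup>2)"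
    by (rule borel_integral_lebesgue_on[OF assms(1)]) (auto simp: test_eq_0[OF assms(2)])
  ultimately show ?thesis by (simp add: L2_def)
qed

lemma test_L2_inner:
  assumes "open \<Omega>" "f \<in> test_functions \<Omega>" "g \<in> test_functions \<Omega>"
  shows "L2_inner \<Omega> f g = (LINT x|lborel. f x * cnj (g x))"
    and "(L2_norm \<Omega> f)\<^sup>2 = (LINT x|lborel. (cmod (f x))\<^sup>2)"
proof -
  have [measurable]: "f \<in> borel_measurable borel" "g \<in> borel_measurable borel"
    using assms by (auto intro!: borel_measurable_continuous_onI test_continuous)
  have [measurable]: "cnj \<in> borel_measurable borel"
    by (intro borel_measurable_continuous_onI continuous_intros)
  show "L2_inner \<Omega> f g = (LINT x|lborel. f x * cnj (g x))" unfolding L2_inner_def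
    by (rule borel_integral_lebesgue_on[OF assms(1)]) (auto simp: test_eq_0[OF assms(2)])
  show "(L2_norm \<Omega> f)\<^sup>2 = (LINT x|lborel. (cmod (f x))\<^sup>2)" unfolding L2_norm_power2
    by (rule borel_integral_lebesgue_on[OF assms(1)]) (auto simp: test_eq_0[OF assms(2)])
qed

lemma test_power2_integrable:
  assumes "f \<in> test_functions \<Omega>"
  shows "integrable lborel (\<lambda>x. (cmod (f x))\<^sup>2)"
  unfolding cmod_power2_eq_Re
  by (intro integrable_Re test_integrable[OF test_mult[OF assms test_smooth[OF test_cnj[OF assms]]]])

text \<open>Boxes form an intersection-stable generator, so Dynkin's argument spreads the vanishing
  of integrals from boxes to Borel sets; Lebesgue sets differ from Borel sets by null sets.\<close>

lemma AE_zero_if_box_integrals_zero: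
  fixes G :: "'a::euclidean_space \<Rightarrow> complex"
  assumes int: "integrable lebesgue G"
    and box: "\<And>l u. (LINT x:box l u|lebesgue. G x) = 0"
  shows "AE x in lebesgue. G x = 0"
proof -
  have si: "set_integrable lebesgue A G" if "A \<in> sets lebesgue" for A
    unfolding set_integrable_def by (intro integrable_mult_indicator that int)
  \<comment> \<open>Exhaustion by boxes gives integral 0 over the whole space, as needed for
    complements in the Dynkin induction.\<close>
  let ?B = "\<lambda>n::nat. box (- (real n *\<^sub>R One)) (real n *\<^sub>R One) :: 'a set"
  have UN: "(\<Union>i. ?B i) = UNIV" by (rule UN_box_eq_UNIV)
  have "(\<lambda>i. LINT x:?B i|lebesgue. G x) \<longlonglongrightarrow> (LINT x:(\<Union>i. ?B i)|lebesgue. G x)"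
  proof (rule set_integral_cont_up)
    show "incseq ?B"
      by (force simp: incseq_def mem_box)
    show "set_integrable lebesgue (\<Union>i. ?B i) G" unfolding UN by (rule si) simp
  qed simp
  then have all: "(LINT x:UNIV|lebesgue. G x) = 0"
    unfolding UN box using LIMSEQ_unique tendsto_const by blast
  have borel: "(LINT x:A|lebesgue. G x) = 0" if "A \<in> sets borel" for A
  proof -
    let ?R = "range (\<lambda>(a, b). box a b :: 'a set)"
    have sub: "S \<in> sets lebesgue" if "S \<in> sigma_sets UNIV ?R" for S
    proof -
      have "S \<in> sets borel" using that by (simp add: borel_eq_box)
      then show ?thesis by (intro sets_completionI_sets) simp
    qed
    have "Int_stable ?R"
      by (auto simp: Int_stable_def box_Int_box)
    moreover have "?R \<subseteq> Pow UNIV" by simp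
    moreover have "A \<in> sigma_sets UNIV ?R" using that by (simp add: borel_eq_box)
    ultimately show ?thesis
    proof (induction rule: sigma_sets_induct_disjoint)
      case (basic A)
      then show ?case using box by auto
    next
      case (compl A)
      have "(LINT x:A \<union> (UNIV - A)|lebesgue. G x) = (LINT x:A|lebesgue. G x) + (LINT x:UNIV - A|lebesgue. G x)"
        using sub[OF compl(1)] by (intro set_integral_Un si) auto
      then show ?case using compl(2) all by simp
    next
      case (union A)
      have "(LINT x:(\<Union>i. A i)|lebesgue. G x) = (\<Sum>i. (LINT x:(A i)|lebesgue. G x))"
      proof (rule lebesgue_integral_countable_add)
        show m: "A i \<in> sets lebesgue" for i using union(2) by (intro sub) auto
        show "set_integrable lebesgue (\<Union>i. A i) G" by (intro si sets.countable_UN) (use m in auto)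
      qed (use union(1) in \<open>auto simp: disjoint_family_on_def\<close>)
      then show ?case using union(3) by simp
    qed (auto simp: set_lebesgue_integral_def)
  qed
  have "(LINT x:A|lebesgue. G x) = 0" if A: "A \<in> sets lebesgue" for A
  proof -
    obtain S N N' where A': "A = S \<union> N" "N \<subseteq> N'" "N' \<in> null_sets lborel" "S \<in> sets lborel"
      using A by (rule sets_completionE) auto
    have "N \<in> null_sets lebesgue"
      using A'(2,3) by (auto simp: null_sets_completion_iff2)
    then have "(LINT x:A|lebesgue. G x) = (LINT x:S|lebesgue. G x)"
    proof (intro set_integral_null_delta int A)
      show "S \<in> sets lebesgue" using A'(4) by simp
      show "A - S \<union> (S - A) \<in> null_sets lebesgue"
        by (rule null_sets_completion_subset[OF _ \<open>N \<in> null_sets lebesgue\<close>]) (use A' in auto)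
    qed
    then show ?thesis using borel A'(4) by simp
  qed
  moreover have "sigma_finite_measure (lebesgue :: 'a measure)"
  proof
    obtain A :: "'a set set" where "countable A" "A \<subseteq> sets lborel" "\<Union>A = space lborel"
      "\<And>a. a \<in> A \<Longrightarrow> emeasure lborel a \<noteq> \<infinity>"
      using lborel.sigma_finite_countable by metis
    then show "\<exists>A. countable A \<and> A \<subseteq> sets (lebesgue :: 'a measure) \<and> \<Union>A = space lebesgue \<and>
      (\<forall>a\<in>A. emeasure lebesgue a \<noteq> \<infinity>)"
      by (intro exI[of _ A]) (auto intro: sets_completionI_sets)
  qed
  ultimately show ?thesis
    using sigma_finite_measure.density_zero[OF _ int] by blast
qed

text \<open>Each factor tends to 1 as d tends to 0 where its argument is positive. So these are
  smooth functions below the indicator of the open box that converge to it pointwise.\<close>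

definition box_cutoff :: "'a::euclidean_space \<Rightarrow> 'a \<Rightarrow> real \<Rightarrow> 'a \<Rightarrow> complex" where
  "box_cutoff l u d x = of_real (\<Prod>b\<in>Basis. flat d (x \<bullet> b - l \<bullet> b) * flat d (u \<bullet> b - x \<bullet> b))"

lemma box_cutoff_test:
  assumes "d > 0" "cbox l u \<subseteq> \<Omega>"
  shows "box_cutoff l u d \<in> test_functions \<Omega>"
proof (rule test_functionsI[OF _ compact_cbox assms(2)])
  have lin: "smooth (\<lambda>x. a + r * (x \<bullet> b))" for a r and b :: 'a
    by (intro smooth_add smooth_mult smooth_const smooth_linear bounded_linear_inner_left)
  have "smooth (\<lambda>x. \<Prod>b\<in>Basis. flat d (- (l \<bullet> b) + 1 * (x \<bullet> b)) * flat d (u \<bullet> b + (-1) * (x \<bullet> b)))"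
    by (intro smooth_prod smooth_mult smooth_flat assms lin)
  from smooth_linear_compose[OF bounded_linear_of_real this]
  show "smooth (box_cutoff l u d)" by (simp add: box_cutoff_def[abs_def] del: of_real_prod)
  show "box_cutoff l u d x = 0" if x: "x \<notin> cbox l u" for x
  proof -
    obtain b where "b \<in> Basis" "x \<bullet> b < l \<bullet> b \<or> u \<bullet> b < x \<bullet> b"
      using x by (auto simp: mem_box not_le)
    then have "flat d (x \<bullet> b - l \<bullet> b) * flat d (u \<bullet> b - x \<bullet> b) = 0" "b \<in> Basis" by (auto simp: flat_def)
    then show ?thesis unfolding box_cutoff_def by (auto intro!: bexI[of _ b])
  qed
qed

lemma box_cutoff_bounds: "d > 0 \<Longrightarrow> cmod (box_cutoff l u d x) \<le> indicator (box l u) x"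
proof -
  assume d: "d > 0"
  show ?thesis
  proof (cases "x \<in> box l u")
    case True
    have "\<bar>\<Prod>b\<in>Basis. flat d (x \<bullet> b - l \<bullet> b) * flat d (u \<bullet> b - x \<bullet> b)\<bar> \<le> 1"
      unfolding abs_prod using flat_bounds d
      by (intro prod_le_1) (auto simp: abs_mult intro!: mult_le_one)
    then show ?thesis using True by (simp add: box_cutoff_def del: of_real_prod)
  next
    case False
    then obtain b where b: "b \<in> Basis" "flat d (x \<bullet> b - l \<bullet> b) * flat d (u \<bullet> b - x \<bullet> b) = 0"
      by (auto simp: mem_box flat_def)
    then have "(\<Prod>b\<in>Basis. flat d (x \<bullet> b - l \<bullet> b) * flat d (u \<bullet> b - x \<bullet> b)) = 0"
      by (intro prod_zero) auto
    then show ?thesis using False by (simp add: box_cutoff_def del: of_real_prod)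
  qed
qed

lemma box_cutoff_tendsto: "(\<lambda>n. box_cutoff l u (inverse (real (Suc n))) x) \<longlonglongrightarrow> indicator (box l u) x"
proof (cases "x \<in> box l u")
  case True
  have fl: "(\<lambda>n. flat (inverse (real (Suc n))) t) \<longlonglongrightarrow> 1" if "t > 0" for t
  proof -
    have "(\<lambda>n. exp (- inverse (real (Suc n)) / t)) \<longlonglongrightarrow> exp (- 0 / t)"
      using that by (intro tendsto_intros LIMSEQ_inverse_real_of_nat) auto
    then show ?thesis using that by (simp add: flat_def)
  qed
  have "(\<lambda>n. \<Prod>b\<in>Basis. flat (inverse (real (Suc n))) (x \<bullet> b - l \<bullet> b) * flat (inverse (real (Suc n))) (u \<bullet> b - x \<bullet> b))
     \<longlonglongrightarrow> (\<Prod>b\<in>(Basis::'a set). 1 * 1)"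
    using True by (intro tendsto_prod tendsto_mult fl) (auto simp: mem_box)
  from tendsto_of_real[OF this, where 'a = complex]
  show ?thesis using True by (simp add: box_cutoff_def)
next
  case False
  have "cmod (box_cutoff l u (inverse (real (Suc n))) x) \<le> 0" for n
    using box_cutoff_bounds[of "inverse (real (Suc n))" l u x] False by simp
  then show ?thesis using False by simp
qed

lemma L2_integrable_mult_indicator:
  assumes "open \<Omega>" "g \<in> L2 \<Omega>" "bounded S" "S \<in> sets borel" "S \<subseteq> \<Omega>"
  shows "integrable lebesgue (\<lambda>x. indicator S x *\<^sub>R g x)"
proof -
  have S: "S \<in> sets lebesgue" "\<Omega> \<in> sets lebesgue" using assms by (auto simp: borel_open)
  have "integrable (lebesgue_on \<Omega>) (\<lambda>x. indicator S x *\<^sub>R g x)"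
  proof (rule Bochner_Integration.integrable_bound)
    have "integrable lborel (indicator S :: 'a \<Rightarrow> real)"
      using assms by (intro integrable_real_indicator) (auto simp: top.not_eq_extremum[symmetric] dest: emeasure_bounded_finite)
    then have "integrable (lebesgue_on \<Omega>) (indicator S :: 'a \<Rightarrow> real)"
      using assms by (subst borel_integral_lebesgue_on(2)) (auto simp: indicator_def)
    then show "integrable (lebesgue_on \<Omega>) (\<lambda>x. indicator S x + (cmod (g x))\<^sup>2)"
      by (intro Bochner_Integration.integrable_add L2_integrable assms)
    have [measurable]: "g \<in> borel_measurable (lebesgue_on \<Omega>)" by (rule L2_measurable[OF assms(2)])
    have [measurable]: "indicator S \<in> borel_measurable (lebesgue_on \<Omega>)"
      using S by (intro measurable_restrict_space1) auto
    show "(\<lambda>x. indicat_real S x *\<^sub>R g x) \<in> borel_measurable (lebesgue_on \<Omega>)" by measurable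
    have "t \<le> 1 + t\<^sup>2" for t :: real
    proof -
      have "2 * t \<le> t\<^sup>2 + 1" using zero_le_power2[of "t - 1"] unfolding power2_diff by simp
      moreover have "0 \<le> t\<^sup>2" by simp
      ultimately show ?thesis by linarith
    qed
    then show "AE x in lebesgue_on \<Omega>. norm (indicator S x *\<^sub>R g x) \<le> norm (indicator S x + (cmod (g x))\<^sup>2)"
      by (auto simp: indicator_def)
  qed
  then have "integrable lebesgue (\<lambda>x. indicator \<Omega> x *\<^sub>R (indicator S x *\<^sub>R g x))"
    using S by (subst (asm) integrable_restrict_space) auto
  moreover have "(\<lambda>x. indicator \<Omega> x *\<^sub>R (indicator S x *\<^sub>R g x)) = (\<lambda>x. indicator S x *\<^sub>R g x)"
    using assms(5) by (intro ext) (auto simp: indicator_def)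
  ultimately show ?thesis by simp
qed

text \<open>The functions \<open>box_cutoff\<close> and dominated convergence give integral 0 over
  every box whose closure lies in \<Omega>. Hence g vanishes a.e. on each such box, and countably
  many closed boxes cover \<Omega>.\<close>

lemma fundamental_lemma_L2:
  assumes \<Omega>: "open \<Omega>" and g: "g \<in> L2 \<Omega>"
    and zero: "\<And>\<eta>. \<eta> \<in> test_functions \<Omega> \<Longrightarrow> (LINT x|lebesgue_on \<Omega>. g x * \<eta> x) = 0"
  shows "AE x in lebesgue_on \<Omega>. g x = 0"
proof -
  have \<Omega>m: "\<Omega> \<in> sets lebesgue" using \<Omega> by (simp add: borel_open)
  have box0: "(LINT x:box l u|lebesgue. g x) = 0" if sub: "cbox l u \<subseteq> \<Omega>" for l u
  proof -
    have sub': "box l u \<subseteq> \<Omega>" using sub box_subset_cbox by blast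
    let ?e = "\<lambda>n. inverse (real (Suc n))"
    let ?s = "\<lambda>n x. indicator \<Omega> x *\<^sub>R (g x * box_cutoff l u (?e n) x)"
    have int: "integrable lebesgue (\<lambda>x. indicator (box l u) x *\<^sub>R g x)"
      by (intro L2_integrable_mult_indicator[OF \<Omega> g] sub') auto
    have s0: "?s n x = indicator (box l u) x *\<^sub>R g x * box_cutoff l u (?e n) x" for n x
      using box_cutoff_bounds[of "?e n" l u x] sub' by (auto simp: indicator_def)
    have "(\<lambda>n. LINT x|lebesgue. ?s n x) \<longlonglongrightarrow> (LINT x|lebesgue. indicator (box l u) x *\<^sub>R g x)"
    proof (rule integral_dominated_convergence)
      show "integrable lebesgue (\<lambda>x. norm (indicator (box l u) x *\<^sub>R g x))" using int by (rule integrable_norm)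
      show "AE x in lebesgue. (\<lambda>n. ?s n x) \<longlonglongrightarrow> indicator (box l u) x *\<^sub>R g x"
      proof (rule AE_I2)
        fix x
        have "(\<lambda>n. indicator (box l u) x *\<^sub>R g x * box_cutoff l u (?e n) x) \<longlonglongrightarrow>
           indicator (box l u) x *\<^sub>R g x * indicator (box l u) x"
          by (intro tendsto_mult tendsto_const box_cutoff_tendsto)
        then show "(\<lambda>n. ?s n x) \<longlonglongrightarrow> indicator (box l u) x *\<^sub>R g x"
          unfolding s0 by (auto simp: indicator_def)
      qed
      have b: "norm (?s n x) \<le> norm (indicator (box l u) x *\<^sub>R g x)" for n x
        unfolding s0 norm_mult[of _ "box_cutoff l u (?e n) x"] using box_cutoff_bounds[of "?e n" l u x]
        by (auto simp: indicator_def split: if_splits intro!: mult_right_le_one_le)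
      then show "AE x in lebesgue. norm (?s n x) \<le> norm (indicator (box l u) x *\<^sub>R g x)" for n by simp
      have "box_cutoff l u (?e n) \<in> borel_measurable borel" for n
        using box_cutoff_test[OF _ sub, of "?e n"] by (intro borel_measurable_continuous_onI test_continuous) auto
      then have [measurable]: "box_cutoff l u (?e n) \<in> borel_measurable lebesgue" for n
        by (simp add: measurable_completion)
      have [measurable]: "(\<lambda>x. indicator (box l u) x *\<^sub>R g x) \<in> borel_measurable lebesgue" using int by simp
      then show "(\<lambda>x. indicator (box l u) x *\<^sub>R g x) \<in> borel_measurable lebesgue" .
      show "?s n \<in> borel_measurable lebesgue" for n
        unfolding s0 by measurable
    qed
    moreover have "(LINT x|lebesgue. ?s n x) = 0" for n
      using zero[OF box_cutoff_test[OF _ sub, of "?e n"]] \<Omega>m by (simp add: integral_restrict_space)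
    ultimately show ?thesis unfolding set_lebesgue_integral_def
      using LIMSEQ_unique tendsto_const by (metis (no_types, lifting) ext)
  qed
  have bb: "AE x in lebesgue. x \<in> cbox a b \<longrightarrow> g x = 0" if sub: "cbox a b \<subseteq> \<Omega>" for a b
  proof -
    have "AE x in lebesgue. indicator (box a b) x *\<^sub>R g x = 0"
    proof (rule AE_zero_if_box_integrals_zero)
      show "integrable lebesgue (\<lambda>x. indicator (box a b) x *\<^sub>R g x)"
        using sub box_subset_cbox[of a b] by (intro L2_integrable_mult_indicator[OF \<Omega> g]) auto
      fix l u
      \<comment> \<open>The same corners describe the open and the closed intersection, so the
        smaller closed box still lies in \<Omega> and \<open>box0\<close> applies to it.\<close>
      have "\<exists>l' u'. cbox l u \<inter> cbox a b = cbox l' u' \<and> box l u \<inter> box a b = box l' u'"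
        unfolding Int_interval box_Int_box by (rule exI)+ (rule conjI refl)+
      then obtain l' u' where lu: "cbox l u \<inter> cbox a b = cbox l' u'" "box l u \<inter> box a b = box l' u'"
        by (elim exE conjE)
      have "(LINT x:box l' u'|lebesgue. g x) = 0" using lu sub by (intro box0) auto
      moreover have "(\<lambda>x. indicator (box l' u') x *\<^sub>R g x) =
        (\<lambda>x. indicator (box l u) x *\<^sub>R (indicator (box a b) x *\<^sub>R g x))"
        unfolding lu(2)[symmetric] by (auto simp: indicator_def)
      ultimately show "(LINT x:box l u|lebesgue. indicator (box a b) x *\<^sub>R g x) = 0"
        by (simp add: set_lebesgue_integral_def)
    qed
    \<comment> \<open>The boundary is null; the countable cover below consists of closed
      boxes.\<close>
    moreover have "cbox a b - box a b \<in> null_sets lebesgue"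
      using negligible_frontier_interval negligible_iff_null_sets by blast
    then have "AE x in lebesgue. x \<notin> cbox a b - box a b" by (rule AE_not_in)
    ultimately show ?thesis by eventually_elim (auto simp: indicator_def)
  qed
  obtain \<D> where D: "countable \<D>" "\<D> \<subseteq> Pow \<Omega>" "\<And>X. X \<in> \<D> \<Longrightarrow> \<exists>a b. X = cbox a b" "\<Union>\<D> = \<Omega>"
    using open_countable_Union_open_cbox[OF \<Omega>] by metis
  have "AE x in lebesgue. \<forall>X\<in>\<D>. x \<in> X \<longrightarrow> g x = 0"
    using D by (intro AE_ball_countable[THEN iffD2] ballI D(1)) (metis bb PowD subsetD)
  then have "AE x in lebesgue. x \<in> \<Omega> \<longrightarrow> g x = 0"
    by eventually_elim (use D(4) in blast)
  then show ?thesis using \<Omega>m by (simp add: AE_restrict_space_iff)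
qed

section \<open>Weak derivatives of functions in \<open>H1_0\<close>\<close>

lemma L2_test_integrable:
  assumes "open \<Omega>" "g \<in> L2 \<Omega>" "\<eta> \<in> test_functions \<Omega>"
  shows "integrable (lebesgue_on \<Omega>) (\<lambda>x. g x * \<eta> x)"
  using L2_inner_integrable[OF assms(2) test_in_L2[OF assms(1) test_cnj[OF assms(3)]]] by simp

text \<open>The difference of two weak derivatives is annihilated by all test functions, hence zero
  a.e. by the fundamental lemma. From here on the choice in \<open>weak_partial\<close> is
  harmless.\<close>

lemma weak_partial_unique:
  assumes \<Omega>: "open \<Omega>" and g: "g \<in> L2 \<Omega>" "is_weak_partial \<Omega> b u g"
  shows "weak_partial \<Omega> b u \<in> L2 \<Omega>" "is_weak_partial \<Omega> b u (weak_partial \<Omega> b u)"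
    "AE x in lebesgue_on \<Omega>. weak_partial \<Omega> b u x = g x"
proof -
  let ?w = "weak_partial \<Omega> b u"
  have "?w \<in> L2 \<Omega> \<and> is_weak_partial \<Omega> b u ?w"
    unfolding weak_partial_def by (rule someI[of _ g]) (use g in auto)
  then show w: "?w \<in> L2 \<Omega>" "is_weak_partial \<Omega> b u ?w" by auto
  have "AE x in lebesgue_on \<Omega>. ?w x + (- 1) * g x = 0"
  proof (rule fundamental_lemma_L2[OF \<Omega> L2_lincomb(1)[OF w(1) g(1)]])
    fix \<eta> assume \<eta>: "\<eta> \<in> test_functions \<Omega>"
    have "(LINT x|lebesgue_on \<Omega>. (?w x + (- 1) * g x) * \<eta> x) =
      (LINT x|lebesgue_on \<Omega>. ?w x * \<eta> x) - (LINT x|lebesgue_on \<Omega>. g x * \<eta> x)"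
      using L2_test_integrable[OF \<Omega> w(1) \<eta>] L2_test_integrable[OF \<Omega> g(1) \<eta>]
      by (simp add: algebra_simps)
    also have "\<dots> = 0"
      using w(2) g(2) \<eta> unfolding is_weak_partial_def by (metis eq_iff_diff_eq_0 neg_equal_iff_equal)
    finally show "(LINT x|lebesgue_on \<Omega>. (?w x + (- 1) * g x) * \<eta> x) = 0" .
  qed
  then show "AE x in lebesgue_on \<Omega>. ?w x = g x" by eventually_elim simp
qed

lemma is_weak_partial_lincomb:
  assumes \<Omega>: "open \<Omega>" and L2: "u \<in> L2 \<Omega>" "v \<in> L2 \<Omega>" "g \<in> L2 \<Omega>" "h \<in> L2 \<Omega>"
    and w: "is_weak_partial \<Omega> b u g" "is_weak_partial \<Omega> b v h"
  shows "is_weak_partial \<Omega> b (\<lambda>x. u x + c * v x) (\<lambda>x. g x + c * h x)"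
  unfolding is_weak_partial_def
proof
  fix \<eta> assume \<eta>: "\<eta> \<in> test_functions \<Omega>"
  note i = L2_test_integrable[OF \<Omega> L2(1) test_pd[OF \<eta>]] L2_test_integrable[OF \<Omega> L2(2) test_pd[OF \<eta>]]
    L2_test_integrable[OF \<Omega> L2(3) \<eta>] L2_test_integrable[OF \<Omega> L2(4) \<eta>]
  have "(LINT x|lebesgue_on \<Omega>. (u x + c * v x) * pd b \<eta> x) =
     (LINT x|lebesgue_on \<Omega>. u x * pd b \<eta> x) + c * (LINT x|lebesgue_on \<Omega>. v x * pd b \<eta> x)"
    using i(1,2) by (simp add: distrib_right mult.assoc)
  also have "\<dots> = - (LINT x|lebesgue_on \<Omega>. g x * \<eta> x) + c * (- (LINT x|lebesgue_on \<Omega>. h x * \<eta> x))"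
    using w \<eta> by (simp add: is_weak_partial_def)
  also have "\<dots> = - (LINT x|lebesgue_on \<Omega>. (g x + c * h x) * \<eta> x)"
    using i(3,4) by (simp add: distrib_right mult.assoc)
  finally show "(LINT x|lebesgue_on \<Omega>. (u x + c * v x) * pd b \<eta> x) =
    - (LINT x|lebesgue_on \<Omega>. (g x + c * h x) * \<eta> x)" .
qed

lemma test_is_weak_partial:
  assumes \<Omega>: "open \<Omega>" and \<phi>: "\<phi> \<in> test_functions \<Omega>"
  shows "is_weak_partial \<Omega> b \<phi> (pd b \<phi>)"
  unfolding is_weak_partial_def
proof
  fix \<eta> assume \<eta>: "\<eta> \<in> test_functions \<Omega>"
  have e: "(LINT x|lebesgue_on \<Omega>. f x * g x) = (LINT x|lborel. f x * g x)"
    if "f \<in> test_functions \<Omega>" "g \<in> test_functions \<Omega>" for f g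
    using test_L2_inner(1)[OF \<Omega> that(1) test_cnj[OF that(2)]] by (simp add: L2_inner_def)
  show "(LINT x|lebesgue_on \<Omega>. \<phi> x * pd b \<eta> x) = - (LINT x|lebesgue_on \<Omega>. pd b \<phi> x * \<eta> x)"
    unfolding e[OF \<phi> test_pd[OF \<eta>]] e[OF test_pd[OF \<phi>] \<eta>]
    by (rule integral_by_parts[OF \<phi> test_smooth[OF \<eta>]])
qed

lemma L2_norm_cong_AE:
  assumes "AE x in lebesgue_on \<Omega>. f x = g x" "f \<in> L2 \<Omega>" "g \<in> L2 \<Omega>"
  shows "L2_norm \<Omega> f = L2_norm \<Omega> g"
proof -
  note [measurable] = L2_measurable[OF assms(2)] L2_measurable[OF assms(3)]
  have "(LINT x|lebesgue_on \<Omega>. (cmod (f x))\<^sup>2) = (LINT x|lebesgue_on \<Omega>. (cmod (g x))\<^sup>2)"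
    by (rule integral_cong_AE) (use assms(1) in auto)
  then show ?thesis by (simp add: L2_norm_def)
qed

lemma test_weak_partial:
  assumes \<Omega>: "open \<Omega>" and \<phi>: "\<phi> \<in> test_functions \<Omega>"
  shows "weak_partial \<Omega> b \<phi> \<in> L2 \<Omega>" "AE x in lebesgue_on \<Omega>. weak_partial \<Omega> b \<phi> x = pd b \<phi> x"
  using weak_partial_unique[OF \<Omega> test_in_L2[OF \<Omega> test_pd[OF \<phi>]] test_is_weak_partial[OF \<Omega> \<phi>]] by auto

lemma test_in_H1: "open \<Omega> \<Longrightarrow> \<phi> \<in> test_functions \<Omega> \<Longrightarrow> \<phi> \<in> H1 \<Omega>"
  unfolding H1_def by (blast intro: test_in_L2 test_pd test_is_weak_partial)

lemma test_in_H1_0: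
  assumes \<Omega>: "open \<Omega>" and \<phi>: "\<phi> \<in> test_functions \<Omega>"
  shows "\<phi> \<in> H1_0 \<Omega>"
proof -
  have "(\<lambda>x. 0) \<in> test_functions \<Omega>" by (auto simp: test_functions_def Ck_const)
  from test_weak_partial[OF \<Omega> this] have "L2_norm \<Omega> (weak_partial \<Omega> b (\<lambda>x. 0)) = L2_norm \<Omega> (\<lambda>x. 0)" for b
    by (intro L2_norm_cong_AE) (auto simp: L2_def)
  then have "H1_norm \<Omega> (\<lambda>x. 0) = 0" by (simp add: H1_norm_def L2_norm_def)
  then show ?thesis unfolding H1_0_def
    by (auto intro!: exI[of _ "\<lambda>_. \<phi>"] test_in_H1[OF \<Omega> \<phi>] \<phi>)
qed

lemma H1_weak_partial:
  assumes "open \<Omega>" "u \<in> H1 \<Omega>" "b \<in> Basis"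
  shows "weak_partial \<Omega> b u \<in> L2 \<Omega>" "is_weak_partial \<Omega> b u (weak_partial \<Omega> b u)"
proof -
  obtain g where "g \<in> L2 \<Omega>" "is_weak_partial \<Omega> b u g" using assms by (auto simp: H1_def)
  then show "weak_partial \<Omega> b u \<in> L2 \<Omega>" "is_weak_partial \<Omega> b u (weak_partial \<Omega> b u)"
    using weak_partial_unique[OF assms(1)] by auto
qed

text \<open>The chosen weak derivative of u - \<phi> agrees only a.e. with the difference of the
  derivatives. Replacing it once and for all splits the H1 norm into L2 limits with the classical
  \<open>pd b (\<phi> n)\<close>, the form used in the later limit arguments.\<close>

lemma H1_0_approx:
  assumes \<Omega>: "open \<Omega>" and u: "u \<in> H1_0 \<Omega>"
  obtains \<phi> where "\<And>n::nat. \<phi> n \<in> test_functions \<Omega>"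
    "(\<lambda>n. L2_norm \<Omega> (\<lambda>x. u x + (- 1) * \<phi> n x)) \<longlonglongrightarrow> 0"
    "\<And>b. b \<in> Basis \<Longrightarrow> (\<lambda>n. L2_norm \<Omega> (\<lambda>x. weak_partial \<Omega> b u x + (- 1) * pd b (\<phi> n) x)) \<longlonglongrightarrow> 0"
proof -
  obtain \<phi> where \<phi>: "\<And>n::nat. \<phi> n \<in> test_functions \<Omega>"
    and lim: "(\<lambda>n. H1_norm \<Omega> (\<lambda>x. u x - \<phi> n x)) \<longlonglongrightarrow> 0"
    using u by (auto simp: H1_0_def)
  have u1: "u \<in> H1 \<Omega>" "u \<in> L2 \<Omega>" using u by (auto simp: H1_0_def H1_def)
  have le: "L2_norm \<Omega> v \<le> H1_norm \<Omega> v" for v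
    unfolding H1_norm_def by (rule real_le_rsqrt) (simp add: sum_nonneg)
  have le': "L2_norm \<Omega> (weak_partial \<Omega> b v) \<le> H1_norm \<Omega> v" if "b \<in> Basis" for v b
    unfolding H1_norm_def by (rule real_le_rsqrt)
      (simp add: add_increasing member_le_sum[OF that, of "\<lambda>b. (L2_norm \<Omega> (weak_partial \<Omega> b v))\<^sup>2"])
  show ?thesis
  proof (rule that[OF \<phi>])
    show "(\<lambda>n. L2_norm \<Omega> (\<lambda>x. u x + (- 1) * \<phi> n x)) \<longlonglongrightarrow> 0"
      by (rule Lim_null_comparison[OF always_eventually lim]) (use le in \<open>auto simp: L2_norm_nonneg\<close>)
    fix b :: 'a assume b: "b \<in> Basis"
    have "L2_norm \<Omega> (weak_partial \<Omega> b (\<lambda>x. u x + (- 1) * \<phi> n x)) =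
      L2_norm \<Omega> (\<lambda>x. weak_partial \<Omega> b u x + (- 1) * pd b (\<phi> n) x)" for n
    proof -
      note t = test_in_L2[OF \<Omega> \<phi>[of n]] test_in_L2[OF \<Omega> test_pd[OF \<phi>[of n]], of b]
      note w = H1_weak_partial[OF \<Omega> u1(1) b]
      have l: "(\<lambda>x. weak_partial \<Omega> b u x + (- 1) * pd b (\<phi> n) x) \<in> L2 \<Omega>"
        by (rule L2_lincomb(1)[OF w(1) t(2)])
      note i = weak_partial_unique[OF \<Omega> l is_weak_partial_lincomb[OF \<Omega> u1(2) t(1) w(1) t(2) w(2) test_is_weak_partial[OF \<Omega> \<phi>]]]
      show ?thesis by (rule L2_norm_cong_AE[OF i(3) i(1) l])
    qed
    then have "L2_norm \<Omega> (\<lambda>x. weak_partial \<Omega> b u x + (- 1) * pd b (\<phi> n) x) \<le> H1_norm \<Omega> (\<lambda>x. u x - \<phi> n x)" for n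
      using le'[OF b, of "\<lambda>x. u x + (- 1) * \<phi> n x"] by simp
    then show "(\<lambda>n. L2_norm \<Omega> (\<lambda>x. weak_partial \<Omega> b u x + (- 1) * pd b (\<phi> n) x)) \<longlonglongrightarrow> 0"
      by (intro Lim_null_comparison[OF always_eventually lim]) (auto simp: L2_norm_nonneg)
  qed
qed

lemma L2_norm_tendsto:
  assumes "u \<in> L2 \<Omega>" "\<And>n. f n \<in> L2 \<Omega>" "(\<lambda>n. L2_norm \<Omega> (\<lambda>x. u x + (- 1) * f n x)) \<longlonglongrightarrow> 0"
  shows "(\<lambda>n. L2_norm \<Omega> (f n)) \<longlonglongrightarrow> L2_norm \<Omega> u"
proof (rule Lim_transform2[OF tendsto_const])
  show "(\<lambda>n. L2_norm \<Omega> u - L2_norm \<Omega> (f n)) \<longlonglongrightarrow> 0"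
  proof (rule Lim_null_comparison[OF always_eventually assms(3)], rule allI)
    fix n
    have 1: "L2_norm \<Omega> u \<le> L2_norm \<Omega> (f n) + L2_norm \<Omega> (\<lambda>x. u x + (- 1) * f n x)"
      using L2_triangle[OF assms(2)[of n] L2_lincomb(1)[OF assms(1) assms(2)[of n], of "-1"], of 1] by simp
    have 2: "L2_norm \<Omega> (f n) \<le> L2_norm \<Omega> u + L2_norm \<Omega> (\<lambda>x. u x + (- 1) * f n x)"
      using L2_triangle[OF assms(1) L2_lincomb(1)[OF assms(1) assms(2)[of n], of "-1"], of "-1"] by simp
    show "norm (L2_norm \<Omega> u - L2_norm \<Omega> (f n)) \<le> L2_norm \<Omega> (\<lambda>x. u x + (- 1) * f n x)"
      using 1 2 by simp
  qed
qed

lemma L2_inner_tendsto: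
  assumes "u \<in> L2 \<Omega>" "\<And>n. f n \<in> L2 \<Omega>" "g \<in> L2 \<Omega>" "(\<lambda>n. L2_norm \<Omega> (\<lambda>x. u x + (- 1) * f n x)) \<longlonglongrightarrow> 0"
  shows "(\<lambda>n. L2_inner \<Omega> (f n) g) \<longlonglongrightarrow> L2_inner \<Omega> u g"
proof (rule Lim_transform2[OF tendsto_const])
  have "(\<lambda>n. L2_norm \<Omega> (\<lambda>x. u x + (- 1) * f n x) * L2_norm \<Omega> g) \<longlonglongrightarrow> 0 * L2_norm \<Omega> g"
    by (intro tendsto_mult assms tendsto_const)
  then have lim: "(\<lambda>n. L2_norm \<Omega> (\<lambda>x. u x + (- 1) * f n x) * L2_norm \<Omega> g) \<longlonglongrightarrow> 0" by simp
  show "(\<lambda>n. L2_inner \<Omega> u g - L2_inner \<Omega> (f n) g) \<longlonglongrightarrow> 0"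
  proof (rule Lim_null_comparison[OF always_eventually lim], rule allI)
    fix n
    have "L2_inner \<Omega> u g - L2_inner \<Omega> (f n) g = L2_inner \<Omega> (\<lambda>x. u x + (- 1) * f n x) g"
      unfolding L2_inner_def using L2_inner_integrable[OF assms(1,3)] L2_inner_integrable[OF assms(2,3), of n]
      by (simp add: left_diff_distrib)
    then show "norm (L2_inner \<Omega> u g - L2_inner \<Omega> (f n) g) \<le> L2_norm \<Omega> (\<lambda>x. u x + (- 1) * f n x) * L2_norm \<Omega> g"
      using L2_cauchy_schwarz[OF L2_lincomb(1)[OF assms(1) assms(2)[of n]] assms(3), of "-1"] by simp
  qed
qed

section \<open>Variational criteria for the spectrum\<close>

lemma L2_inner_self: "L2_inner \<Omega> f f = of_real ((L2_norm \<Omega> f)\<^sup>2)"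
  unfolding L2_inner_def L2_norm_power2 complex_norm_square[symmetric]
  by (rule integral_complex_of_real)

lemma L2_norm_eq_0_AE:
  assumes "f \<in> L2 \<Omega>" "L2_norm \<Omega> f = 0"
  shows "AE x in lebesgue_on \<Omega>. f x = 0"
proof -
  have "(LINT x|lebesgue_on \<Omega>. (cmod (f x))\<^sup>2) = 0"
    using assms(2) L2_norm_power2[of \<Omega> f] by simp
  then have "AE x in lebesgue_on \<Omega>. (cmod (f x))\<^sup>2 = 0"
    using integral_nonneg_eq_0_iff_AE[OF L2_integrable[OF assms(1)]] by simp
  then show ?thesis by simp
qed

lemma gradient_norm_integral:
  assumes "open \<Omega>" "\<phi> \<in> test_functions \<Omega>"
  shows "(LINT x|lborel. (\<Sum>b\<in>Basis. (cmod (pd b \<phi> x))\<^sup>2)) = (\<Sum>b\<in>Basis. (L2_norm \<Omega> (pd b \<phi>))\<^sup>2)"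
  using test_power2_integrable[OF test_pd[OF assms(2)]] test_L2_inner(2)[OF assms(1) test_pd[OF assms(2)] test_pd[OF assms(2)]]
  by (subst Bochner_Integration.integral_sum) auto

lemma dirichlet_form_self:
  "dirichlet_form \<Omega> u u = of_real (\<Sum>b\<in>Basis. (L2_norm \<Omega> (weak_partial \<Omega> b u))\<^sup>2)"
  by (simp add: dirichlet_form_def L2_inner_self)

text \<open>Testing the equation with the eigenfunction itself shows that its energy is \<mu> times
  its mass; the Poincare inequality passes from test functions to it by density.\<close>

lemma eigenvalue_lower_bound:
  fixes \<Omega> :: "'a::euclidean_space set"
  assumes \<Omega>: "open \<Omega>"
    and poincare: "\<And>\<phi>. \<phi> \<in> test_functions \<Omega> \<Longrightarrow>
      \<Lambda> * (LINT x|lborel. (cmod (\<phi> x))\<^sup>2) \<le> (LINT x|lborel. (\<Sum>b\<in>Basis. (cmod (pd b \<phi> x))\<^sup>2))"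
    and ev: "is_eigenvalue \<Omega> (dirichlet_laplacian \<Omega>) (of_real \<mu>)"
  shows "\<Lambda> \<le> \<mu>"
proof -
  obtain u where u: "(u, \<lambda>x. of_real \<mu> * u x) \<in> dirichlet_laplacian \<Omega>"
    and nz: "\<not> (AE x in lebesgue_on \<Omega>. u x = 0)"
    using ev by (auto simp: is_eigenvalue_def op_eigenspace_def)
  have H: "u \<in> H1_0 \<Omega>" and eq: "dirichlet_form \<Omega> u u = L2_inner \<Omega> (\<lambda>x. of_real \<mu> * u x) u"
    using u by (auto simp: dirichlet_laplacian_def)
  have H1: "u \<in> H1 \<Omega>" "u \<in> L2 \<Omega>" using H by (auto simp: H1_0_def H1_def)
  have "L2_inner \<Omega> (\<lambda>x. of_real \<mu> * u x) u = of_real \<mu> * L2_inner \<Omega> u u"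
    unfolding L2_inner_def by (simp add: mult.assoc)
  then have "complex_of_real (\<Sum>b\<in>Basis. (L2_norm \<Omega> (weak_partial \<Omega> b u))\<^sup>2) = of_real (\<mu> * (L2_norm \<Omega> u)\<^sup>2)"
    using eq unfolding dirichlet_form_self by (simp add: L2_inner_self)
  then have eq': "(\<Sum>b\<in>Basis. (L2_norm \<Omega> (weak_partial \<Omega> b u))\<^sup>2) = \<mu> * (L2_norm \<Omega> u)\<^sup>2"
    by (simp only: of_real_eq_iff)
  obtain \<phi> where \<phi>: "\<And>n::nat. \<phi> n \<in> test_functions \<Omega>"
    and lim: "(\<lambda>n. L2_norm \<Omega> (\<lambda>x. u x + (- 1) * \<phi> n x)) \<longlonglongrightarrow> 0"
    "\<And>b. b \<in> Basis \<Longrightarrow> (\<lambda>n. L2_norm \<Omega> (\<lambda>x. weak_partial \<Omega> b u x + (- 1) * pd b (\<phi> n) x)) \<longlonglongrightarrow> 0"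
    using H1_0_approx[OF \<Omega> H] by blast
  have "\<Lambda> * (L2_norm \<Omega> u)\<^sup>2 \<le> (\<Sum>b\<in>Basis. (L2_norm \<Omega> (weak_partial \<Omega> b u))\<^sup>2)"
  proof (rule LIMSEQ_le)
    show "(\<lambda>n. \<Lambda> * (L2_norm \<Omega> (\<phi> n))\<^sup>2) \<longlonglongrightarrow> \<Lambda> * (L2_norm \<Omega> u)\<^sup>2"
      by (intro tendsto_mult tendsto_const tendsto_power L2_norm_tendsto H1 test_in_L2[OF \<Omega> \<phi>] lim)
    show "(\<lambda>n. \<Sum>b\<in>Basis. (L2_norm \<Omega> (pd b (\<phi> n)))\<^sup>2) \<longlonglongrightarrow> (\<Sum>b\<in>Basis. (L2_norm \<Omega> (weak_partial \<Omega> b u))\<^sup>2)"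
      by (intro tendsto_sum tendsto_power L2_norm_tendsto H1_weak_partial(1)[OF \<Omega> H1(1)]
          test_in_L2[OF \<Omega> test_pd[OF \<phi>]] lim)
    show "\<exists>N. \<forall>n\<ge>N. \<Lambda> * (L2_norm \<Omega> (\<phi> n))\<^sup>2 \<le> (\<Sum>b\<in>Basis. (L2_norm \<Omega> (pd b (\<phi> n)))\<^sup>2)"
      using poincare[OF \<phi>] unfolding gradient_norm_integral[OF \<Omega> \<phi>] test_L2_inner(2)[OF \<Omega> \<phi> \<phi>] by blast
  qed
  then have "\<Lambda> * (L2_norm \<Omega> u)\<^sup>2 \<le> \<mu> * (L2_norm \<Omega> u)\<^sup>2" unfolding eq' .
  moreover have "L2_norm \<Omega> u \<noteq> 0" using L2_norm_eq_0_AE[OF H1(2)] nz by blast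
  ultimately show ?thesis by simp
qed

text \<open>
  Weyl's criterion in the form domain: the residual of the quasi-modes \<open>\<phi>\<close> only has to be small
  as a functional on \<open>H1\<close>, so they need not lie in the operator domain. If \<open>\<mu>\<close> were in the
  resolvent set, testing the equation for \<open>w = (T - \<mu>)\<inverse> \<phi>\<close> against \<open>\<phi>\<close> would give a contradiction.
\<close>

lemma weyl_criterion:
  fixes \<Omega> :: "'a::euclidean_space set"
  assumes \<Omega>: "open \<Omega>"
    and weyl: "\<And>\<epsilon>. \<epsilon> > 0 \<Longrightarrow> \<exists>\<phi>\<in>test_functions \<Omega>. 0 < (LINT x|lborel. (cmod (\<phi> x))\<^sup>2) \<and>
      (\<forall>v\<in>test_functions \<Omega>.
        cmod (LINT x|lborel. (\<Sum>b\<in>Basis. pd b v x * cnj (pd b \<phi> x)) - of_real \<mu> * (v x * cnj (\<phi> x))) \<le>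
        \<epsilon> * sqrt (LINT x|lborel. (cmod (\<phi> x))\<^sup>2) *
          sqrt ((LINT x|lborel. (cmod (v x))\<^sup>2) + (LINT x|lborel. (\<Sum>b\<in>Basis. (cmod (pd b v x))\<^sup>2))))"
  shows "of_real \<mu> \<in> op_spectrum \<Omega> (dirichlet_laplacian \<Omega>)"
proof (rule ccontr)
  assume "\<not> ?thesis"
  then have "complex_of_real \<mu> \<in> resolvent_set \<Omega> (dirichlet_laplacian \<Omega>)" by (simp add: op_spectrum_def)
  then obtain C0 where solve: "\<And>f. f \<in> L2 \<Omega> \<Longrightarrow> \<exists>u. (u, \<lambda>x. f x + of_real \<mu> * u x) \<in> dirichlet_laplacian \<Omega>"
    and C0: "\<And>u g. (u, g) \<in> dirichlet_laplacian \<Omega> \<Longrightarrow> L2_norm \<Omega> u \<le> C0 * L2_norm \<Omega> (\<lambda>x. g x - of_real \<mu> * u x)"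
    unfolding resolvent_set_def by blast
  define C where "C = \<bar>C0\<bar>"
  have C: "L2_norm \<Omega> u \<le> C * L2_norm \<Omega> (\<lambda>x. g x - of_real \<mu> * u x)" if "(u, g) \<in> dirichlet_laplacian \<Omega>" for u g
    using C0[OF that] mult_right_mono[of C0 C "L2_norm \<Omega> (\<lambda>x. g x - of_real \<mu> * u x)"] L2_norm_nonneg[of \<Omega>]
    by (smt (verit) C_def)
  have "C \<ge> 0" by (simp add: C_def)
  \<comment> \<open>K bounds the H1 norm of the solution w below in terms of the L2 norm N of
    \<phi>: C^2 N^2 bounds its mass, and testing its equation with w bounds its energy by (C +
    |\<mu>| C^2) N^2.\<close>
  define K where "K = sqrt (C\<^sup>2 + (C + \<bar>\<mu>\<bar> * C\<^sup>2))"
  have "K \<ge> 0" using \<open>C \<ge> 0\<close> by (simp add: K_def)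
  \<comment> \<open>Chosen to have \<epsilon> K < 1, so that the residual at w is strictly below
    N^2.\<close>
  define \<epsilon> where "\<epsilon> = 1 / (2 * (K + 1))"
  have "\<epsilon> > 0" using \<open>K \<ge> 0\<close> by (simp add: \<epsilon>_def)
  have "\<epsilon> * K < 1" using \<open>K \<ge> 0\<close> by (simp add: \<epsilon>_def field_simps)
  obtain \<phi> where \<phi>: "\<phi> \<in> test_functions \<Omega>" and pos: "0 < (LINT x|lborel. (cmod (\<phi> x))\<^sup>2)"
    and small: "\<And>v. v \<in> test_functions \<Omega> \<Longrightarrow>
        cmod (LINT x|lborel. (\<Sum>b\<in>Basis. pd b v x * cnj (pd b \<phi> x)) - of_real \<mu> * (v x * cnj (\<phi> x))) \<le>
        \<epsilon> * sqrt (LINT x|lborel. (cmod (\<phi> x))\<^sup>2) *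
          sqrt ((LINT x|lborel. (cmod (v x))\<^sup>2) + (LINT x|lborel. (\<Sum>b\<in>Basis. (cmod (pd b v x))\<^sup>2)))"
    using weyl[OF \<open>\<epsilon> > 0\<close>] by blast
  define N where "N = L2_norm \<Omega> \<phi>"
  have N2: "N\<^sup>2 = (LINT x|lborel. (cmod (\<phi> x))\<^sup>2)" unfolding N_def by (rule test_L2_inner(2)[OF \<Omega> \<phi> \<phi>])
  then have "N > 0" using pos L2_norm_nonneg[of \<Omega> \<phi>] unfolding N_def by (cases "L2_norm \<Omega> \<phi> = 0") auto
  note \<phi>L2 = test_in_L2[OF \<Omega> \<phi>]
  obtain w where w: "(w, \<lambda>x. \<phi> x + of_real \<mu> * w x) \<in> dirichlet_laplacian \<Omega>" using solve[OF \<phi>L2] by blast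
  then have H: "w \<in> H1_0 \<Omega>"
    and weq: "\<And>v. v \<in> H1_0 \<Omega> \<Longrightarrow> dirichlet_form \<Omega> w v = L2_inner \<Omega> (\<lambda>x. \<phi> x + of_real \<mu> * w x) v"
    by (auto simp: dirichlet_laplacian_def)
  have H1: "w \<in> H1 \<Omega>" "w \<in> L2 \<Omega>" using H by (auto simp: H1_0_def H1_def)
  have inner: "L2_inner \<Omega> (\<lambda>x. \<phi> x + of_real \<mu> * w x) v = L2_inner \<Omega> \<phi> v + of_real \<mu> * L2_inner \<Omega> w v"
    if "v \<in> L2 \<Omega>" for v
    unfolding L2_inner_def using L2_inner_integrable[OF \<phi>L2 that] L2_inner_integrable[OF H1(2) that]
    by (simp add: distrib_right mult.assoc)
  have wN: "L2_norm \<Omega> w \<le> C * N" using C[OF w] by (simp add: N_def)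
  define G where "G = (\<Sum>b\<in>Basis. (L2_norm \<Omega> (weak_partial \<Omega> b w))\<^sup>2)"
  have "complex_of_real G = L2_inner \<Omega> \<phi> w + of_real \<mu> * of_real ((L2_norm \<Omega> w)\<^sup>2)"
    using weq[OF H] inner[OF H1(2)] unfolding dirichlet_form_self G_def L2_inner_self by simp
  then have "cmod (complex_of_real G) \<le> cmod (L2_inner \<Omega> \<phi> w) + \<bar>\<mu>\<bar> * (L2_norm \<Omega> w)\<^sup>2"
    by (metis abs_mult abs_power2 norm_of_real norm_triangle_ineq of_real_mult)
  moreover have "G \<ge> 0" unfolding G_def by (simp add: sum_nonneg)
  moreover have "cmod (L2_inner \<Omega> \<phi> w) \<le> N * L2_norm \<Omega> w"
    unfolding N_def by (rule L2_cauchy_schwarz[OF \<phi>L2 H1(2)])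
  moreover have "N * L2_norm \<Omega> w \<le> N * (C * N)" using wN \<open>N > 0\<close> by simp
  moreover have w2: "(L2_norm \<Omega> w)\<^sup>2 \<le> (C * N)\<^sup>2" by (rule power_mono[OF wN L2_norm_nonneg])
  moreover from this have "\<bar>\<mu>\<bar> * (L2_norm \<Omega> w)\<^sup>2 \<le> \<bar>\<mu>\<bar> * (C * N)\<^sup>2" by (rule mult_left_mono) simp
  ultimately have "G \<le> N * (C * N) + \<bar>\<mu>\<bar> * (C * N)\<^sup>2" by simp
  then have "(L2_norm \<Omega> w)\<^sup>2 + G \<le> (C * N)\<^sup>2 + (N * (C * N) + \<bar>\<mu>\<bar> * (C * N)\<^sup>2)" using w2 by simp
  also have "\<dots> = (C\<^sup>2 + (C + \<bar>\<mu>\<bar> * C\<^sup>2)) * N\<^sup>2" by (simp add: power2_eq_square algebra_simps)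
  finally have "sqrt ((L2_norm \<Omega> w)\<^sup>2 + G) \<le> sqrt ((C\<^sup>2 + (C + \<bar>\<mu>\<bar> * C\<^sup>2)) * N\<^sup>2)" by simp
  then have bound: "sqrt ((L2_norm \<Omega> w)\<^sup>2 + G) \<le> K * N"
    using \<open>N > 0\<close> by (simp add: K_def real_sqrt_mult)
  obtain v where v: "\<And>n::nat. v n \<in> test_functions \<Omega>"
    and lim: "(\<lambda>n. L2_norm \<Omega> (\<lambda>x. w x + (- 1) * v n x)) \<longlonglongrightarrow> 0"
    "\<And>b. b \<in> Basis \<Longrightarrow> (\<lambda>n. L2_norm \<Omega> (\<lambda>x. weak_partial \<Omega> b w x + (- 1) * pd b (v n) x)) \<longlonglongrightarrow> 0"
    using H1_0_approx[OF \<Omega> H] by blast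
  \<comment> \<open>The gradient is a separate argument g: test functions come with
    \<open>pd\<close>, their limit w with \<open>weak_partial\<close>.\<close>
  define R where "R u g = (\<Sum>b\<in>Basis. L2_inner \<Omega> (g b) (pd b \<phi>)) - of_real \<mu> * L2_inner \<Omega> u \<phi>" for u g
  have R: "cmod (R (v n) (\<lambda>b. pd b (v n))) \<le>
    \<epsilon> * N * sqrt ((L2_norm \<Omega> (v n))\<^sup>2 + (\<Sum>b\<in>Basis. (L2_norm \<Omega> (pd b (v n)))\<^sup>2))" for n
  proof -
    have i: "integrable lborel (\<lambda>x. pd b (v n) x * cnj (pd b \<phi> x))" for b
      by (intro test_integrable[OF test_mult[OF test_pd[OF v] test_smooth[OF test_cnj[OF test_pd[OF \<phi>]]]]])
    have i': "integrable lborel (\<lambda>x. v n x * cnj (\<phi> x))"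
      by (intro test_integrable[OF test_mult[OF v test_smooth[OF test_cnj[OF \<phi>]]]])
    have "R (v n) (\<lambda>b. pd b (v n)) =
      (LINT x|lborel. (\<Sum>b\<in>Basis. pd b (v n) x * cnj (pd b \<phi> x)) - of_real \<mu> * (v n x * cnj (\<phi> x)))"
      unfolding R_def test_L2_inner(1)[OF \<Omega> v \<phi>] test_L2_inner(1)[OF \<Omega> test_pd[OF v] test_pd[OF \<phi>]]
      using i i' by (simp add: Bochner_Integration.integral_sum)
    then show ?thesis
      using small[OF v, of n] \<open>N > 0\<close>
      unfolding gradient_norm_integral[OF \<Omega> v] test_L2_inner(2)[OF \<Omega> v v, symmetric] N2[symmetric] by simp
  qed
  have "cmod (R w (\<lambda>b. weak_partial \<Omega> b w)) \<le> \<epsilon> * N * sqrt ((L2_norm \<Omega> w)\<^sup>2 + G)"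
  proof (rule LIMSEQ_le)
    show "(\<lambda>n. cmod (R (v n) (\<lambda>b. pd b (v n)))) \<longlonglongrightarrow> cmod (R w (\<lambda>b. weak_partial \<Omega> b w))"
      unfolding R_def
      by (intro tendsto_norm tendsto_diff tendsto_sum tendsto_mult tendsto_const L2_inner_tendsto H1
           H1_weak_partial(1)[OF \<Omega> H1(1)] test_in_L2[OF \<Omega> v] test_in_L2[OF \<Omega> test_pd[OF v]]
           test_in_L2[OF \<Omega> test_pd[OF \<phi>]] \<phi>L2 lim)
    show "(\<lambda>n. \<epsilon> * N * sqrt ((L2_norm \<Omega> (v n))\<^sup>2 + (\<Sum>b\<in>Basis. (L2_norm \<Omega> (pd b (v n)))\<^sup>2))) \<longlonglongrightarrow>
      \<epsilon> * N * sqrt ((L2_norm \<Omega> w)\<^sup>2 + G)"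
      unfolding G_def
      by (intro tendsto_mult tendsto_const tendsto_real_sqrt tendsto_add tendsto_sum tendsto_power L2_norm_tendsto
          H1 H1_weak_partial(1)[OF \<Omega> H1(1)] test_in_L2[OF \<Omega> v] test_in_L2[OF \<Omega> test_pd[OF v]] lim)
  qed (use R in blast)
  also have "\<dots> \<le> \<epsilon> * N * (K * N)" using bound \<open>\<epsilon> > 0\<close> \<open>N > 0\<close> by simp
  also have "\<dots> < N\<^sup>2" using \<open>\<epsilon> * K < 1\<close> \<open>N > 0\<close> by (simp add: power2_eq_square)
  finally have less: "cmod (R w (\<lambda>b. weak_partial \<Omega> b w)) < N\<^sup>2" .
  have "L2_inner \<Omega> (weak_partial \<Omega> b w) (weak_partial \<Omega> b \<phi>) = L2_inner \<Omega> (weak_partial \<Omega> b w) (pd b \<phi>)"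
    if b: "b \<in> Basis" for b
    unfolding L2_inner_def
  proof (rule integral_cong_AE)
    note wp = H1_weak_partial(1)[OF \<Omega> H1(1) b]
    show "(\<lambda>x. weak_partial \<Omega> b w x * cnj (weak_partial \<Omega> b \<phi> x)) \<in> borel_measurable (lebesgue_on \<Omega>)"
      using L2_inner_integrable[OF wp test_weak_partial(1)[OF \<Omega> \<phi>]] by simp
    show "(\<lambda>x. weak_partial \<Omega> b w x * cnj (pd b \<phi> x)) \<in> borel_measurable (lebesgue_on \<Omega>)"
      using L2_inner_integrable[OF wp test_in_L2[OF \<Omega> test_pd[OF \<phi>]]] by simp
    show "AE x in lebesgue_on \<Omega>. weak_partial \<Omega> b w x * cnj (weak_partial \<Omega> b \<phi> x) = weak_partial \<Omega> b w x * cnj (pd b \<phi> x)"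
      using test_weak_partial(2)[OF \<Omega> \<phi>, of b] by eventually_elim simp
  qed
  \<comment> \<open>The equation for w, tested with \<phi>, evaluates the residual exactly: the
    terms with \<mu> cancel and the squared norm of \<phi> remains.\<close>
  then have "R w (\<lambda>b. weak_partial \<Omega> b w) = dirichlet_form \<Omega> w \<phi> - of_real \<mu> * L2_inner \<Omega> w \<phi>"
    by (simp add: R_def dirichlet_form_def)
  also have "\<dots> = of_real (N\<^sup>2)"
    using weq[OF test_in_H1_0[OF \<Omega> \<phi>]] inner[OF \<phi>L2] by (simp add: L2_inner_self N_def)
  finally have "cmod (R w (\<lambda>b. weak_partial \<Omega> b w)) = N\<^sup>2" by (simp add: norm_power)
  with less show False by simp
qed

text \<open>An open half-line contained in the spectrum has only limit points, so none of its points
  is removed as an isolated eigenvalue; e tending to 0 gives the bound.\<close>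

lemma ess_threshold_le:
  assumes "\<And>\<mu>. \<mu> > \<Lambda> \<Longrightarrow> complex_of_real \<mu> \<in> op_spectrum \<Omega> T"
  shows "ess_threshold \<Omega> T \<le> ereal \<Lambda>"
proof (rule ereal_le_epsilon2)
  fix e :: real assume "e > 0"
  show "ess_threshold \<Omega> T \<le> ereal \<Lambda> + ereal e"
  proof -
    have "complex_of_real (\<Lambda> + e) islimpt op_spectrum \<Omega> T"
    proof (unfold islimpt_approachable, intro allI impI)
      fix d :: real assume "d > 0"
      show "\<exists>x'\<in>op_spectrum \<Omega> T. x' \<noteq> complex_of_real (\<Lambda> + e) \<and> dist x' (complex_of_real (\<Lambda> + e)) < d"
        \<comment> \<open>Neighbours to the right stay in the half-line, whatever the size of
          d.\<close>
        using assms[of "\<Lambda> + e + d / 2"] \<open>d > 0\<close> \<open>e > 0\<close>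
        by (intro bexI[of _ "complex_of_real (\<Lambda> + e + d / 2)"]) (auto simp: dist_norm simp flip: of_real_diff of_real_add)
    qed
    then have "complex_of_real (\<Lambda> + e) \<in> essential_spectrum \<Omega> T"
      using assms[of "\<Lambda> + e"] \<open>e > 0\<close> by (simp add: essential_spectrum_def)
    then have "ess_threshold \<Omega> T \<le> ereal (Re (complex_of_real (\<Lambda> + e)))"
      unfolding ess_threshold_def by (rule INF_lower)
    then show "ess_threshold \<Omega> T \<le> ereal \<Lambda> + ereal e" by simp
  qed
qed

section \<open>Layers of polyhedral cones with non-acute normals\<close>

text \<open>Because distinct normals have nonpositive products, moving perpendicularly towards one
  face plane never decreases the distance to another. The foot therefore stays in U and lies on the
  frontier, so the nearest face plane already determines the distance.\<close>

lemma cone_infdist_frontier: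
  fixes V :: "'a::euclidean_space" and K :: "'a set"
  defines "U \<equiv> {x. \<forall>k\<in>K. 0 \<le> k \<bullet> (x - V)}"
  assumes K: "finite K" "\<And>k. k \<in> K \<Longrightarrow> norm k = 1"
    "\<And>k l. k \<in> K \<Longrightarrow> l \<in> K \<Longrightarrow> k \<noteq> l \<Longrightarrow> k \<bullet> l \<le> 0" "K \<noteq> {}"
    and x: "x \<in> U"
  shows "infdist x (frontier U) = Min ((\<lambda>k. k \<bullet> (x - V)) ` K)"
proof -
  have U: "U = (\<Inter>k\<in>K. {x. k \<bullet> (x - V) \<ge> 0})" by (auto simp: U_def)
  have "closed U" unfolding U
    by (intro closed_INT ballI closed_Collect_le continuous_intros)
  have "open (\<Inter>k\<in>K. {x. k \<bullet> (x - V) > 0})" using K(1)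
    by (intro open_INT ballI open_Collect_less continuous_intros) auto
  moreover have "(\<Inter>k\<in>K. {x. k \<bullet> (x - V) > 0}) \<subseteq> U" unfolding U by force
  ultimately have int: "(\<Inter>k\<in>K. {x. k \<bullet> (x - V) > 0}) \<subseteq> interior U" by (rule interior_maximal[rotated])
  have foot: "x - (k \<bullet> (x - V)) *\<^sub>R k \<in> frontier U" if k: "k \<in> K" for k
  proof -
    define z where "z = x - (k \<bullet> (x - V)) *\<^sub>R k"
    have kk: "k \<bullet> k = 1" using K(2)[OF k] by (simp add: norm_eq_1)
    have kz: "k \<bullet> (z - V) = 0" using kk by (simp add: z_def inner_diff_right)
    have "l \<bullet> (z - V) \<ge> 0" if l: "l \<in> K" for l
    proof (cases "l = k")
      case False
      have "l \<bullet> (z - V) = l \<bullet> (x - V) - (k \<bullet> (x - V)) * (l \<bullet> k)"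
        by (simp add: z_def inner_diff_right algebra_simps)
      moreover have "(k \<bullet> (x - V)) * (l \<bullet> k) \<le> 0"
        using K(3)[OF l k False] x k by (intro mult_nonneg_nonpos) (auto simp: U_def)
      ultimately show ?thesis using x l by (auto simp: U_def)
    qed (use kz in simp)
    then have "z \<in> U" by (simp add: U_def)
    moreover have "z \<notin> interior U"
    proof
      assume "z \<in> interior U"
      then obtain e where "e > 0" "ball z e \<subseteq> U" by (auto simp: mem_interior)
      then have "z - (e / 2) *\<^sub>R k \<in> U" using K(2)[OF k] by (intro subsetD[OF \<open>ball z e \<subseteq> U\<close>]) (simp add: dist_norm)
      then have "k \<bullet> (z - (e / 2) *\<^sub>R k - V) \<ge> 0" using k by (simp add: U_def)
      moreover have "k \<bullet> (z - (e / 2) *\<^sub>R k - V) = k \<bullet> (z - V) - (e / 2) * (k \<bullet> k)"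
        by (simp add: inner_diff_right)
      ultimately show False using kz kk \<open>e > 0\<close> by simp
    qed
    ultimately show ?thesis unfolding z_def[symmetric] frontier_def using closure_subset by auto
  qed
  let ?m = "Min ((\<lambda>k. k \<bullet> (x - V)) ` K)"
  have ne: "frontier U \<noteq> {}" using foot K(4) by auto
  show ?thesis
  proof (rule antisym)
    have "?m \<in> (\<lambda>k. k \<bullet> (x - V)) ` K" using K by (intro Min_in) auto
    then obtain k where k: "k \<in> K" "?m = k \<bullet> (x - V)" by auto
    have "infdist x (frontier U) \<le> dist x (x - (k \<bullet> (x - V)) *\<^sub>R k)" by (rule infdist_le[OF foot[OF k(1)]])
    also have "\<dots> = ?m" using K(2)[OF k(1)] k x by (auto simp: dist_norm U_def)
    finally show "infdist x (frontier U) \<le> ?m" .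
    \<comment> \<open>A frontier point violates some strict inequality, and the corresponding unit
      normal k gives the lower bound by Cauchy-Schwarz.\<close>
    have "?m \<le> dist x z" if z: "z \<in> frontier U" for z
    proof -
      have "z \<in> U" "z \<notin> interior U" using z \<open>closed U\<close> by (auto simp: frontier_def)
      then obtain k where k: "k \<in> K" "k \<bullet> (z - V) \<le> 0" using int by (force simp: not_less)
      have "?m \<le> k \<bullet> (x - V)" using K(1) k(1) by simp
      also have "\<dots> \<le> k \<bullet> (x - z)" using k(2) by (simp add: inner_diff_right)
      also have "\<dots> \<le> norm k * norm (x - z)" by (rule norm_cauchy_schwarz)
      finally show ?thesis using K(2)[OF k(1)] by (simp add: dist_norm)
    qed
    then show "?m \<le> infdist x (frontier U)"
      unfolding infdist_notempty[OF ne] by (intro cINF_greatest ne)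
  qed
qed

locale wedge =
  fixes V e1 e2 e3 :: "real^3" and \<alpha> :: real
  assumes orthonormal: "e1 \<bullet> e1 = 1" "e2 \<bullet> e2 = 1" "e3 \<bullet> e3 = 1" "e1 \<bullet> e2 = 0" "e1 \<bullet> e3 = 0" "e2 \<bullet> e3 = 0"
    and angle_bounds: "0 < \<alpha>" "\<alpha> < pi / 2"
begin

abbreviation "co \<equiv> cos (\<alpha> / 2)"
abbreviation "si \<equiv> sin (\<alpha> / 2)"

text \<open>
  The cone is \<open>{x. n \<bullet> (x - V) \<ge> 0}\<close> for the inner unit normals \<open>n1\<close>, \<open>n2\<close>, \<open>e3\<close>; \<open>e1\<close> points along
  the bisector of the angle \<open>\<alpha>\<close> and \<open>e3\<close> along the edge orthogonal to its plane.
\<close>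

definition "n1 = si *\<^sub>R e1 + co *\<^sub>R e2"
definition "n2 = si *\<^sub>R e1 - co *\<^sub>R e2"

text \<open>These inequalities say that the minimum of the distances to the three face planes lies
  in (0, 1); by \<open>cone_infdist_frontier\<close> this minimum is the distance to the boundary of
  the cone.\<close>

definition layer :: "(real^3) set" where
  "layer = {x. 0 < n1 \<bullet> (x - V) \<and> 0 < n2 \<bullet> (x - V) \<and> 0 < e3 \<bullet> (x - V) \<and>
     (n1 \<bullet> (x - V) < 1 \<or> n2 \<bullet> (x - V) < 1 \<or> e3 \<bullet> (x - V) < 1)}"

lemma orthonormal': "e2 \<bullet> e1 = 0" "e3 \<bullet> e1 = 0" "e3 \<bullet> e2 = 0"
  using orthonormal by (simp_all add: inner_commute)

lemma co_pos: "0 < co" and si_pos: "0 < si" and si_less_co: "si < co"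
proof -
  show "0 < co" "0 < si" using angle_bounds by (auto intro!: cos_gt_zero sin_gt_zero)
  have "sin (\<alpha> / 2) < sin (pi / 2 - \<alpha> / 2)" using angle_bounds by (intro sin_monotone_2pi) auto
  then show "si < co" by (simp add: sin_diff)
qed

text \<open>The sign comes from si^2 - co^2 = -cos \<alpha>, where \<alpha> < pi / 2 enters through
  \<open>si_less_co\<close>.\<close>

lemma normals_inner:
  "n1 \<bullet> n1 = 1" "n2 \<bullet> n2 = 1" "n1 \<bullet> n2 \<le> 0" "n1 \<bullet> e3 = 0" "n2 \<bullet> e3 = 0"
proof -
  have "si\<^sup>2 + co\<^sup>2 = 1" by simp
  then show "n1 \<bullet> n1 = 1" "n2 \<bullet> n2 = 1"
    by (simp_all add: n1_def n2_def inner_simps orthonormal orthonormal' power2_eq_square)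
  have "si * si \<le> co * co" using si_pos si_less_co by (intro mult_mono) auto
  then show "n1 \<bullet> n2 \<le> 0" by (simp add: n1_def n2_def inner_simps orthonormal orthonormal')
  show "n1 \<bullet> e3 = 0" "n2 \<bullet> e3 = 0" by (simp_all add: n1_def n2_def inner_simps orthonormal orthonormal')
qed

lemma open_layer: "open layer"
proof -
  have eq: "layer = {x. 0 < n1 \<bullet> (x - V)} \<inter> {x. 0 < n2 \<bullet> (x - V)} \<inter> {x. 0 < e3 \<bullet> (x - V)} \<inter>
    ({x. n1 \<bullet> (x - V) < 1} \<union> {x. n2 \<bullet> (x - V) < 1} \<union> {x. e3 \<bullet> (x - V) < 1})"
    by (auto simp: layer_def)
  show ?thesis unfolding eq by (intro open_Int open_Un open_Collect_less continuous_intros)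
qed

lemma expand: "(x \<bullet> e1) *\<^sub>R e1 + (x \<bullet> e2) *\<^sub>R e2 + (x \<bullet> e3) *\<^sub>R e3 = x"
proof -
  have ne: "e1 \<noteq> e2" "e1 \<noteq> e3" "e2 \<noteq> e3" using orthonormal by auto
  have po: "pairwise orthogonal {e1, e2, e3}"
    using orthonormal orthonormal' by (auto simp: pairwise_def orthogonal_def)
  have "0 \<notin> {e1, e2, e3}" using orthonormal by auto
  with po have "independent {e1, e2, e3}" by (rule pairwise_orthogonal_independent)
  moreover have "card {e1, e2, e3} = 3" using ne by simp
  ultimately have "UNIV \<subseteq> span {e1, e2, e3}"
    by (intro card_ge_dim_independent) auto
  then have "(\<Sum>i\<in>{e1, e2, e3}. (x \<bullet> i) *\<^sub>R i) = x"
    using po orthonormal by (intro orthonormal_basis_expand) (auto simp: norm_eq_1)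
  then show ?thesis using ne by (simp add: add.assoc)
qed

lemma unit_layer_eq_layer:
  assumes P: "range P = {A, B, E}"
    and A: "A = V + a *\<^sub>R (co *\<^sub>R e1 - si *\<^sub>R e2)" "a > 0"
    and B: "B = V + b *\<^sub>R (co *\<^sub>R e1 + si *\<^sub>R e2)" "b > 0"
    and E: "E = V + d *\<^sub>R e3" "d > 0"
  shows "unit_layer V P = layer"
proof -
  define U where "U = {x. \<forall>k\<in>{n1, n2, e3}. 0 \<le> k \<bullet> (x - V)}"
  have rays: "(\<Union>j. ray V (P j)) = ray V A \<union> ray V B \<union> ray V E"
  proof -
    have "(\<Union>j. ray V (P j)) = (\<Union>Q\<in>range P. ray V Q)" by simp
    then show ?thesis unfolding P by auto
  qed
  have U: "trihedral_angle V P = U"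
  proof
    have "convex {x. 0 \<le> k \<bullet> (x - V)}" for k
      using convex_halfspace_ge[of "k \<bullet> V" k] by (simp add: inner_diff_right)
    then have "convex (\<Inter>k\<in>{n1, n2, e3}. {x. 0 \<le> k \<bullet> (x - V)})"
      by (intro convex_INT) auto
    moreover have "(\<Inter>k\<in>{n1, n2, e3}. {x. 0 \<le> k \<bullet> (x - V)}) = U" by (auto simp: U_def)
    ultimately have "convex U" by simp
    moreover have "ray V A \<union> ray V B \<union> ray V E \<subseteq> U"
    proof -
      have "n1 \<bullet> (co *\<^sub>R e1 - si *\<^sub>R e2) = 0" "n2 \<bullet> (co *\<^sub>R e1 - si *\<^sub>R e2) = 2 * si * co"
        "n1 \<bullet> (co *\<^sub>R e1 + si *\<^sub>R e2) = 2 * si * co" "n2 \<bullet> (co *\<^sub>R e1 + si *\<^sub>R e2) = 0"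
        "e3 \<bullet> (co *\<^sub>R e1 - si *\<^sub>R e2) = 0" "e3 \<bullet> (co *\<^sub>R e1 + si *\<^sub>R e2) = 0"
        by (simp_all add: n1_def n2_def inner_simps orthonormal orthonormal')
      then show ?thesis using A(2) B(2) E(2) co_pos si_pos normals_inner(4,5) orthonormal(3)
        unfolding A(1) B(1) E(1) U_def ray_def by auto
    qed
    ultimately show "trihedral_angle V P \<subseteq> U"
      unfolding trihedral_angle_def rays by (intro hull_minimal) auto
  next
    show "U \<subseteq> trihedral_angle V P"
    proof
      fix x assume x: "x \<in> U"
      define y where "y = x - V"
      \<comment> \<open>Coordinates along the edges: \<open>n2\<close> is orthogonal to the edges
        through B and E and has product 2 si co with the direction of the edge through A, so it
        reads off p; likewise \<open>n1\<close> reads off q.\<close>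
      define p where "p = n2 \<bullet> y / (2 * si * co)"
      define q where "q = n1 \<bullet> y / (2 * si * co)"
      define r where "r = e3 \<bullet> y"
      have pqr: "p \<ge> 0" "q \<ge> 0" "r \<ge> 0" using x co_pos si_pos by (auto simp: p_def q_def r_def U_def y_def)
      have pq: "(p + q) * co = y \<bullet> e1" "(q - p) * si = y \<bullet> e2"
        using co_pos si_pos by (simp_all add: p_def q_def n1_def n2_def inner_simps inner_commute field_simps)
      have y: "y = p *\<^sub>R (co *\<^sub>R e1 - si *\<^sub>R e2) + q *\<^sub>R (co *\<^sub>R e1 + si *\<^sub>R e2) + r *\<^sub>R e3"
        using expand[of y] unfolding pq[symmetric] by (simp add: algebra_simps r_def inner_commute)
      let ?H = "convex hull (ray V A \<union> ray V B \<union> ray V E)"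
      have mem: "V + t *\<^sub>R (Q - V) \<in> ?H" if "t \<ge> 0" "Q \<in> {A, B, E}" for t Q
        using that by (intro hull_inc) (auto simp: ray_def)
      \<comment> \<open>The factor 3 compensates for averaging: x is the barycentre of one point on
        each ray, which puts it into the convex hull.\<close>
      let ?a = "V + (3 * p / a) *\<^sub>R (A - V)" and ?b = "V + (3 * q / b) *\<^sub>R (B - V)" and ?e = "V + (3 * r / d) *\<^sub>R (E - V)"
      have abe: "?a \<in> ?H" "?b \<in> ?H" "?e \<in> ?H" using pqr A B E by (intro mem; simp)+
      have "(1 / 2) *\<^sub>R ?a + (1 / 2) *\<^sub>R ?b \<in> ?H" by (rule convexD[OF convex_convex_hull abe(1,2)]) auto
      then have "(2 / 3) *\<^sub>R ((1 / 2) *\<^sub>R ?a + (1 / 2) *\<^sub>R ?b) + (1 / 3) *\<^sub>R ?e \<in> ?H"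
        by (rule convexD[OF convex_convex_hull _ abe(3)]) auto
      also have "(2 / 3) *\<^sub>R ((1 / 2) *\<^sub>R ?a + (1 / 2) *\<^sub>R ?b) + (1 / 3) *\<^sub>R ?e = V + y"
      proof -
        have *: "?a = V + (3 * p) *\<^sub>R (co *\<^sub>R e1 - si *\<^sub>R e2)" "?b = V + (3 * q) *\<^sub>R (co *\<^sub>R e1 + si *\<^sub>R e2)"
          "?e = V + (3 * r) *\<^sub>R e3"
          using A B E by simp_all
        have v: "(1 / 3) *\<^sub>R V + ((1 / 3) *\<^sub>R V + (1 / 3) *\<^sub>R V) = V"
          by (simp flip: scaleR_add_left)
        show ?thesis unfolding * y using v by (simp add: scaleR_add_right add_ac)
      qed
      finally show "x \<in> trihedral_angle V P"
        unfolding trihedral_angle_def rays y_def by simp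
    qed
  qed
  have "infdist x (frontier U) = Min ((\<lambda>k. k \<bullet> (x - V)) ` {n1, n2, e3})" if "x \<in> U" for x
    unfolding U_def
  proof (rule cone_infdist_frontier)
    show "norm k = 1" if "k \<in> {n1, n2, e3}" for k
      using that normals_inner orthonormal by (auto simp: norm_eq_1)
    show "k \<bullet> l \<le> 0" if "k \<in> {n1, n2, e3}" "l \<in> {n1, n2, e3}" "k \<noteq> l" for k l
      using that normals_inner by (auto simp: inner_commute)
  qed (use that in \<open>auto simp: U_def\<close>)
  then show ?thesis unfolding unit_layer_def U layer_def
    by (auto simp: U_def min_less_iff_disj)
qed

end

section \<open>Adapted frames for trihedral angles with two right vertex angles\<close>

lemma angle_eq_half_pi_iff:
  assumes "A \<noteq> V" "B \<noteq> V"
  shows "angle A V B = pi / 2 \<longleftrightarrow> (A - V) \<bullet> (B - V) = 0"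
proof -
  let ?t = "(A - V) \<bullet> (B - V) / (norm (A - V) * norm (B - V))"
  have "\<bar>?t\<bar> \<le> 1" using assms Cauchy_Schwarz_ineq2[of "A - V" "B - V"] by (simp add: abs_mult divide_le_eq_1)
  then have "arccos ?t = pi / 2 \<longleftrightarrow> ?t = 0"
    by (metis abs_le_iff arccos_0 arccos_cos cos_arccos cos_pi_half minus_le_iff)
  then show ?thesis using assms by (simp add: angle_def)
qed

lemma cos_angle:
  assumes "A \<noteq> V" "B \<noteq> V"
  shows "(A - V) \<bullet> (B - V) = norm (A - V) * norm (B - V) * cos (angle A V B)"
proof -
  let ?t = "(A - V) \<bullet> (B - V) / (norm (A - V) * norm (B - V))"
  have "\<bar>?t\<bar> \<le> 1" using assms Cauchy_Schwarz_ineq2[of "A - V" "B - V"] by (simp add: abs_mult divide_le_eq_1)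
  then have "cos (angle A V B) = ?t" unfolding angle_def by (intro cos_arccos_abs)
  then show ?thesis using assms by simp
qed

text \<open>Both right angles contain the edge through P (j + 2), which is therefore orthogonal to
  the plane of the angle \<alpha> and gives \<open>e3\<close>. The unit vectors u, w along the other
  two edges give \<open>e1\<close> and \<open>e2\<close> as normalised sum and difference.\<close>

lemma trihedral_wedge:
  fixes V :: "real^3" and P :: "3 \<Rightarrow> real^3" and j :: 3
  assumes tri: "is_trihedral V P" and \<alpha>: "0 < \<alpha>" "\<alpha> < pi / 2"
    and ang: "vertex_angle V P j = \<alpha>" "vertex_angle V P (j + 1) = pi / 2" "vertex_angle V P (j + 2) = pi / 2"
  obtains e1 e2 e3 where "wedge e1 e2 e3 \<alpha>" "unit_layer V P = wedge.layer V e1 e2 e3 \<alpha>"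
proof -
  define A B E where "A = P j" "B = P (j + 1)" "E = P (j + 2)"
  have "UNIV = {j, j + 1, j + 2}"
  proof -
    have "i \<in> {j, j + 1, j + 2}" for i :: 3
      using exhaust_3[of i] exhaust_3[of j] by auto
    then show ?thesis by blast
  qed
  then have rng: "range P = {A, B, E}" by (auto simp: A_B_E_def)
  have "V \<notin> range P" using tri hull_subset[of "range P" affine] by (auto simp: is_trihedral_def)
  then have ne: "A \<noteq> V" "B \<noteq> V" "E \<noteq> V" using rng by auto
  have j3: "j + 1 + 1 = j + 2" "j + 2 + 1 = j" using exhaust_3[of j] by auto
  have BE: "(B - V) \<bullet> (E - V) = 0" and EA: "(E - V) \<bullet> (A - V) = 0"
    using ang ne angle_eq_half_pi_iff unfolding vertex_angle_def j3 A_B_E_def by blast+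
  have AB: "(A - V) \<bullet> (B - V) = norm (A - V) * norm (B - V) * cos \<alpha>"
    using cos_angle[OF ne(1,2)] ang(1) by (simp add: vertex_angle_def A_B_E_def)
  define u w e3 where "u = (1 / norm (A - V)) *\<^sub>R (A - V)" "w = (1 / norm (B - V)) *\<^sub>R (B - V)"
    "e3 = (1 / norm (E - V)) *\<^sub>R (E - V)"
  have nn: "norm (A - V) > 0" "norm (B - V) > 0" "norm (E - V) > 0" using ne by auto
  have uw: "u \<bullet> u = 1" "w \<bullet> w = 1" "e3 \<bullet> e3 = 1" "u \<bullet> w = cos \<alpha>" "u \<bullet> e3 = 0" "w \<bullet> e3 = 0"
    using nn AB BE EA by (simp_all add: u_w_e3_def dot_square_norm power2_eq_square inner_commute)
  let ?c = "cos (\<alpha> / 2)" and ?s = "sin (\<alpha> / 2)"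
  have cs: "?c > 0" "?s > 0" using \<alpha> by (auto intro!: cos_gt_zero sin_gt_zero)
  have cos2: "cos \<alpha> = 2 * ?c\<^sup>2 - 1" "cos \<alpha> = 1 - 2 * ?s\<^sup>2"
    using cos_double_cos[of "\<alpha> / 2"] cos_double_sin[of "\<alpha> / 2"] by (simp_all add: cos_squared_eq)
  \<comment> \<open>u + w and w - u are orthogonal, of lengths 2 cos (\<alpha> / 2) and 2 sin
    (\<alpha> / 2).\<close>
  define e1 e2 where "e1 = (1 / (2 * ?c)) *\<^sub>R (u + w)" "e2 = (1 / (2 * ?s)) *\<^sub>R (w - u)"
  have "e1 \<bullet> e1 = 1" "e1 \<bullet> e2 = 0" "e1 \<bullet> e3 = 0" "e2 \<bullet> e3 = 0"
    using cs cos2(1) by (simp_all add: e1_e2_def inner_simps uw inner_commute[of w u] power2_eq_square field_simps)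
  moreover have "e2 \<bullet> e2 = 1"
    using cs by (simp add: e1_e2_def inner_simps uw inner_commute[of w u] cos2(2)) (simp add: power2_eq_square field_simps)
  ultimately interpret wedge V e1 e2 e3 \<alpha>
    using uw \<alpha> by unfold_locales auto
  have "unit_layer V P = layer"
  proof (rule unit_layer_eq_layer[OF rng])
    have h: "(1 / 2) *\<^sub>R (u + w) - (1 / 2) *\<^sub>R (w - u) = u" "(1 / 2) *\<^sub>R (u + w) + (1 / 2) *\<^sub>R (w - u) = w"
      by (simp_all add: scaleR_diff_right[symmetric] scaleR_add_right[symmetric])
    show "A = V + norm (A - V) *\<^sub>R (?c *\<^sub>R e1 - ?s *\<^sub>R e2)"
      using cs nn h(1) by (simp add: e1_e2_def) (simp add: u_w_e3_def)
    show "B = V + norm (B - V) *\<^sub>R (?c *\<^sub>R e1 + ?s *\<^sub>R e2)"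
      using cs nn h(2) by (simp add: e1_e2_def) (simp add: u_w_e3_def)
    show "E = V + norm (E - V) *\<^sub>R e3" using nn by (simp add: u_w_e3_def)
  qed (use nn in auto)
  then show ?thesis using that wedge_axioms by blast
qed

section \<open>A Poincare inequality along lines\<close>

text \<open>The quadratic in c is the integral of |g + c|^2 over the interval, that is, g is paired
  with the constant 1, whose mass is s.\<close>

lemma interval_cauchy_schwarz:
  fixes g :: "real \<Rightarrow> complex"
  assumes g: "continuous_on UNIV g" and s: "s \<ge> 0"
  shows "(cmod (LINT r|lborel. indicator {0..s} r *\<^sub>R g r))\<^sup>2 \<le>
    s * (LINT r|lborel. indicator {0..s} r * (cmod (g r))\<^sup>2)"
proof -
  let ?B = "LINT r|lborel. indicator {0..s} r *\<^sub>R g r"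
  let ?A = "LINT r|lborel. indicator {0..s} r * (cmod (g r))\<^sup>2"
  have i1: "integrable lborel (\<lambda>r. indicator {0..s} r *\<^sub>R g r)"
    by (intro borel_integrable_compact continuous_on_subset[OF g]) auto
  have "integrable lborel (\<lambda>r. indicator {0..s} r *\<^sub>R (cmod (g r))\<^sup>2)"
    by (intro borel_integrable_compact continuous_intros continuous_on_subset[OF g]) auto
  then have i2: "integrable lborel (\<lambda>r. indicator {0..s} r * (cmod (g r))\<^sup>2)" by simp
  have i3: "integrable lborel (\<lambda>r. indicator {0..s} r :: real)"
    using s by (intro integrable_real_indicator) auto
  have i4: "integrable lborel (\<lambda>r. Re (cnj c * (indicator {0..s} r *\<^sub>R g r)))" for c
    by (intro integrable_Re integrable_mult_right i1)
  have "cmod ?B \<le> sqrt ?A * sqrt s"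
  proof (rule quadratic_form_cauchy_schwarz)
    fix c
    have "0 \<le> (LINT r|lborel. indicator {0..s} r * (cmod (g r + c * 1))\<^sup>2)"
      by (intro integral_nonneg_AE) auto
    also have "(\<lambda>r. indicator {0..s} r * (cmod (g r + c * 1))\<^sup>2) =
      (\<lambda>r. indicator {0..s} r * (cmod (g r))\<^sup>2 + 2 * Re (cnj c * (indicator {0..s} r *\<^sub>R g r)) + (cmod c)\<^sup>2 * indicator {0..s} r)"
      unfolding cmod_lincomb_power2 by (auto simp: indicator_def)
    also have "(LINT r|lborel. indicator {0..s} r * (cmod (g r))\<^sup>2 + 2 * Re (cnj c * (indicator {0..s} r *\<^sub>R g r)) + (cmod c)\<^sup>2 * indicator {0..s} r)
       = ?A + 2 * (LINT r|lborel. Re (cnj c * (indicator {0..s} r *\<^sub>R g r))) + (cmod c)\<^sup>2 * (LINT r|lborel. indicator {0..s} r)"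
      using i2 i3 i4 by (simp only: Bochner_Integration.integral_add Bochner_Integration.integrable_add
          integrable_mult_right integral_mult_right_zero)
    also have "(LINT r|lborel. Re (cnj c * (indicator {0..s} r *\<^sub>R g r))) = Re (cnj c * ?B)"
      unfolding integral_mult_right_zero[symmetric] by (rule integral_Re[OF integrable_mult_right[OF i1]])
    also have "(LINT r|lborel. indicator {0..s} r) = s" using s by simp
    finally show "0 \<le> ?A + 2 * Re (cnj c * ?B) + (cmod c)\<^sup>2 * s" .
  qed (use s in auto)
  then have "(cmod ?B)\<^sup>2 \<le> (sqrt ?A * sqrt s)\<^sup>2" by (rule power_mono) simp
  moreover have "?A \<ge> 0" by (intro integral_nonneg_AE) auto
  ultimately show ?thesis using s by (simp add: power_mult_distrib mult.commute)
qed

text \<open>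
  The pointwise bound for \<open>f x\<close> by the integral over the segment down to the hyperplane is integrated
  over \<open>x\<close>; Tonelli and translation invariance then spare a rotation of the coordinates.
\<close>

lemma line_poincare:
  fixes f :: "'a::euclidean_space \<Rightarrow> complex"
  assumes f: "f \<in> test_functions \<Omega>" and n: "norm n = 1" and L: "0 < L" and B: "B \<in> sets borel"
    and strip: "\<And>x. x \<in> B \<Longrightarrow> 0 \<le> n \<bullet> (x - V) \<and> n \<bullet> (x - V) \<le> L"
    and star: "\<And>x r. x \<in> B \<Longrightarrow> 0 \<le> r \<Longrightarrow> r \<le> n \<bullet> (x - V) \<Longrightarrow> x - r *\<^sub>R n \<in> B"
    and zero: "\<And>x. x \<in> B \<Longrightarrow> f (x - (n \<bullet> (x - V)) *\<^sub>R n) = 0"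
  shows "2 / L\<^sup>2 * (LINT x|lborel. indicator B x * (cmod (f x))\<^sup>2) \<le>
    (LINT x|lborel. indicator B x * (cmod (pd n f x))\<^sup>2)"
proof -
  let ?s = "\<lambda>x. n \<bullet> (x - V)"
  let ?h = "pd n f"
  have sm: "smooth f" by (rule test_smooth[OF f])
  have hc: "continuous_on S ?h" for S by (rule smooth_continuous[OF smooth_pd[OF sm]])
  have [measurable]: "f \<in> borel_measurable borel" "?h \<in> borel_measurable borel"
    by (rule borel_measurable_continuous_onI[OF smooth_continuous[OF sm]], rule borel_measurable_continuous_onI[OF hc])
  note [measurable] = B
  \<comment> \<open>f x is the integral of the derivative over the segment of length n \<bullet> (x
    - V) that ends at a zero of f; Cauchy-Schwarz costs this length as a factor.\<close>
  have pointwise: "ennreal ((cmod (f x))\<^sup>2) \<le> (\<integral>\<^sup>+r. ennreal (indicator {0..?s x} r * (?s x * (cmod (?h (x - r *\<^sub>R n)))\<^sup>2)) \<partial>lborel)"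
    if x: "x \<in> B" for x
  proof -
    have s: "0 \<le> ?s x" using strip[OF x] by simp
    have "(LINT r|lborel. indicator {0..?s x} r *\<^sub>R pd (- n) f (x + r *\<^sub>R (- n))) = f (x + ?s x *\<^sub>R (- n)) - f (x + 0 *\<^sub>R (- n))"
      by (rule pd_line_integral[OF sm s])
    then have "(LINT r|lborel. indicator {0..?s x} r *\<^sub>R pd (- n) f (x + r *\<^sub>R (- n))) = - f x" using zero[OF x] by simp
    moreover have "pd (- n) f y = - ?h y" for y using pd_scaleR_direction[OF sm, where r = "-1" and a = n and x = y] by simp
    ultimately have "(LINT r|lborel. indicator {0..?s x} r *\<^sub>R ?h (x - r *\<^sub>R n)) = f x" by simp
    moreover have "continuous_on UNIV (\<lambda>r. ?h (x - r *\<^sub>R n))"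
      by (rule continuous_on_compose2[OF hc[of UNIV]]) (intro continuous_intros, simp)
    ultimately have "(cmod (f x))\<^sup>2 \<le> ?s x * (LINT r|lborel. indicator {0..?s x} r * (cmod (?h (x - r *\<^sub>R n)))\<^sup>2)"
      using interval_cauchy_schwarz[OF _ s, of "\<lambda>r. ?h (x - r *\<^sub>R n)"] by simp
    also have "\<dots> = (LINT r|lborel. indicator {0..?s x} r * (?s x * (cmod (?h (x - r *\<^sub>R n)))\<^sup>2))"
      by (subst integral_mult_right_zero[symmetric]) (simp add: mult_ac)
    finally have le: "(cmod (f x))\<^sup>2 \<le> (LINT r|lborel. indicator {0..?s x} r * (?s x * (cmod (?h (x - r *\<^sub>R n)))\<^sup>2))" .
    have "integrable lborel (\<lambda>r. indicator {0..?s x} r *\<^sub>R (?s x * (cmod (?h (x - r *\<^sub>R n)))\<^sup>2))"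
      by (intro borel_integrable_compact continuous_intros continuous_on_compose2[OF hc[of UNIV]]) auto
    then have "(\<integral>\<^sup>+r. ennreal (indicator {0..?s x} r * (?s x * (cmod (?h (x - r *\<^sub>R n)))\<^sup>2)) \<partial>lborel)
       = ennreal (LINT r|lborel. indicator {0..?s x} r * (?s x * (cmod (?h (x - r *\<^sub>R n)))\<^sup>2))"
      using s by (intro nn_integral_eq_integral) auto
    then show ?thesis using le by (simp add: ennreal_leI)
  qed
  \<comment> \<open>Origin of the constant: a point at height t receives the weight t + r from the
    point r above it, and the integral over r from 0 to L - t is (L^2 - t^2) / 2 \<le> L^2 /
    2.\<close>
  have length: "(\<integral>\<^sup>+r. ennreal (indicator {0..L - t} r * (t + r)) \<partial>lborel) \<le> ennreal (L\<^sup>2 / 2)"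
    if t: "0 \<le> t" "t \<le> L" for t
  proof -
    have "(\<integral>\<^sup>+r. ennreal (t + r) * indicator {0..L - t} r \<partial>lborel) = (t * (L - t) + (L - t)\<^sup>2 / 2) - (t * 0 + 0\<^sup>2 / 2)"
      by (rule nn_integral_FTC_Icc) (use t in \<open>auto intro!: derivative_eq_intros simp: has_real_derivative_iff_has_vector_derivative[symmetric]\<close>)
    also have "\<dots> \<le> ennreal (L\<^sup>2 / 2)"
      by (intro ennreal_leI) (simp add: power2_eq_square field_simps)
    finally have "(\<integral>\<^sup>+r. ennreal (t + r) * indicator {0..L - t} r \<partial>lborel) \<le> ennreal (L\<^sup>2 / 2)" .
    moreover have "(\<lambda>r. ennreal (indicator {0..L - t} r * (t + r))) = (\<lambda>r. ennreal (t + r) * indicator {0..L - t} r)"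
      by (auto simp: indicator_def)
    ultimately show ?thesis by simp
  qed
  have "(\<integral>\<^sup>+x. ennreal (indicator B x * (cmod (f x))\<^sup>2) \<partial>lborel) \<le>
    (\<integral>\<^sup>+x. (\<integral>\<^sup>+r. ennreal (indicator B x * (indicator {0..?s x} r * (?s x * (cmod (?h (x - r *\<^sub>R n)))\<^sup>2))) \<partial>lborel) \<partial>lborel)"
    by (intro nn_integral_mono) (auto simp: indicator_def[of B] intro!: pointwise)
  also have "\<dots> = (\<integral>\<^sup>+r. (\<integral>\<^sup>+x. ennreal (indicator B x * (indicator {0..?s x} r * (?s x * (cmod (?h (x - r *\<^sub>R n)))\<^sup>2))) \<partial>lborel) \<partial>lborel)"
    unfolding atLeastAtMost_iff indicator_def[of "{0.._}"] by (intro lborel_pair.Fubini') measurable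
  \<comment> \<open>For fixed r the substitution x = r n + y moves the derivative from x - r n to y,
    while the height of x becomes that of y plus r.\<close>
  also have "\<dots> = (\<integral>\<^sup>+r. (\<integral>\<^sup>+y. ennreal (indicator B (r *\<^sub>R n + y) * (indicator {0..?s (r *\<^sub>R n + y)} r * (?s (r *\<^sub>R n + y) * (cmod (?h (r *\<^sub>R n + y - r *\<^sub>R n)))\<^sup>2))) \<partial>lborel) \<partial>lborel)"
  proof (rule nn_integral_cong)
    fix r :: real
    have "(\<lambda>x. ennreal (indicator B x * (indicator {0..?s x} r * (?s x * (cmod (?h (x - r *\<^sub>R n)))\<^sup>2)))) \<in> borel_measurable borel"
      unfolding atLeastAtMost_iff indicator_def[of "{0.._}"] by measurable
    from nn_integral_translation[OF this, of "r *\<^sub>R n", symmetric]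
    show "(\<integral>\<^sup>+x. ennreal (indicator B x * (indicator {0..?s x} r * (?s x * (cmod (?h (x - r *\<^sub>R n)))\<^sup>2))) \<partial>lborel) =
      (\<integral>\<^sup>+y. ennreal (indicator B (r *\<^sub>R n + y) * (indicator {0..?s (r *\<^sub>R n + y)} r * (?s (r *\<^sub>R n + y) * (cmod (?h (r *\<^sub>R n + y - r *\<^sub>R n)))\<^sup>2))) \<partial>lborel)" .
  qed
  also have "\<dots> \<le> (\<integral>\<^sup>+r. (\<integral>\<^sup>+y. ennreal (indicator B y * (cmod (?h y))\<^sup>2) * ennreal (indicator {0..L - ?s y} r * (?s y + r)) \<partial>lborel) \<partial>lborel)"
  proof (intro nn_integral_mono)
    fix r y
    have sy: "?s (r *\<^sub>R n + y) = ?s y + r"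
      using n by (simp add: inner_diff_right inner_add_right norm_eq_1)
    show "ennreal (indicator B (r *\<^sub>R n + y) * (indicator {0..?s (r *\<^sub>R n + y)} r * (?s (r *\<^sub>R n + y) * (cmod (?h (r *\<^sub>R n + y - r *\<^sub>R n)))\<^sup>2)))
      \<le> ennreal (indicator B y * (cmod (?h y))\<^sup>2) * ennreal (indicator {0..L - ?s y} r * (?s y + r))"
    proof (cases "r *\<^sub>R n + y \<in> B \<and> r \<in> {0..?s (r *\<^sub>R n + y)}")
      case True
      then have "y \<in> B" using star[of "r *\<^sub>R n + y" r] by simp
      moreover have "r \<in> {0..L - ?s y}" using True strip[of "r *\<^sub>R n + y"] unfolding sy by simp
      moreover have "0 \<le> ?s y + r" using True strip[of "r *\<^sub>R n + y"] unfolding sy by simp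
      ultimately show ?thesis using True unfolding sy
        by (simp add: ennreal_mult[symmetric] mult.commute del: ennreal_plus)
    qed (auto simp: indicator_def)
  qed
  also have "\<dots> = (\<integral>\<^sup>+y. (\<integral>\<^sup>+r. ennreal (indicator B y * (cmod (?h y))\<^sup>2) * ennreal (indicator {0..L - ?s y} r * (?s y + r)) \<partial>lborel) \<partial>lborel)"
    unfolding atLeastAtMost_iff indicator_def[of "{0.._}"] by (intro lborel_pair.Fubini') measurable
  also have "\<dots> = (\<integral>\<^sup>+y. ennreal (indicator B y * (cmod (?h y))\<^sup>2) * (\<integral>\<^sup>+r. ennreal (indicator {0..L - ?s y} r * (?s y + r)) \<partial>lborel) \<partial>lborel)"
    by (intro nn_integral_cong nn_integral_cmult) measurable
  also have "\<dots> \<le> (\<integral>\<^sup>+y. ennreal (indicator B y * (cmod (?h y))\<^sup>2) * ennreal (L\<^sup>2 / 2) \<partial>lborel)"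
  proof (intro nn_integral_mono)
    fix y show "ennreal (indicator B y * (cmod (?h y))\<^sup>2) * (\<integral>\<^sup>+r. ennreal (indicator {0..L - ?s y} r * (?s y + r)) \<partial>lborel)
      \<le> ennreal (indicator B y * (cmod (?h y))\<^sup>2) * ennreal (L\<^sup>2 / 2)"
    proof (cases "y \<in> B")
      case True
      then show ?thesis using strip[OF True] by (intro mult_left_mono length) auto
    qed auto
  qed
  also have "\<dots> = (\<integral>\<^sup>+y. ennreal (indicator B y * (cmod (?h y))\<^sup>2) \<partial>lborel) * ennreal (L\<^sup>2 / 2)"
    by (intro nn_integral_multc) measurable
  finally have nn: "(\<integral>\<^sup>+x. ennreal (indicator B x * (cmod (f x))\<^sup>2) \<partial>lborel) \<le>
    (\<integral>\<^sup>+y. ennreal (indicator B y * (cmod (?h y))\<^sup>2) \<partial>lborel) * ennreal (L\<^sup>2 / 2)" .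
  have i: "integrable lborel (\<lambda>x. indicator B x * (cmod (g x))\<^sup>2)" if "g \<in> test_functions \<Omega>" for g
    using integrable_mult_indicator[of B lborel "\<lambda>x. (cmod (g x))\<^sup>2"] test_power2_integrable[OF that] B by simp
  have e: "(\<integral>\<^sup>+x. ennreal (indicator B x * (cmod (g x))\<^sup>2) \<partial>lborel) = ennreal (LINT x|lborel. indicator B x * (cmod (g x))\<^sup>2)"
    if "g \<in> test_functions \<Omega>" for g
    by (intro nn_integral_eq_integral i that) auto
  have nonneg: "0 \<le> (LINT x|lborel. indicator B x * (cmod (?h x))\<^sup>2)" by (intro integral_nonneg_AE) auto
  have "ennreal (LINT x|lborel. indicator B x * (cmod (f x))\<^sup>2) \<le> ennreal ((LINT x|lborel. indicator B x * (cmod (?h x))\<^sup>2) * (L\<^sup>2 / 2))"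
    using nn unfolding e[OF f] e[OF test_pd[OF f]] by (subst ennreal_mult[OF nonneg]) auto
  then have "(LINT x|lborel. indicator B x * (cmod (f x))\<^sup>2) \<le> (LINT x|lborel. indicator B x * (cmod (?h x))\<^sup>2) * (L\<^sup>2 / 2)"
    using nonneg by (subst (asm) ennreal_le_iff) (auto intro!: mult_nonneg_nonneg)
  then show ?thesis using L by (simp add: field_simps)
qed

section \<open>The gradient expressed in the orthonormal frame\<close>

context wedge
begin

text \<open>Parseval for the standard basis: summing over b leaves the coefficient v \<bullet> w for
  each pair of frame vectors v, w (this is \<open>ip\<close>), and orthonormality removes the mixed
  terms.\<close>

lemma gradient_inner_frame:
  assumes "smooth f" "smooth g"
  shows "(\<Sum>b\<in>Basis. pd b f x * cnj (pd b g x)) =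
    pd e1 f x * cnj (pd e1 g x) + pd e2 f x * cnj (pd e2 g x) + pd e3 f x * cnj (pd e3 g x)"
proof -
  have pd: "pd b h x = (b \<bullet> e1) *\<^sub>R pd e1 h x + (b \<bullet> e2) *\<^sub>R pd e2 h x + (b \<bullet> e3) *\<^sub>R pd e3 h x"
    if "smooth h" for b and h :: "real^3 \<Rightarrow> complex"
    using that by (subst (1) expand[of b, symmetric]) (simp add: pd_add_direction pd_scaleR_direction)
  have ip: "(\<Sum>b\<in>Basis. complex_of_real (b \<bullet> v) * (complex_of_real (b \<bullet> w) * z)) = of_real (v \<bullet> w) * z" for v w :: "real^3" and z
  proof -
    have "of_real (v \<bullet> w) * z = (\<Sum>b\<in>Basis. complex_of_real (v \<bullet> b) * complex_of_real (w \<bullet> b)) * z"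
      by (simp only: euclidean_inner[of v w] of_real_sum of_real_mult)
    also have "\<dots> = (\<Sum>b\<in>Basis. complex_of_real (b \<bullet> v) * (complex_of_real (b \<bullet> w) * z))"
      by (simp only: sum_distrib_right mult.assoc inner_commute[of v] inner_commute[of w])
    finally show ?thesis by (rule sym)
  qed
  have alg: "(p1 *\<^sub>R X1 + p2 *\<^sub>R X2 + p3 *\<^sub>R X3) * cnj (p1 *\<^sub>R Y1 + p2 *\<^sub>R Y2 + p3 *\<^sub>R Y3) =
      of_real p1 * (of_real p1 * (X1 * cnj Y1)) +
      of_real p1 * (of_real p2 * (X1 * cnj Y2)) +
      of_real p1 * (of_real p3 * (X1 * cnj Y3)) +
      of_real p2 * (of_real p1 * (X2 * cnj Y1)) +
      of_real p2 * (of_real p2 * (X2 * cnj Y2)) +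
      of_real p2 * (of_real p3 * (X2 * cnj Y3)) +
      of_real p3 * (of_real p1 * (X3 * cnj Y1)) +
      of_real p3 * (of_real p2 * (X3 * cnj Y2)) +
      of_real p3 * (of_real p3 * (X3 * cnj Y3))" for p1 p2 p3 :: real and X1 X2 X3 Y1 Y2 Y3 :: complex
    unfolding scaleR_conv_of_real complex_cnj_add complex_cnj_mult complex_cnj_complex_of_real
    by (simp only: distrib_left distrib_right mult_ac add_ac)
  have "pd b f x * cnj (pd b g x) =
      of_real (b \<bullet> e1) * (of_real (b \<bullet> e1) * (pd e1 f x * cnj (pd e1 g x))) +
      of_real (b \<bullet> e1) * (of_real (b \<bullet> e2) * (pd e1 f x * cnj (pd e2 g x))) +
      of_real (b \<bullet> e1) * (of_real (b \<bullet> e3) * (pd e1 f x * cnj (pd e3 g x))) +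
      of_real (b \<bullet> e2) * (of_real (b \<bullet> e1) * (pd e2 f x * cnj (pd e1 g x))) +
      of_real (b \<bullet> e2) * (of_real (b \<bullet> e2) * (pd e2 f x * cnj (pd e2 g x))) +
      of_real (b \<bullet> e2) * (of_real (b \<bullet> e3) * (pd e2 f x * cnj (pd e3 g x))) +
      of_real (b \<bullet> e3) * (of_real (b \<bullet> e1) * (pd e3 f x * cnj (pd e1 g x))) +
      of_real (b \<bullet> e3) * (of_real (b \<bullet> e2) * (pd e3 f x * cnj (pd e2 g x))) +
      of_real (b \<bullet> e3) * (of_real (b \<bullet> e3) * (pd e3 f x * cnj (pd e3 g x)))" for b
    by (subst pd[OF assms(1), of b], subst pd[OF assms(2), of b]) (rule alg)
  then have "(\<Sum>b\<in>Basis. pd b f x * cnj (pd b g x)) = (\<Sum>b\<in>Basis.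
      of_real (b \<bullet> e1) * (of_real (b \<bullet> e1) * (pd e1 f x * cnj (pd e1 g x))) +
      of_real (b \<bullet> e1) * (of_real (b \<bullet> e2) * (pd e1 f x * cnj (pd e2 g x))) +
      of_real (b \<bullet> e1) * (of_real (b \<bullet> e3) * (pd e1 f x * cnj (pd e3 g x))) +
      of_real (b \<bullet> e2) * (of_real (b \<bullet> e1) * (pd e2 f x * cnj (pd e1 g x))) +
      of_real (b \<bullet> e2) * (of_real (b \<bullet> e2) * (pd e2 f x * cnj (pd e2 g x))) +
      of_real (b \<bullet> e2) * (of_real (b \<bullet> e3) * (pd e2 f x * cnj (pd e3 g x))) +
      of_real (b \<bullet> e3) * (of_real (b \<bullet> e1) * (pd e3 f x * cnj (pd e1 g x))) +
      of_real (b \<bullet> e3) * (of_real (b \<bullet> e2) * (pd e3 f x * cnj (pd e2 g x))) +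
      of_real (b \<bullet> e3) * (of_real (b \<bullet> e3) * (pd e3 f x * cnj (pd e3 g x))))"
    by (intro sum.cong refl)
  then show ?thesis
    unfolding sum.distrib ip by (simp add: orthonormal orthonormal')
qed

lemma gradient_norm_frame:
  fixes f :: "real^3 \<Rightarrow> complex"
  assumes "smooth f"
  shows "(\<Sum>b\<in>Basis. (cmod (pd b f x))\<^sup>2) = (cmod (pd e1 f x))\<^sup>2 + (cmod (pd e2 f x))\<^sup>2 + (cmod (pd e3 f x))\<^sup>2"
proof -
  have "complex_of_real (\<Sum>b\<in>Basis. (cmod (pd b f x))\<^sup>2) =
    of_real ((cmod (pd e1 f x))\<^sup>2 + (cmod (pd e2 f x))\<^sup>2 + (cmod (pd e3 f x))\<^sup>2)"
    using gradient_inner_frame[OF assms assms] by (simp only: of_real_sum of_real_add complex_norm_square)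
  then show ?thesis by (simp only: of_real_eq_iff)
qed

end

section \<open>The lower bound for the Dirichlet form\<close>

lemma test_indicator_power2_integrable:
  assumes "f \<in> test_functions \<Omega>" "B \<in> sets borel"
  shows "integrable lborel (\<lambda>x. indicator B x * (cmod (f x))\<^sup>2)"
  using integrable_mult_indicator[of B lborel "\<lambda>x. (cmod (f x))\<^sup>2"] test_power2_integrable[OF assms(1)] assms(2) by simp

context wedge
begin

lemma zero_outside:
  assumes "f \<in> test_functions layer"
    "n1 \<bullet> (x - V) \<le> 0 \<or> n2 \<bullet> (x - V) \<le> 0 \<or> e3 \<bullet> (x - V) \<le> 0 \<or>
     1 \<le> n1 \<bullet> (x - V) \<and> 1 \<le> n2 \<bullet> (x - V) \<and> 1 \<le> e3 \<bullet> (x - V)"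
  shows "f x = 0"
  using assms(2) by (intro test_eq_0[OF assms(1)]) (auto simp: layer_def)

lemma unit_vectors: "norm e1 = 1" "norm e2 = 1" "norm e3 = 1" "norm n1 = 1" "norm n2 = 1"
  using orthonormal normals_inner by (simp_all add: norm_eq_1)

lemma inner_step: "v \<bullet> (x - r *\<^sub>R n - V) = v \<bullet> (x - V) - r * (v \<bullet> n)"
  by (simp add: inner_diff_right)

text \<open>Bessel's inequality for the gradient, since each inclined normal together with
  \<open>e3\<close> is an orthonormal pair. The square discarded in \<open>cs\<close> is the
  derivative along the direction orthogonal to both.\<close>

lemma pd_normal_le:
  fixes f :: "real^3 \<Rightarrow> complex"
  assumes "smooth f"
  shows "(cmod (pd n1 f x))\<^sup>2 + (cmod (pd e3 f x))\<^sup>2 \<le> (\<Sum>b\<in>Basis. (cmod (pd b f x))\<^sup>2)"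
    "(cmod (pd n2 f x))\<^sup>2 + (cmod (pd e3 f x))\<^sup>2 \<le> (\<Sum>b\<in>Basis. (cmod (pd b f x))\<^sup>2)"
proof -
  have cs: "(cmod (si *\<^sub>R a + t *\<^sub>R b))\<^sup>2 \<le> (cmod a)\<^sup>2 + (cmod b)\<^sup>2" if "t\<^sup>2 = co\<^sup>2" for a b and t :: real
  proof -
    have "(cmod (si *\<^sub>R a + t *\<^sub>R b))\<^sup>2 + (cmod (t *\<^sub>R a - si *\<^sub>R b))\<^sup>2 = (si\<^sup>2 + t\<^sup>2) * ((cmod a)\<^sup>2 + (cmod b)\<^sup>2)"
      by (simp add: cmod_power2) (simp add: power2_eq_square algebra_simps)
    also have "\<dots> = (cmod a)\<^sup>2 + (cmod b)\<^sup>2" using that by simp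
    finally show ?thesis using zero_le_power2[of "cmod (t *\<^sub>R a - si *\<^sub>R b)"] by linarith
  qed
  have "pd n1 f x = si *\<^sub>R pd e1 f x + co *\<^sub>R pd e2 f x"
    by (simp add: n1_def pd_add_direction[OF assms] pd_scaleR_direction[OF assms])
  moreover have "pd n2 f x = si *\<^sub>R pd e1 f x + (- co) *\<^sub>R pd e2 f x"
    unfolding n2_def scaleR_minus_left[symmetric] diff_conv_add_uminus
    by (simp only: pd_add_direction[OF assms] pd_scaleR_direction[OF assms] scaleR_minus_left[symmetric])
  ultimately show "(cmod (pd n1 f x))\<^sup>2 + (cmod (pd e3 f x))\<^sup>2 \<le> (\<Sum>b\<in>Basis. (cmod (pd b f x))\<^sup>2)"
    "(cmod (pd n2 f x))\<^sup>2 + (cmod (pd e3 f x))\<^sup>2 \<le> (\<Sum>b\<in>Basis. (cmod (pd b f x))\<^sup>2)"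
    unfolding gradient_norm_frame[OF assms] using cs[of co] cs[of "- co"] by simp_all
qed

text \<open>
  Below height 1 the energy is bounded along lines orthogonal to the faces: horizontally and
  vertically in the part close to the inclined faces, and only vertically, from both ends, in the
  remaining part, where the layer is bounded above by the height 1.
\<close>

lemma slab_bound:
  assumes f: "f \<in> test_functions layer"
  shows "4 * (LINT x|lborel. indicator {x. e3 \<bullet> (x - V) \<le> 1} x * (cmod (f x))\<^sup>2) \<le>
    (LINT x|lborel. indicator {x. e3 \<bullet> (x - V) \<le> 1} x * (\<Sum>b\<in>Basis. (cmod (pd b f x))\<^sup>2))"
proof -
  note sm = test_smooth[OF f]
  define h s t where "h x = e3 \<bullet> (x - V)" and "s x = n1 \<bullet> (x - V)" and "t x = n2 \<bullet> (x - V)" for x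
  have [measurable]: "h \<in> borel_measurable borel" "s \<in> borel_measurable borel" "t \<in> borel_measurable borel"
    unfolding h_def s_def t_def by measurable
  \<comment> \<open>\<open>R1\<close> and \<open>R2\<close> divide the part \<open>C\<close> near
    the inclined faces according to the nearer face, ties going to \<open>R1\<close>;
    \<open>T1\<close> and \<open>T2\<close> halve the remaining core at height 1 / 2.\<close>
  define R1 where "R1 = {x. 0 \<le> s x \<and> s x < 1 \<and> s x \<le> t x \<and> 0 \<le> h x \<and> h x \<le> 1}"
  define R2 where "R2 = {x. 0 \<le> t x \<and> t x < 1 \<and> t x < s x \<and> 0 \<le> h x \<and> h x \<le> 1}"
  define C where "C = {x. 0 \<le> s x \<and> 0 \<le> t x \<and> (s x < 1 \<or> t x < 1) \<and> 0 \<le> h x \<and> h x \<le> 1}"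
  define T1 where "T1 = {x. 1 \<le> s x \<and> 1 \<le> t x \<and> 0 \<le> h x \<and> h x < 1 / 2}"
  define T2 where "T2 = {x. 1 \<le> s x \<and> 1 \<le> t x \<and> 1 / 2 \<le> h x \<and> h x \<le> 1}"
  define S where "S = {x. h x \<le> 1}"
  have meas: "R1 \<in> sets borel" "R2 \<in> sets borel" "C \<in> sets borel" "T1 \<in> sets borel" "T2 \<in> sets borel" "S \<in> sets borel"
    unfolding R1_def R2_def C_def T1_def T2_def S_def by measurable
  \<comment> \<open>Because of this sign, moving towards one inclined face never brings the other
    one closer. A point thus stays in the region of its nearer face, as the star condition of
    \<open>line_poincare\<close> demands.\<close>
  have n21: "n2 \<bullet> n1 \<le> 0" and e3n: "e3 \<bullet> n1 = 0" "e3 \<bullet> n2 = 0"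
    using normals_inner by (simp_all add: inner_commute)
  have step: "s (x - r *\<^sub>R n) = s x - r * (n1 \<bullet> n)" "t (x - r *\<^sub>R n) = t x - r * (n2 \<bullet> n)"
    "h (x - r *\<^sub>R n) = h x - r * (e3 \<bullet> n)" for x r n
    unfolding h_def s_def t_def by (rule inner_step)+
  have neg: "r * a \<le> 0" if "r \<ge> 0" "a \<le> 0" for r a :: real using that by (rule mult_nonneg_nonpos)
  let ?I = "\<lambda>B g. LINT x|lborel. indicator B x * (cmod (g x))\<^sup>2"
  have 1: "2 / 1\<^sup>2 * ?I R1 f \<le> ?I R1 (pd n1 f)"
  proof (rule line_poincare[OF f unit_vectors(4) _ meas(1), of 1 V])
    fix x r assume "x \<in> R1" "0 \<le> r" "r \<le> n1 \<bullet> (x - V)"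
    then show "x - r *\<^sub>R n1 \<in> R1"
      using neg[OF _ n21, of r] by (auto simp: R1_def step normals_inner e3n s_def[symmetric])
  next
    fix x show "f (x - (n1 \<bullet> (x - V)) *\<^sub>R n1) = 0"
      by (rule zero_outside[OF f]) (simp add: inner_step normals_inner)
  qed (auto simp: R1_def s_def)
  have 2: "2 / 1\<^sup>2 * ?I R2 f \<le> ?I R2 (pd n2 f)"
  proof (rule line_poincare[OF f unit_vectors(5) _ meas(2), of 1 V])
    fix x r assume "x \<in> R2" "0 \<le> r" "r \<le> n2 \<bullet> (x - V)"
    then show "x - r *\<^sub>R n2 \<in> R2"
      using neg[OF _ normals_inner(3), of r] by (auto simp: R2_def step normals_inner e3n t_def[symmetric])
  next
    fix x show "f (x - (n2 \<bullet> (x - V)) *\<^sub>R n2) = 0"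
      by (rule zero_outside[OF f]) (simp add: inner_step normals_inner)
  qed (auto simp: R2_def t_def)
  have zero3: "f (x - (e3 \<bullet> (x - V)) *\<^sub>R e3) = 0" for x
    by (rule zero_outside[OF f]) (simp add: inner_step orthonormal)
  have 3: "2 / 1\<^sup>2 * ?I C f \<le> ?I C (pd e3 f)"
  proof (rule line_poincare[OF f unit_vectors(3) _ meas(3), of 1 V])
    fix x r assume "x \<in> C" "0 \<le> r" "r \<le> e3 \<bullet> (x - V)"
    then show "x - r *\<^sub>R e3 \<in> C"
      by (auto simp: C_def step normals_inner orthonormal h_def[symmetric])
  qed (auto simp: C_def h_def zero3)
  have 4: "2 / (1 / 2)\<^sup>2 * ?I T1 f \<le> ?I T1 (pd e3 f)"
  proof (rule line_poincare[OF f unit_vectors(3) _ meas(4), of "1 / 2" V])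
    fix x r assume "x \<in> T1" "0 \<le> r" "r \<le> e3 \<bullet> (x - V)"
    then show "x - r *\<^sub>R e3 \<in> T1"
      by (auto simp: T1_def step normals_inner orthonormal h_def[symmetric])
  qed (auto simp: T1_def h_def zero3)
  \<comment> \<open>The upper half of the core is treated upside down, with normal
    \<open>- e3\<close> and base point \<open>V + e3\<close>: at height 1 the function vanishes,
    because both inclined faces are at distance at least 1.\<close>
  have up: "(- e3) \<bullet> (x - (V + e3)) = 1 - h x" for x
    by (simp add: h_def inner_diff_right inner_add_right orthonormal)
  have up': "e3 \<bullet> (x - (V + e3)) = h x - 1" for x
    by (simp add: h_def inner_diff_right inner_add_right orthonormal)
  have "2 / (1 / 2)\<^sup>2 * ?I T2 f \<le> ?I T2 (pd (- e3) f)"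
  proof (rule line_poincare[OF f _ _ meas(5), of "- e3" "1 / 2" "V + e3"])
    fix x r assume "x \<in> T2" "0 \<le> r" "r \<le> (- e3) \<bullet> (x - (V + e3))"
    then show "x - r *\<^sub>R (- e3) \<in> T2"
      unfolding up by (auto simp: T2_def step[of x "- r" e3, simplified] normals_inner orthonormal)
  next
    fix x assume x: "x \<in> T2"
    have "s (x + (1 - h x) *\<^sub>R e3) = s x" "t (x + (1 - h x) *\<^sub>R e3) = t x" "h (x + (1 - h x) *\<^sub>R e3) = 1"
    proof -
      have eq: "x + (1 - h x) *\<^sub>R e3 = x - (h x - 1) *\<^sub>R e3" by (simp add: algebra_simps)
      show "s (x + (1 - h x) *\<^sub>R e3) = s x" "t (x + (1 - h x) *\<^sub>R e3) = t x" "h (x + (1 - h x) *\<^sub>R e3) = 1"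
        unfolding eq step by (simp_all add: normals_inner orthonormal)
    qed
    then have "f (x + (1 - h x) *\<^sub>R e3) = 0"
      using x by (intro zero_outside[OF f]) (auto simp: T2_def s_def t_def h_def)
    then show "f (x - ((- e3) \<bullet> (x - (V + e3))) *\<^sub>R (- e3)) = 0" unfolding up by simp
  qed (auto simp: T2_def up' unit_vectors)
  moreover have "cmod (pd (- e3) f x) = cmod (pd e3 f x)" for x
    using pd_scaleR_direction[OF sm, where r = "-1" and a = e3 and x = x] by simp
  ultimately have 5: "2 / (1 / 2)\<^sup>2 * ?I T2 f \<le> ?I T2 (pd e3 f)" by simp
  have i: "integrable lborel (\<lambda>x. indicator B x * (cmod (g x))\<^sup>2)"
    if "B \<in> sets borel" "g \<in> test_functions layer" for B g
    by (rule test_indicator_power2_integrable[OF that(2,1)])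
  have RC: "indicator C x = indicator R1 x + (indicator R2 x :: real)" for x
    by (auto simp: C_def R1_def R2_def indicator_def)
  have IC: "?I C f = ?I R1 f + ?I R2 f"
    unfolding RC distrib_right by (intro Bochner_Integration.integral_add i meas f)
  \<comment> \<open>Off the layer f vanishes; inside it the slab is the disjoint union of
    \<open>C\<close>, \<open>T1\<close> and \<open>T2\<close>.\<close>
  have S: "indicator S x * (cmod (f x))\<^sup>2 = indicator C x * (cmod (f x))\<^sup>2 + indicator T1 x * (cmod (f x))\<^sup>2 + indicator T2 x * (cmod (f x))\<^sup>2" for x
  proof (cases "f x = 0")
    case False
    then have "x \<in> layer" using test_eq_0[OF f] by blast
    then show ?thesis
      by (auto simp: layer_def S_def C_def T1_def T2_def indicator_def s_def[symmetric] t_def[symmetric] h_def[symmetric])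
  qed auto
  have IS: "?I S f = ?I C f + ?I T1 f + ?I T2 f"
    unfolding S by (simp only: Bochner_Integration.integral_add Bochner_Integration.integrable_add i meas f)
  have "4 * ?I S f \<le> ?I R1 (pd n1 f) + ?I R2 (pd n2 f) + ?I C (pd e3 f) + ?I T1 (pd e3 f) + ?I T2 (pd e3 f)"
  proof -
    have "0 \<le> ?I T1 f" "0 \<le> ?I T2 f" by (intro integral_nonneg_AE; simp)+
    moreover have n: "2 / 1\<^sup>2 = (2 :: real)" "2 / (1 / 2)\<^sup>2 = (8 :: real)" by (simp_all add: power2_eq_square)
    ultimately show ?thesis using 1 2 3 4 5 IC IS unfolding n by linarith
  qed
  also have "\<dots> = (LINT x|lborel. indicator R1 x * (cmod (pd n1 f x))\<^sup>2 + indicator R2 x * (cmod (pd n2 f x))\<^sup>2 +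
     indicator C x * (cmod (pd e3 f x))\<^sup>2 + indicator T1 x * (cmod (pd e3 f x))\<^sup>2 + indicator T2 x * (cmod (pd e3 f x))\<^sup>2)"
    by (simp only: Bochner_Integration.integral_add Bochner_Integration.integrable_add i meas test_pd[OF f])
  also have "\<dots> \<le> (LINT x|lborel. indicator S x * (\<Sum>b\<in>Basis. (cmod (pd b f x))\<^sup>2))"
  proof (rule integral_mono)
    show "integrable lborel (\<lambda>x. indicator R1 x * (cmod (pd n1 f x))\<^sup>2 + indicator R2 x * (cmod (pd n2 f x))\<^sup>2 +
     indicator C x * (cmod (pd e3 f x))\<^sup>2 + indicator T1 x * (cmod (pd e3 f x))\<^sup>2 + indicator T2 x * (cmod (pd e3 f x))\<^sup>2)"
      by (intro Bochner_Integration.integrable_add i meas test_pd[OF f])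
    show "integrable lborel (\<lambda>x. indicator S x * (\<Sum>b\<in>Basis. (cmod (pd b f x))\<^sup>2))"
      unfolding sum_distrib_left by (intro Bochner_Integration.integrable_sum i meas test_pd[OF f])
    fix x
    have "(cmod (pd e3 f x))\<^sup>2 \<le> (\<Sum>b\<in>Basis. (cmod (pd b f x))\<^sup>2)"
      unfolding gradient_norm_frame[OF sm] by simp
    then show "indicator R1 x * (cmod (pd n1 f x))\<^sup>2 + indicator R2 x * (cmod (pd n2 f x))\<^sup>2 +
     indicator C x * (cmod (pd e3 f x))\<^sup>2 + indicator T1 x * (cmod (pd e3 f x))\<^sup>2 + indicator T2 x * (cmod (pd e3 f x))\<^sup>2
      \<le> indicator S x * (\<Sum>b\<in>Basis. (cmod (pd b f x))\<^sup>2)"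
      using pd_normal_le[OF sm, of x]
      by (auto simp: R1_def R2_def C_def T1_def T2_def S_def indicator_def sum_nonneg)
  qed
  finally show ?thesis by (simp add: S_def h_def)
qed

section \<open>The cross-sectional problem above height 1 and the resulting Poincare
  inequality\<close>

definition far :: "(real^3) set" where
  "far = {x. 1 < e3 \<bullet> (x - V)}"

definition far_mass :: "(real^3 \<Rightarrow> complex) \<Rightarrow> real" where
  "far_mass f = (LINT x|lborel. indicator far x * (cmod (f x))\<^sup>2)"

text \<open>The derivative along \<open>e3\<close> is left out, so the height is a mere parameter
  and the comparison with \<open>far_mass\<close> concerns planar cross-sections.\<close>

definition far_energy :: "(real^3 \<Rightarrow> complex) \<Rightarrow> real" where
  "far_energy f = (LINT x|lborel. indicator far x * ((cmod (pd e1 f x))\<^sup>2 + (cmod (pd e2 f x))\<^sup>2))"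

definition far_bounds :: "real set" where
  "far_bounds = {c. \<forall>f\<in>test_functions layer. c * far_mass f \<le> far_energy f}"

text \<open>
  The cross-sections of the layer at heights above 1 are all equal to the planar broken strip, so
  this is the bottom of the spectrum of the Dirichlet Laplacian in the broken strip.
\<close>

definition strip_bottom :: real where
  "strip_bottom = Sup far_bounds"

lemma far_borel: "far \<in> sets borel"
  unfolding far_def by measurable

lemma far_mass_nonneg: "0 \<le> far_mass f"
  unfolding far_mass_def by (intro integral_nonneg_AE) auto

lemma far_energy_nonneg: "0 \<le> far_energy f"
  unfolding far_energy_def by (intro integral_nonneg_AE) auto

text \<open>\<open>f0\<close> bounds \<open>far_bounds\<close> above by 4, so the supremum is
  meaningful. It is attained, because for each test function the defining inequality is closed in
  the constant.\<close>

lemma strip_bottom: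
  assumes "f0 \<in> test_functions layer" "far_energy f0 < 4 * far_mass f0"
  shows "0 \<le> strip_bottom" "strip_bottom \<le> 4" "strip_bottom \<in> far_bounds"
    "\<epsilon> > 0 \<Longrightarrow> strip_bottom + \<epsilon> \<notin> far_bounds"
proof -
  have pos: "far_mass f0 > 0"
    using assms(2) far_energy_nonneg[of f0] far_mass_nonneg[of f0] by linarith
  have le4: "c \<le> 4" if "c \<in> far_bounds" for c
  proof -
    have "c * far_mass f0 \<le> far_energy f0" using that assms(1) by (simp add: far_bounds_def)
    then have "c * far_mass f0 < 4 * far_mass f0" using assms(2) by simp
    then show ?thesis using pos by simp
  qed
  have bdd: "bdd_above far_bounds" using le4 by (auto simp: bdd_above_def)
  have z: "0 \<in> far_bounds" by (simp add: far_bounds_def far_energy_nonneg)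
  show "0 \<le> strip_bottom" unfolding strip_bottom_def by (rule cSup_upper[OF z bdd])
  show "strip_bottom \<le> 4" unfolding strip_bottom_def by (rule cSup_least) (use z le4 in auto)
  show "strip_bottom \<in> far_bounds" unfolding far_bounds_def
  proof (clarify)
    fix f assume f: "f \<in> test_functions layer"
    show "strip_bottom * far_mass f \<le> far_energy f"
    proof (cases "far_mass f = 0")
      case True
      then show ?thesis by (simp add: far_energy_nonneg)
    next
      case False
      then have p: "far_mass f > 0" using far_mass_nonneg[of f] by simp
      have "strip_bottom \<le> far_energy f / far_mass f" unfolding strip_bottom_def
      proof (rule cSup_least)
        show "c \<le> far_energy f / far_mass f" if "c \<in> far_bounds" for c
          using that f p by (simp add: far_bounds_def field_simps)
      qed (use z in blast)
      then show ?thesis using p by (simp add: field_simps)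
    qed
  qed
  show "strip_bottom + \<epsilon> \<notin> far_bounds" if "\<epsilon> > 0"
    using cSup_upper[OF _ bdd, of "strip_bottom + \<epsilon>"] that by (auto simp: strip_bottom_def)
qed

text \<open>The bounds on the two sides of height 1 simply add: \<open>slab_bound\<close> gives the
  constant 4, which dominates \<open>strip_bottom\<close>, and above height 1 the vertical
  derivative is thrown away.\<close>

lemma layer_poincare:
  assumes "strip_bottom \<in> far_bounds" "strip_bottom \<le> 4" and f: "f \<in> test_functions layer"
  shows "strip_bottom * (LINT x|lborel. (cmod (f x))\<^sup>2) \<le> (LINT x|lborel. (\<Sum>b\<in>Basis. (cmod (pd b f x))\<^sup>2))"
proof -
  let ?S = "{x. e3 \<bullet> (x - V) \<le> 1}"
  have S: "?S \<in> sets borel" by measurable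
  have ind: "indicator ?S x + indicator far x = (1::real)" for x by (auto simp: far_def indicator_def)
  have split: "(LINT x|lborel. u x) = (LINT x|lborel. indicator ?S x * u x) + (LINT x|lborel. indicator far x * u x)"
    if "integrable lborel u" for u :: "real^3 \<Rightarrow> real"
  proof -
    have "integrable lborel (\<lambda>x. indicator ?S x * u x)" "integrable lborel (\<lambda>x. indicator far x * u x)"
      using integrable_mult_indicator[OF _ that, of ?S] integrable_mult_indicator[OF _ that, of far] S far_borel by simp_all
    then have "(LINT x|lborel. indicator ?S x * u x) + (LINT x|lborel. indicator far x * u x) =
       (LINT x|lborel. indicator ?S x * u x + indicator far x * u x)" by simp
    then show ?thesis unfolding distrib_right[symmetric] ind by simp
  qed
  have iG: "integrable lborel (\<lambda>x. \<Sum>b\<in>Basis. (cmod (pd b f x))\<^sup>2)"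
    by (intro Bochner_Integration.integrable_sum test_power2_integrable[OF test_pd[OF f]])
  have "far_energy f \<le> (LINT x|lborel. indicator far x * (\<Sum>b\<in>Basis. (cmod (pd b f x))\<^sup>2))"
    unfolding far_energy_def
  proof (rule integral_mono)
    show "integrable lborel (\<lambda>x. indicator far x * ((cmod (pd e1 f x))\<^sup>2 + (cmod (pd e2 f x))\<^sup>2))"
      unfolding distrib_left
      by (intro Bochner_Integration.integrable_add test_indicator_power2_integrable[OF test_pd[OF f]] far_borel)
    show "integrable lborel (\<lambda>x. indicator far x * (\<Sum>b\<in>Basis. (cmod (pd b f x))\<^sup>2))"
      using integrable_mult_indicator[OF _ iG, of far] far_borel by simp
  qed (auto simp: gradient_norm_frame[OF test_smooth[OF f]] intro!: mult_left_mono)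
  moreover have "strip_bottom * far_mass f \<le> far_energy f" using assms(1) f by (simp add: far_bounds_def)
  moreover have "strip_bottom * (LINT x|lborel. indicator ?S x * (cmod (f x))\<^sup>2) \<le> 4 * (LINT x|lborel. indicator ?S x * (cmod (f x))\<^sup>2)"
    using assms(2) by (intro mult_right_mono integral_nonneg_AE) auto
  moreover note slab_bound[OF f]
  ultimately show ?thesis
    unfolding split[OF test_power2_integrable[OF f]] split[OF iG] far_mass_def by (simp add: distrib_left)
qed

end

section \<open>Integration in an orthonormal frame\<close>

text \<open>Only boxes have to be measured, and the preimage of a box is its image under the
  inverse, which is again orthogonal and preserves Lebesgue measure.\<close>

lemma distr_orthogonal_transformation:
  fixes T :: "real^3 \<Rightarrow> real^3"
  assumes T: "orthogonal_transformation T"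
  shows "distr lborel borel T = lborel"
proof (rule lborel_eqI[symmetric])
  fix l u :: "real^3" assume le: "\<And>b. b \<in> Basis \<Longrightarrow> l \<bullet> b \<le> u \<bullet> b"
  have lin: "linear T" using T by (rule orthogonal_transformation_linear)
  have [measurable]: "T \<in> borel_measurable borel"
    using lin by (intro borel_measurable_continuous_onI linear_continuous_on) (simp add: linear_conv_bounded_linear)
  have inv: "orthogonal_transformation (inv T)" using T by (rule orthogonal_transformation_inv)
  have "bij T" using T by (rule orthogonal_transformation_bij)
  then have vim: "T -` box l u = inv T ` box l u" by (rule bij_vimage_eq_inv_image)
  have S: "T -` box l u \<in> sets borel" using measurable_sets[of T borel borel "box l u"] by simp
  have fin: "inv T ` box l u \<in> lmeasurable" by (rule measurable_orthogonal_image[OF inv]) simp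
  have "emeasure lborel (T -` box l u) = emeasure lebesgue (inv T ` box l u)" using S unfolding vim by simp
  also have "\<dots> = ennreal (measure lebesgue (box l u))"
    using measure_orthogonal_image[OF inv, of "box l u"] fin by (simp add: emeasure_eq_measure2)
  also have "\<dots> = (\<Prod>b\<in>Basis. (u - l) \<bullet> b)"
    using le by (simp add: measure_completion measure_def)
  finally show "emeasure (distr lborel borel T) (box l u) = (\<Prod>b\<in>Basis. (u - l) \<bullet> b)"
    by (simp add: emeasure_distr)
qed simp

lemma measurable_vector3:
  "(\<lambda>q :: (real \<times> real) \<times> real. vector [fst (fst q), snd (fst q), snd q] :: real^3) \<in> borel_measurable borel"
proof -
  have "(\<lambda>q :: (real \<times> real) \<times> real. vector [fst (fst q), snd (fst q), snd q] :: real^3) =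
    (\<lambda>q. fst (fst q) *\<^sub>R axis 1 1 + snd (fst q) *\<^sub>R axis 2 1 + snd q *\<^sub>R axis 3 1)"
    by (simp add: fun_eq_iff vec_eq_iff forall_3 axis_def)
  then show ?thesis
    by (simp only:) (intro borel_measurable_continuous_onI continuous_intros)
qed

text \<open>Identifies \<open>real^3\<close> with a product grouped as cross-section and height, the
  grouping on which Fubini is used below.\<close>

lemma distr_vector3:
  "distr lborel borel (\<lambda>q :: (real \<times> real) \<times> real. vector [fst (fst q), snd (fst q), snd q] :: real^3) = lborel"
  (is "distr _ _ ?H = _")
proof (rule lborel_eqI[symmetric])
  fix l u :: "real^3" assume le: "\<And>b. b \<in> Basis \<Longrightarrow> l \<bullet> b \<le> u \<bullet> b"
  have lu: "l $ i \<le> u $ i" for i using le[of "axis i 1"] by (simp add: inner_axis)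
  note [measurable] = measurable_vector3
  have vim: "?H -` box l u = ({l $ 1 <..< u $ 1} \<times> {l $ 2 <..< u $ 2}) \<times> {l $ 3 <..< u $ 3}"
    by (auto simp: mem_box_cart forall_3)
  have "emeasure lborel (?H -` box l u) =
    emeasure ((lborel \<Otimes>\<^sub>M lborel) \<Otimes>\<^sub>M lborel) (({l $ 1 <..< u $ 1} \<times> {l $ 2 <..< u $ 2}) \<times> {l $ 3 <..< u $ 3})"
    unfolding vim by (simp add: lborel_prod)
  also have "\<dots> = ennreal (u $ 1 - l $ 1) * ennreal (u $ 2 - l $ 2) * ennreal (u $ 3 - l $ 3)"
  proof -
    have "{l $ 1 <..< u $ 1} \<times> {l $ 2 <..< u $ 2} \<in> sets (lborel \<Otimes>\<^sub>M lborel)" by (intro pair_measureI) auto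
    then have "emeasure ((lborel \<Otimes>\<^sub>M lborel) \<Otimes>\<^sub>M lborel) (({l $ 1 <..< u $ 1} \<times> {l $ 2 <..< u $ 2}) \<times> {l $ 3 <..< u $ 3}) =
      emeasure (lborel \<Otimes>\<^sub>M lborel) ({l $ 1 <..< u $ 1} \<times> {l $ 2 <..< u $ 2}) * emeasure lborel {l $ 3 <..< u $ 3}"
      by (rule lborel.emeasure_pair_measure_Times) simp
    also have "emeasure (lborel \<Otimes>\<^sub>M lborel) ({l $ 1 <..< u $ 1} \<times> {l $ 2 <..< u $ 2}) =
      emeasure lborel {l $ 1 <..< u $ 1} * emeasure lborel {l $ 2 <..< u $ 2}"
      by (rule lborel.emeasure_pair_measure_Times) simp_all
    finally show ?thesis using lu by (simp only: emeasure_lborel_Ioo)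
  qed
  also have "\<dots> = ennreal (\<Prod>i\<in>UNIV. (u - l) $ i)"
  proof -
    have "(\<Prod>i\<in>UNIV. (u - l) $ i) = (u $ 1 - l $ 1) * (u $ 2 - l $ 2) * (u $ 3 - l $ 3)"
      unfolding UNIV_3 by (simp add: ac_simps)
    then show ?thesis using lu by (simp add: ennreal_mult)
  qed
  also have "(\<Prod>i\<in>UNIV. (u - l) $ i) = (\<Prod>b\<in>Basis. (u - l) \<bullet> b)"
  proof -
    have B: "(Basis :: (real^3) set) = range (\<lambda>i. axis i 1)" by (auto simp: Basis_vec_def)
    have "inj (\<lambda>i. axis i (1::real) :: real^3)" by (auto simp: inj_def axis_eq_axis)
    then show ?thesis unfolding B by (subst prod.reindex) (simp_all add: inner_axis)
  qed
  finally show "emeasure (distr lborel borel ?H) (box l u) = (\<Prod>b\<in>Basis. (u - l) \<bullet> b)"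
    by (simp add: emeasure_distr)
qed simp

lemma integral_product_compact:
  fixes A :: "'a::euclidean_space \<Rightarrow> real" and C :: "'b::euclidean_space \<Rightarrow> real"
  assumes A: "continuous_on UNIV A" "compact K" "\<And>x. x \<notin> K \<Longrightarrow> A x = 0"
    and C: "continuous_on UNIV C" "compact L" "\<And>x. x \<notin> L \<Longrightarrow> C x = 0"
  shows "(LINT q|lborel. A (fst q) * C (snd q)) = (LINT x|lborel. A x) * (LINT y|lborel. C y)"
proof -
  have "integrable lborel (\<lambda>q. A (fst q) * C (snd q))"
  proof (rule integrable_compact_support)
    show "continuous_on UNIV (\<lambda>q. A (fst q) * C (snd q))"
      by (intro continuous_on_mult continuous_on_compose2[OF A(1)] continuous_on_compose2[OF C(1)] continuous_intros) auto
    show "compact (K \<times> L)" by (intro compact_Times A C)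
    show "\<And>q. q \<notin> K \<times> L \<Longrightarrow> A (fst q) * C (snd q) = 0"
      using A(3) C(3) by (metis SigmaI mult_zero_left mult_zero_right prod.collapse)
  qed
  then have int: "integrable (lborel \<Otimes>\<^sub>M lborel) (\<lambda>(x, y). A x * C y)"
    by (simp add: lborel_prod case_prod_beta')
  have "(LINT q|lborel. A (fst q) * C (snd q)) = (LINT x|lborel. (LINT y|lborel. A x * C y))"
    using lborel_pair.integral_fst[OF int] by (simp add: lborel_prod case_prod_beta')
  then show ?thesis by simp
qed

text \<open>Once smoothness is known, a directional derivative can be computed on a single line by
  one-variable calculus.\<close>

lemma pd_eq_line:
  assumes "smooth f" "((\<lambda>s. f (p + s *\<^sub>R v)) has_vector_derivative D) (at 0)"
  shows "pd v f p = D"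
  using vector_derivative_unique_at[OF pd_line_derivative[OF assms(1), of p v 0 UNIV]] assms(2) by simp

context wedge
begin

definition place :: "(real \<times> real) \<times> real \<Rightarrow> real^3" where
  "place q = V + (fst (fst q) *\<^sub>R e1 + snd (fst q) *\<^sub>R e2 + snd q *\<^sub>R e3)"

lemma place_coordinates:
  "e1 \<bullet> (place q - V) = fst (fst q)" "e2 \<bullet> (place q - V) = snd (fst q)" "e3 \<bullet> (place q - V) = snd q"
  by (simp_all add: place_def inner_simps orthonormal orthonormal')

lemma place_of_coordinates: "place ((e1 \<bullet> (x - V), e2 \<bullet> (x - V)), e3 \<bullet> (x - V)) = x"
  using expand[of "x - V"] by (simp add: place_def inner_commute)

lemma continuous_place: "continuous_on S place"
  unfolding place_def by (intro continuous_intros)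

text \<open>\<open>place\<close> is a translation after an orthogonal map after the identification
  of \<open>distr_vector3\<close>, and each of these preserves Lebesgue measure.\<close>

lemma distr_place: "distr lborel borel place = lborel"
proof -
  let ?H = "\<lambda>q :: (real \<times> real) \<times> real. vector [fst (fst q), snd (fst q), snd q] :: real^3"
  define T where "T v = (v $ 1) *\<^sub>R e1 + (v $ 2) *\<^sub>R e2 + (v $ 3) *\<^sub>R e3" for v :: "real^3"
  have "linear T" unfolding T_def
    by (intro linearI) (simp_all add: algebra_simps)
  moreover have "T v \<bullet> T w = v \<bullet> w" for v w
  proof -
    have "T v \<bullet> T w = v $ 1 * w $ 1 + v $ 2 * w $ 2 + v $ 3 * w $ 3"
      by (simp add: T_def inner_simps orthonormal orthonormal')
    then show ?thesis by (simp add: inner_vec_def sum_3)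
  qed
  ultimately have T: "orthogonal_transformation T"
    unfolding orthogonal_transformation_def by blast
  note [measurable] = measurable_vector3
  have [measurable]: "T \<in> borel_measurable borel"
    using \<open>linear T\<close> by (intro borel_measurable_continuous_onI linear_continuous_on) (simp add: linear_conv_bounded_linear)
  have "place = (\<lambda>q. V + T (?H q))" by (simp add: place_def[abs_def] T_def)
  then have "place = (+) V \<circ> (T \<circ> ?H)" by (simp add: o_def)
  then have "distr lborel borel place = distr (distr (distr lborel borel ?H) borel T) borel ((+) V)"
    by (simp add: distr_distr)
  then show ?thesis by (simp add: distr_vector3 distr_orthogonal_transformation[OF T] lborel_distr_plus)
qed

lemma place_measurable: "place \<in> borel_measurable borel"
  by (rule borel_measurable_continuous_onI[OF continuous_place])

lemma integral_place:
  fixes g :: "real^3 \<Rightarrow> 'b::{banach, second_countable_topology}"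
  assumes "g \<in> borel_measurable borel"
  shows "(LINT p|lborel. g p) = (LINT q|lborel. g (place q))"
  using integral_distr[of place lborel borel g] place_measurable assms by (simp add: distr_place)

lemma integrable_place:
  fixes g :: "real^3 \<Rightarrow> 'b::{banach, second_countable_topology}"
  assumes "g \<in> borel_measurable borel"
  shows "integrable lborel g \<longleftrightarrow> integrable lborel (\<lambda>q. g (place q))"
  using integrable_distr_eq[of place lborel borel g] place_measurable assms by (simp add: distr_place)

lemma smooth_coordinate:
  fixes A :: "real \<Rightarrow> 'b::real_normed_vector"
  assumes "smooth A"
  shows "smooth (\<lambda>p. A (v \<bullet> (p - V)))"
proof -
  have "smooth (\<lambda>p. A (- (v \<bullet> V) + v \<bullet> p))"
    by (rule smooth_affine_compose[OF bounded_linear_inner_right assms])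
  then show ?thesis by (simp add: inner_diff_right)
qed

end

section \<open>Estimates for the bump function\<close>

lemma smooth_bump_id: "d > 0 \<Longrightarrow> smooth (bump d)"
  using smooth_bump[OF _ smooth_linear[OF bounded_linear_ident]] by simp

lemma smooth_real_derivative:
  fixes \<beta> :: "real \<Rightarrow> 'b::real_normed_vector"
  assumes "smooth \<beta>"
  shows "(\<beta> has_vector_derivative pd 1 \<beta> t) (at t)"
  using pd_line_derivative[OF assms, of 0 1 t UNIV] by simp

lemma bump_derivative_bound:
  assumes "d > 0"
  shows "\<bar>pd 1 (bump d) t\<bar> \<le> 2 * \<bar>t\<bar>" "\<bar>t\<bar> \<ge> 1 \<Longrightarrow> pd 1 (bump d) t = 0"
proof -
  have "pd 1 (bump d) t = (if \<bar>t\<bar> < 1 then - 2 * t * (1 + d / (1 - t\<^sup>2)) * exp (- d / (1 - t\<^sup>2)) else 0)"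
    using vector_derivative_unique_at[OF smooth_real_derivative[OF smooth_bump_id[OF assms]]]
      bump_has_derivative[OF assms, of t] by (simp add: has_real_derivative_iff_has_vector_derivative)
  then show "\<bar>pd 1 (bump d) t\<bar> \<le> 2 * \<bar>t\<bar>" "\<bar>t\<bar> \<ge> 1 \<Longrightarrow> pd 1 (bump d) t = 0"
    using bump_deriv_bound[OF assms, of t] by auto
qed

text \<open>The derivative bound 2 |t| and the minorant of \<open>bump_lower\<close> are integrated
  exactly over [-1, 1]. As d tends to 0 the quotient of the bounds tends to 5 / 2, close to the
  optimal pi^2 / 4.\<close>

lemma bump_power2_integrals:
  assumes d: "d > 0"
  shows "(LINT t|lborel. (pd 1 (bump d) t)\<^sup>2) \<le> 8 / 3" "16 / 15 - 8 / 3 * d \<le> (LINT t|lborel. (bump d t)\<^sup>2)"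
proof -
  note sm = smooth_bump_id[OF d]
  have c: "continuous_on UNIV (bump d)" "continuous_on UNIV (pd 1 (bump d))"
    by (intro smooth_continuous sm smooth_pd)+
  have i1: "integrable lborel (\<lambda>t. (pd 1 (bump d) t)\<^sup>2)"
    by (rule integrable_compact_support[of _ "{-1..1}"])
      (auto intro!: continuous_intros c bump_derivative_bound(2)[OF d] simp: abs_real_def)
  have i2: "integrable lborel (\<lambda>t. (bump d t)\<^sup>2)"
    by (rule integrable_compact_support[of _ "{-1..1}"]) (auto intro!: continuous_intros c bump_eq_0 simp: abs_real_def)
  have j1: "integrable lborel (\<lambda>t. indicator {-1..1} t *\<^sub>R (4 * t\<^sup>2 :: real))"
    by (intro borel_integrable_compact continuous_intros) auto
  have j2: "integrable lborel (\<lambda>t. indicator {-1..1} t *\<^sub>R ((1 - t\<^sup>2)\<^sup>2 - 2 * d * (1 - t\<^sup>2) :: real))"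
    by (intro borel_integrable_compact continuous_intros) auto
  have "(LINT t|lborel. (pd 1 (bump d) t)\<^sup>2) \<le> (LINT t|lborel. indicator {-1..1} t *\<^sub>R (4 * t\<^sup>2 :: real))"
  proof (rule integral_mono[OF i1 j1])
    fix t :: real
    have "\<bar>pd 1 (bump d) t\<bar>\<^sup>2 \<le> (2 * \<bar>t\<bar>)\<^sup>2" by (intro power_mono bump_derivative_bound d) simp
    then show "(pd 1 (bump d) t)\<^sup>2 \<le> indicator {-1..1} t *\<^sub>R (4 * t\<^sup>2 :: real)"
      using bump_derivative_bound(2)[OF d, of t]
      by (cases "\<bar>t\<bar> < 1") (auto simp: indicator_def power_mult_distrib)
  qed
  also have "\<dots> = 4 / 3 * 1 ^ 3 - 4 / 3 * (- 1) ^ 3"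
    by (rule integral_FTC_atLeastAtMost) (auto intro!: derivative_eq_intros continuous_intros
        simp: has_real_derivative_iff_has_vector_derivative[symmetric] power2_eq_square)
  finally show "(LINT t|lborel. (pd 1 (bump d) t)\<^sup>2) \<le> 8 / 3" by simp
  have "16 / 15 - 8 / 3 * d = (\<lambda>t. t - 2 / 3 * t ^ 3 + t ^ 5 / 5 - 2 * d * (t - t ^ 3 / 3)) 1 - (\<lambda>t. t - 2 / 3 * t ^ 3 + t ^ 5 / 5 - 2 * d * (t - t ^ 3 / 3)) (- 1)"
    by simp
  also have "\<dots> = (LINT t|lborel. indicator {-1..1} t *\<^sub>R ((1 - t\<^sup>2)\<^sup>2 - 2 * d * (1 - t\<^sup>2) :: real))"
  proof (rule integral_FTC_atLeastAtMost[symmetric])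
    fix t :: real
    have "((\<lambda>t. t - 2 / 3 * t ^ 3 + t ^ 5 / 5 - 2 * d * (t - t ^ 3 / 3)) has_real_derivative
      (1 - t\<^sup>2)\<^sup>2 - 2 * d * (1 - t\<^sup>2)) (at t within {-1..1})"
      by (auto intro!: derivative_eq_intros simp: power2_eq_square algebra_simps eval_nat_numeral)
    then show "((\<lambda>t. t - 2 / 3 * t ^ 3 + t ^ 5 / 5 - 2 * d * (t - t ^ 3 / 3)) has_vector_derivative
      (1 - t\<^sup>2)\<^sup>2 - 2 * d * (1 - t\<^sup>2)) (at t within {-1..1})"
      by (simp add: has_real_derivative_iff_has_vector_derivative)
  qed (auto intro!: continuous_intros)
  also have "\<dots> \<le> (LINT t|lborel. (bump d t)\<^sup>2)"
  proof (rule integral_mono[OF j2 i2])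
    fix t :: real
    have "t\<^sup>2 = 1" if "\<bar>t\<bar> = 1" using that by (metis power2_abs one_power2)
    then show "indicator {-1..1} t *\<^sub>R ((1 - t\<^sup>2)\<^sup>2 - 2 * d * (1 - t\<^sup>2)) \<le> (bump d t)\<^sup>2"
      using bump_lower[of t d] by (cases "\<bar>t\<bar> < 1") (auto simp: indicator_def abs_real_def split: if_splits)
  qed
  finally show "16 / 15 - 8 / 3 * d \<le> (LINT t|lborel. (bump d t)\<^sup>2)" .
qed

lemma integral_rescale:
  fixes F :: "real \<Rightarrow> real"
  assumes "r > 0"
  shows "(LINT t|lborel. F ((t - m) / r)) = r * (LINT t|lborel. F t)"
  using lborel_integral_real_affine[of r "\<lambda>t. F ((t - m) / r)" m] assms by simp

lemma smooth_rescale: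
  fixes A :: "real \<Rightarrow> 'b::real_normed_vector"
  assumes "smooth A"
  shows "smooth (\<lambda>t. A ((t - m) / r))"
proof -
  have "bounded_linear (\<lambda>t :: real. t / r)" by (rule bounded_linear_divide)
  from smooth_affine_compose[OF this assms, of "- m / r"]
  show ?thesis by (simp add: diff_divide_distrib)
qed

lemma rescale_has_derivative:
  fixes \<beta> :: "real \<Rightarrow> real"
  assumes "smooth \<beta>"
  shows "((\<lambda>s. \<beta> ((y + s - m) / r)) has_real_derivative pd 1 \<beta> ((y - m) / r) / r) (at 0)"
proof -
  have "(\<beta> has_real_derivative pd 1 \<beta> ((y - m) / r)) (at ((y + 0 - m) / r))"
    using smooth_real_derivative[OF assms, of "(y - m) / r"] by (simp add: has_real_derivative_iff_has_vector_derivative)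
  moreover have "((\<lambda>s. (y + s - m) / r) has_real_derivative 1 / r) (at 0)"
    by (cases "r = 0") (auto intro!: derivative_eq_intros)
  ultimately show ?thesis using DERIV_chain2 by fastforce
qed

context wedge
begin

lemma integral_separable:
  fixes A B C :: "real \<Rightarrow> real"
  assumes A: "continuous_on UNIV A" "compact K" "\<And>x. x \<notin> K \<Longrightarrow> A x = 0"
    and B: "continuous_on UNIV B" "compact L" "\<And>x. x \<notin> L \<Longrightarrow> B x = 0"
    and C: "continuous_on UNIV C" "compact M" "\<And>x. x \<notin> M \<Longrightarrow> C x = 0"
  shows "(LINT p|lborel. A (e1 \<bullet> (p - V)) * B (e2 \<bullet> (p - V)) * C (e3 \<bullet> (p - V))) =
    (LINT t|lborel. A t) * (LINT t|lborel. B t) * (LINT t|lborel. C t)"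
proof -
  have "continuous_on UNIV (\<lambda>p. A (e1 \<bullet> (p - V)) * B (e2 \<bullet> (p - V)) * C (e3 \<bullet> (p - V)))"
    by (intro continuous_on_mult continuous_on_compose2[OF A(1)] continuous_on_compose2[OF B(1)]
        continuous_on_compose2[OF C(1)] continuous_intros) auto
  from integral_place[OF borel_measurable_continuous_onI[OF this]]
  have "(LINT p|lborel. A (e1 \<bullet> (p - V)) * B (e2 \<bullet> (p - V)) * C (e3 \<bullet> (p - V))) =
    (LINT q|lborel. (\<lambda>r. A (fst r) * B (snd r)) (fst q) * C (snd q))"
    by (simp add: place_coordinates)
  also have "\<dots> = (LINT r|lborel. A (fst r) * B (snd r)) * (LINT t|lborel. C t)"
  proof (rule integral_product_compact[OF _ _ _ C])
    show "continuous_on UNIV (\<lambda>r. A (fst r) * B (snd r))"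
      by (intro continuous_on_mult continuous_on_compose2[OF A(1)] continuous_on_compose2[OF B(1)] continuous_intros) auto
    show "compact (K \<times> L)" by (intro compact_Times A B)
    show "\<And>q. q \<notin> K \<times> L \<Longrightarrow> A (fst q) * B (snd q) = 0"
      using A(3) B(3) by (metis SigmaI mult_zero_left mult_zero_right prod.collapse)
  qed
  also have "(LINT r|lborel. A (fst r) * B (snd r)) = (LINT t|lborel. A t) * (LINT t|lborel. B t)"
    by (rule integral_product_compact[OF A B])
  finally show ?thesis .
qed

text \<open>
  For small \<open>\<alpha>\<close> the broken strip contains a long rectangle of half-height \<open>9 / 10\<close> near its
  inner corner, so that its Dirichlet Laplacian has spectrum below 4.
\<close>

lemma narrow_angle_test_function:
  assumes narrow: "si \<le> 1 / 160"
  shows "\<exists>f\<in>test_functions layer. far_energy f < 4 * far_mass f"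
proof -
  \<comment> \<open>With d = 1 / 40 the lower bound 16 / 15 - 8 d / 3 for the mass is exactly
    1.\<close>
  define \<beta> where "\<beta> = bump (1 / 40)"
  define \<beta>' where "\<beta>' = pd 1 \<beta>"
  have sm: "smooth \<beta>" unfolding \<beta>_def by (rule smooth_bump_id) simp
  have cont: "continuous_on UNIV \<beta>" "continuous_on UNIV \<beta>'"
    unfolding \<beta>'_def by (intro smooth_continuous sm smooth_pd)+
  have z: "\<beta> t = 0" "\<beta>' t = 0" if "\<bar>t\<bar> \<ge> 1" for t
    using that bump_eq_0 bump_derivative_bound(2)[of "1 / 40"] by (auto simp: \<beta>_def \<beta>'_def)
  define I0 I1 where "I0 = (LINT t|lborel. (\<beta> t)\<^sup>2)" and "I1 = (LINT t|lborel. (\<beta>' t)\<^sup>2)"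
  have I: "1 \<le> I0" "I1 \<le> 8 / 3" "0 \<le> I1"
    using bump_power2_integrals[of "1 / 40"] unfolding I0_def I1_def \<beta>'_def \<beta>_def
    by (auto intro!: integral_nonneg_AE)
  define h where "h = (9 / 10 :: real)"
  \<comment> \<open>The rectangle has to satisfy co h < si x < 1. The centre m is the midpoint of
    this range of x, and the half-length l is half of what would fit, which keeps the inequalities
    strict.\<close>
  define l where "l = (1 - co * h) / (4 * si)"
  define m where "m = (co * h + 1) / (2 * si)"
  have co1: "co \<le> 1" by simp
  then have ch: "co * h \<le> 9 / 10" "0 < co * h" using co_pos by (auto simp: h_def)
  \<comment> \<open>Since 1 - co h \<ge> 1 / 10, the bound si \<le> 1 / 160 gives l \<ge> (1 / 10) /
    (4 / 160) = 4.\<close>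
  have l4: "4 \<le> l"
  proof -
    have "4 * (4 * si) \<le> 1 - co * h" using narrow ch by simp
    then show ?thesis using si_pos by (simp add: l_def pos_le_divide_eq)
  qed
  \<comment> \<open>The height profile lives on [2, 4], entirely above height 1, and its factor
    cancels from the quotient of energy and mass.\<close>
  let ?A = "\<lambda>t. \<beta> ((t - m) / l)" and ?B = "\<lambda>t. \<beta> ((t - 0) / h)" and ?C = "\<lambda>t. \<beta> ((t - 3) / 1)"
  let ?x = "\<lambda>p. e1 \<bullet> (p - V)" and ?y = "\<lambda>p. e2 \<bullet> (p - V)" and ?z = "\<lambda>p. e3 \<bullet> (p - V)"
  define f where "f p = complex_of_real (?A (?x p) * ?B (?y p) * ?C (?z p))" for p
  have fsm: "smooth f"
    unfolding f_def
    by (intro smooth_linear_compose[OF bounded_linear_of_real] smooth_mult smooth_coordinate smooth_rescale sm)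
  have supp: "t \<notin> {c - r..c + r} \<Longrightarrow> 1 \<le> \<bar>(t - c) / r\<bar>" if "r > 0" for t c r :: real
    using that by (auto simp: abs_if field_simps)
  have l0: "l > 0" and h0: "h > 0" using l4 by (auto simp: h_def)
  let ?K = "({m - l..m + l} \<times> {0 - h..0 + h}) \<times> {3 - 1..3 + 1 :: real}"
  have zero: "f (place q) = 0" if "q \<notin> ?K" for q
  proof -
    have bz: "\<beta> ((t - c) / r) = 0" if "r > 0" "t \<notin> {c - r..c + r}" for t c r
      by (rule z(1)[OF supp[OF that]])
    have "fst (fst q) \<notin> {m - l..m + l} \<or> snd (fst q) \<notin> {0 - h..0 + h} \<or> snd q \<notin> {3 - 1..3 + 1}"
      using that by (metis SigmaI prod.collapse)
    then show ?thesis using bz[OF l0] bz[OF h0] bz[OF zero_less_one]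
      unfolding f_def place_coordinates by (metis mult_zero_left mult_zero_right of_real_0)
  qed
  have ftest: "f \<in> test_functions layer"
  proof (rule test_functionsI[OF fsm])
    show "compact (place ` ?K)"
      by (intro compact_continuous_image continuous_place compact_Times compact_Icc)
    show "f p = 0" if "p \<notin> place ` ?K" for p
    proof -
      have "((?x p, ?y p), ?z p) \<notin> ?K" using that place_of_coordinates by (metis imageI)
      from zero[OF this] show ?thesis by (simp only: place_of_coordinates)
    qed
    show "place ` ?K \<subseteq> layer"
    proof (clarify)
      fix x y w assume x: "x \<in> {m - l..m + l}" and y: "y \<in> {0 - h..0 + h}" and w: "w \<in> {3 - 1..3 + 1 :: real}"
      have n: "n1 \<bullet> (place ((x, y), w) - V) = si * x + co * y" "n2 \<bullet> (place ((x, y), w) - V) = si * x - co * y"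
        by (simp_all add: n1_def n2_def inner_add_left inner_diff_left place_coordinates)
      have sm: "si * m = (co * h + 1) / 2" "si * l = (1 - co * h) / 4" using si_pos by (simp_all add: m_def l_def)
      have "si * (m - l) \<le> si * x" "si * x \<le> si * (m + l)" using x si_pos by auto
      then have sx: "co * h < si * x" "si * x < 1" using sm ch by (auto simp: algebra_simps)
      have "co * y \<le> co * h" "co * (- y) \<le> co * h" using y co_pos by (intro mult_left_mono; simp)+
      then have cy: "- (co * h) \<le> co * y" "co * y \<le> co * h" by auto
      \<comment> \<open>The sign of y decides which inclined face is the one at distance less than
        1.\<close>
      have "0 \<le> co * y \<or> 0 \<le> - (co * y)" by linarith
      then show "place ((x, y), w) \<in> layer"
        using sx cy w unfolding layer_def mem_Collect_eq n place_coordinates by auto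
    qed
  qed
  have d1: "pd e1 f p = of_real (\<beta>' ((?x p - m) / l) / l * ?B (?y p) * ?C (?z p))" for p
  proof (rule pd_eq_line[OF fsm])
    have "((\<lambda>s. \<beta> ((?x p + s - m) / l) * (?B (?y p) * ?C (?z p))) has_real_derivative \<beta>' ((?x p - m) / l) / l * (?B (?y p) * ?C (?z p))) (at 0)"
      unfolding \<beta>'_def by (intro DERIV_cmult_right rescale_has_derivative sm)
    from has_vector_derivative_of_real[OF this, where 'a = complex]
    show "((\<lambda>s. f (p + s *\<^sub>R e1)) has_vector_derivative of_real (\<beta>' ((?x p - m) / l) / l * ?B (?y p) * ?C (?z p))) (at 0)"
      by (simp add: f_def inner_simps orthonormal orthonormal' mult.assoc algebra_simps)
  qed
  have d2: "pd e2 f p = of_real (?A (?x p) * (\<beta>' ((?y p - 0) / h) / h) * ?C (?z p))" for p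
  proof (rule pd_eq_line[OF fsm])
    have "((\<lambda>s. \<beta> ((?y p + s - 0) / h) * (?A (?x p) * ?C (?z p))) has_real_derivative \<beta>' ((?y p - 0) / h) / h * (?A (?x p) * ?C (?z p))) (at 0)"
      unfolding \<beta>'_def by (intro DERIV_cmult_right rescale_has_derivative sm)
    from has_vector_derivative_of_real[OF this, where 'a = complex]
    show "((\<lambda>s. f (p + s *\<^sub>R e2)) has_vector_derivative of_real (?A (?x p) * (\<beta>' ((?y p - 0) / h) / h) * ?C (?z p))) (at 0)"
      by (simp add: f_def inner_simps orthonormal orthonormal' mult.assoc algebra_simps)
  qed
  have far1: "indicator far p * (?C (?z p))\<^sup>2 = (?C (?z p))\<^sup>2" for p
    using supp[of 1 "?z p" 3] z(1) by (auto simp: far_def indicator_def)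
  have resc: "(LINT t|lborel. (\<beta> ((t - c) / r))\<^sup>2) = r * I0" "(LINT t|lborel. (\<beta>' ((t - c) / r) / r)\<^sup>2) = I1 / r" if "r > 0" for c r
    using integral_rescale[OF that, of "\<lambda>t. (\<beta> t)\<^sup>2" c] integral_rescale[OF that, of "\<lambda>t. (\<beta>' t)\<^sup>2" c] that
    by (simp_all add: I0_def I1_def power_divide power2_eq_square)
  have cr: "continuous_on UNIV (\<lambda>t. (\<beta> ((t - c) / r))\<^sup>2)" "continuous_on UNIV (\<lambda>t. (\<beta>' ((t - c) / r) / r)\<^sup>2)" if "r > 0" for c r
    using that by (intro continuous_intros continuous_on_compose2[OF cont(1)] continuous_on_compose2[OF cont(2)]; auto)+
  have sep: "(LINT p|lborel. (A (?x p))\<^sup>2 * (B (?y p))\<^sup>2 * (?C (?z p))\<^sup>2) = (LINT t|lborel. (A t)\<^sup>2) * (LINT t|lborel. (B t)\<^sup>2) * I0"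
    if "A = ?A \<or> A = (\<lambda>t. \<beta>' ((t - m) / l) / l)" "B = ?B \<or> B = (\<lambda>t. \<beta>' ((t - 0) / h) / h)" for A B :: "real \<Rightarrow> real"
  proof -
    have "(LINT p|lborel. (A (?x p))\<^sup>2 * (B (?y p))\<^sup>2 * (?C (?z p))\<^sup>2) =
      (LINT t|lborel. (A t)\<^sup>2) * (LINT t|lborel. (B t)\<^sup>2) * (LINT t|lborel. (?C t)\<^sup>2)"
    proof (rule integral_separable)
      show "continuous_on UNIV (\<lambda>t. (A t)\<^sup>2)" "continuous_on UNIV (\<lambda>t. (B t)\<^sup>2)" "continuous_on UNIV (\<lambda>t. (?C t)\<^sup>2)"
        using that cr[OF l0, of m] cr[OF h0, of 0] cr[of 1 3] by auto
      show "compact {m - l..m + l}" "compact {0 - h..0 + h}" "compact {3 - 1..3 + 1 :: real}" by auto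
      show "(A t)\<^sup>2 = 0" if "t \<notin> {m - l..m + l}" for t
        using z[OF supp[OF l0 that]] \<open>A = ?A \<or> _\<close> by auto
      show "(B t)\<^sup>2 = 0" if "t \<notin> {0 - h..0 + h}" for t
        using z[OF supp[OF h0 that]] \<open>B = ?B \<or> _\<close> by auto
      show "(?C t)\<^sup>2 = 0" if "t \<notin> {3 - 1..3 + 1}" for t
        using z[OF supp[OF _ that]] by auto
    qed
    then show ?thesis using resc(1)[of 1 3] by simp
  qed
  have mass: "far_mass f = (l * I0) * (h * I0) * I0"
  proof -
    have "far_mass f = (LINT p|lborel. (?A (?x p))\<^sup>2 * (?B (?y p))\<^sup>2 * (indicator far p * (?C (?z p))\<^sup>2))"
      unfolding far_mass_def f_def norm_of_real power2_abs power_mult_distrib by (simp only: mult_ac)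
    then show ?thesis unfolding far1 using sep[of ?A ?B] resc(1)[OF l0, of m] resc(1)[OF h0, of 0] by simp
  qed
  have energy: "far_energy f = (I1 / l) * (h * I0) * I0 + (l * I0) * (I1 / h) * I0"
  proof -
    have i: "integrable lborel (\<lambda>p. indicator far p * (cmod (pd v f p))\<^sup>2)" for v
      by (rule test_indicator_power2_integrable[OF test_pd[OF ftest] far_borel])
    have "far_energy f = (LINT p|lborel. indicator far p * (cmod (pd e1 f p))\<^sup>2) + (LINT p|lborel. indicator far p * (cmod (pd e2 f p))\<^sup>2)"
      unfolding far_energy_def distrib_left by (rule Bochner_Integration.integral_add[OF i i])
    also have "(LINT p|lborel. indicator far p * (cmod (pd e1 f p))\<^sup>2) =
        (LINT p|lborel. (\<beta>' ((?x p - m) / l) / l)\<^sup>2 * (?B (?y p))\<^sup>2 * (indicator far p * (?C (?z p))\<^sup>2))"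
      unfolding d1 norm_of_real power2_abs power_mult_distrib by (simp only: mult_ac)
    also have "\<dots> = (I1 / l) * (h * I0) * I0"
      unfolding far1 using sep[of "\<lambda>t. \<beta>' ((t - m) / l) / l" ?B] resc(2)[OF l0, of m] resc(1)[OF h0, of 0] by simp
    also have "(LINT p|lborel. indicator far p * (cmod (pd e2 f p))\<^sup>2) =
        (LINT p|lborel. (?A (?x p))\<^sup>2 * (\<beta>' ((?y p - 0) / h) / h)\<^sup>2 * (indicator far p * (?C (?z p))\<^sup>2))"
      unfolding d2 norm_of_real power2_abs power_mult_distrib by (simp only: mult_ac)
    also have "\<dots> = (l * I0) * (I1 / h) * I0"
      unfolding far1 using sep[of ?A "\<lambda>t. \<beta>' ((t - 0) / h) / h"] resc(1)[OF l0, of m] resc(2)[OF h0, of 0] by simp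
    finally show ?thesis .
  qed
  \<comment> \<open>This is the comparison of Rayleigh quotients after cancelling common factors;
    numerically (8 / 3) (1 / 16 + 100 / 81) is about 3.46.\<close>
  have "I1 * (1 / l\<^sup>2 + 1 / h\<^sup>2) < 4 * I0"
  proof -
    have "4\<^sup>2 \<le> l\<^sup>2" using l4 by (intro power_mono) auto
    then have "1 / l\<^sup>2 \<le> 1 / 16" using l0 by (simp add: field_simps)
    then have "1 / l\<^sup>2 + 1 / h\<^sup>2 \<le> 1 / 16 + 100 / 81" by (simp add: h_def power2_eq_square)
    then have "I1 * (1 / l\<^sup>2 + 1 / h\<^sup>2) \<le> (8 / 3) * (1 / 16 + 100 / 81)" using I by (intro mult_mono) auto
    also have "\<dots> < 4" by simp
    also have "4 \<le> 4 * I0" using I by simp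
    finally show ?thesis .
  qed
  then have "(l * h * I0\<^sup>2) * (I1 * (1 / l\<^sup>2 + 1 / h\<^sup>2)) < (l * h * I0\<^sup>2) * (4 * I0)"
    using l0 h0 I(1) by (intro mult_strict_left_mono) auto
  moreover have "(l * h * I0\<^sup>2) * (I1 * (1 / l\<^sup>2 + 1 / h\<^sup>2)) = far_energy f"
    unfolding energy using l0 h0 by (simp add: power2_eq_square field_simps)
  moreover have "(l * h * I0\<^sup>2) * (4 * I0) = 4 * far_mass f"
    unfolding mass by (simp add: power2_eq_square)
  ultimately show ?thesis using ftest by auto
qed

end

section \<open>Singular sequences along the edge\<close>

context wedge
begin

definition slice :: "real \<Rightarrow> real^3 \<Rightarrow> real^3" where
  "slice z p = p + (z - e3 \<bullet> (p - V)) *\<^sub>R e3"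

lemma slice_place: "slice z (place (r, t)) = place (r, z)"
  by (simp add: slice_def place_coordinates) (simp add: place_def algebra_simps)

lemma slice_step: "slice z (p + s *\<^sub>R e1) = slice z p + s *\<^sub>R e1" "slice z (p + s *\<^sub>R e2) = slice z p + s *\<^sub>R e2"
  "slice z (p + s *\<^sub>R e3) = slice z p"
  by (simp_all add: slice_def inner_simps orthonormal orthonormal' algebra_simps)

lemma smooth_slice:
  fixes w :: "real^3 \<Rightarrow> complex"
  assumes "smooth w"
  shows "smooth (\<lambda>p. w (slice z p))"
proof -
  have "bounded_linear (\<lambda>p. p - (e3 \<bullet> p) *\<^sub>R e3)"
    by (intro bounded_linear_sub bounded_linear_ident
        bounded_linear_compose[OF bounded_linear_scaleR_left bounded_linear_inner_right])
  from smooth_affine_compose[OF this assms, of "(z + e3 \<bullet> V) *\<^sub>R e3"]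
  show ?thesis by (simp add: slice_def inner_diff_right algebra_simps)
qed

text \<open>Only the section of w at height z matters; it is spread along the edge with profile X.
  In this way a function on the layer stands in for a function on the planar strip.\<close>

definition wave :: "(real^3 \<Rightarrow> complex) \<Rightarrow> real \<Rightarrow> (real \<Rightarrow> complex) \<Rightarrow> real^3 \<Rightarrow> complex" where
  "wave w z X p = w (slice z p) * X (e3 \<bullet> (p - V))"

lemma smooth_wave: "smooth w \<Longrightarrow> smooth X \<Longrightarrow> smooth (wave w z X)"
  unfolding wave_def[abs_def] by (intro smooth_mult smooth_slice smooth_coordinate)

lemma pd_wave:
  assumes w: "smooth w" and X: "smooth X"
  shows "pd e1 (wave w z X) = wave (pd e1 w) z X" "pd e2 (wave w z X) = wave (pd e2 w) z X"
    "pd e3 (wave w z X) = wave w z (pd 1 X)"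
proof -
  show "pd e1 (wave w z X) = wave (pd e1 w) z X"
  proof (rule ext, rule pd_eq_line[OF smooth_wave[OF w X]])
    fix p
    have "((\<lambda>s. w (slice z p + s *\<^sub>R e1) * X (e3 \<bullet> (p - V))) has_vector_derivative pd e1 w (slice z p + 0 *\<^sub>R e1) * X (e3 \<bullet> (p - V))) (at 0)"
      by (intro has_vector_derivative_mult_left pd_line_derivative w)
    then show "((\<lambda>s. wave w z X (p + s *\<^sub>R e1)) has_vector_derivative wave (pd e1 w) z X p) (at 0)"
      by (simp add: wave_def slice_step inner_simps orthonormal orthonormal')
  qed
  show "pd e2 (wave w z X) = wave (pd e2 w) z X"
  proof (rule ext, rule pd_eq_line[OF smooth_wave[OF w X]])
    fix p
    have "((\<lambda>s. w (slice z p + s *\<^sub>R e2) * X (e3 \<bullet> (p - V))) has_vector_derivative pd e2 w (slice z p + 0 *\<^sub>R e2) * X (e3 \<bullet> (p - V))) (at 0)"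
      by (intro has_vector_derivative_mult_left pd_line_derivative w)
    then show "((\<lambda>s. wave w z X (p + s *\<^sub>R e2)) has_vector_derivative wave (pd e2 w) z X p) (at 0)"
      by (simp add: wave_def slice_step inner_simps orthonormal orthonormal')
  qed
  show "pd e3 (wave w z X) = wave w z (pd 1 X)"
  proof (rule ext, rule pd_eq_line[OF smooth_wave[OF w X]])
    fix p
    have "((\<lambda>s. w (slice z p) * X (e3 \<bullet> (p - V) + s *\<^sub>R 1)) has_vector_derivative w (slice z p) * pd 1 X (e3 \<bullet> (p - V) + 0 *\<^sub>R 1)) (at 0)"
      by (intro has_vector_derivative_mult_right pd_line_derivative X)
    then show "((\<lambda>s. wave w z X (p + s *\<^sub>R e3)) has_vector_derivative wave w z (pd 1 X) p) (at 0)"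
      by (simp add: wave_def slice_step inner_simps orthonormal orthonormal' algebra_simps)
  qed
qed

lemma slice_support:
  assumes w: "w \<in> test_functions layer"
  shows "\<exists>L. compact L \<and> (\<forall>r. r \<notin> L \<longrightarrow> w (place (r, z)) = 0) \<and> (\<forall>r\<in>L. place (r, z) \<in> layer)"
proof -
  obtain K where K: "compact K" "K \<subseteq> layer" "\<forall>x. x \<notin> K \<longrightarrow> w x = 0" using test_support[OF w] by auto
  let ?\<pi> = "\<lambda>p. (e1 \<bullet> (p - V), e2 \<bullet> (p - V))"
  let ?K = "K \<inter> {p. e3 \<bullet> (p - V) = z}"
  have "closed {p. e3 \<bullet> (p - V) = z}" by (intro closed_Collect_eq continuous_intros)
  then have "compact ?K" using K(1) by (rule compact_Int_closed[rotated])
  then have "compact (?\<pi> ` ?K)" by (intro compact_continuous_image continuous_intros)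
  moreover have "w (place (r, z)) = 0" if "r \<notin> ?\<pi> ` ?K" for r
  proof -
    have "place (r, z) \<notin> ?K" using that by (force simp: place_coordinates image_iff)
    then show ?thesis using K(3) by (auto simp: place_coordinates)
  qed
  moreover have "place (r, z) \<in> layer" if "r \<in> ?\<pi> ` ?K" for r
    using that K(2) place_of_coordinates by auto
  ultimately show ?thesis by (intro exI[of _ "?\<pi> ` ?K"]) simp
qed

text \<open>Above height 1 membership in the layer must come from closeness to an inclined face, and
  the distances to the inclined faces do not depend on the height.\<close>

lemma place_layer_shift:
  assumes "place (r, z) \<in> layer" "1 < z" "0 < t"
  shows "place (r, t) \<in> layer"
proof -
  have "n \<bullet> (place (r, t) - V) = n \<bullet> (place (r, z) - V)" if "n \<bullet> e3 = 0" for n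
    using that by (simp add: place_def inner_simps)
  then show ?thesis using assms normals_inner(4,5) by (auto simp: layer_def place_coordinates)
qed

lemma test_wave:
  assumes w: "w \<in> test_functions layer" and z: "1 < z" and X: "smooth X"
    and supp: "\<And>t. t \<notin> {a..b} \<Longrightarrow> X t = 0" and a: "1 < a"
  shows "wave w z X \<in> test_functions layer"
proof -
  obtain L where L: "compact L" "\<And>r. r \<notin> L \<Longrightarrow> w (place (r, z)) = 0" "\<And>r. r \<in> L \<Longrightarrow> place (r, z) \<in> layer"
    using slice_support[OF w, of z] by auto
  show ?thesis
  proof (rule test_functionsI[OF smooth_wave[OF test_smooth[OF w] X]])
    show "compact (place ` (L \<times> {a..b}))" by (intro compact_continuous_image continuous_place compact_Times L compact_Icc)
    show "place ` (L \<times> {a..b}) \<subseteq> layer" using L(3) a place_layer_shift[OF _ z] by fastforce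
    fix p assume "p \<notin> place ` (L \<times> {a..b})"
    then have "((e1 \<bullet> (p - V), e2 \<bullet> (p - V)), e3 \<bullet> (p - V)) \<notin> L \<times> {a..b}"
      by (metis image_eqI place_of_coordinates)
    moreover have "w (slice z p) = w (place ((e1 \<bullet> (p - V), e2 \<bullet> (p - V)), z))"
      using slice_place[of z "(e1 \<bullet> (p - V), e2 \<bullet> (p - V))" "e3 \<bullet> (p - V)"] by (simp add: place_of_coordinates)
    ultimately show "wave w z X p = 0" using L(2) supp by (auto simp: wave_def)
  qed
qed

lemma wave_norm_integral:
  assumes w: "w \<in> test_functions layer" and X: "smooth X" and supp: "\<And>t. t \<notin> {a..b} \<Longrightarrow> X t = 0"
  shows "(LINT p|lborel. (cmod (wave w z X p))\<^sup>2) = (LINT r|lborel. (cmod (w (place (r, z))))\<^sup>2) * (LINT t|lborel. (cmod (X t))\<^sup>2)"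
proof -
  obtain L where L: "compact L" "\<And>r. r \<notin> L \<Longrightarrow> w (place (r, z)) = 0"
    using slice_support[OF w, of z] by auto
  have "(\<lambda>p. (cmod (wave w z X p))\<^sup>2) \<in> borel_measurable borel"
    by (intro borel_measurable_continuous_onI continuous_intros smooth_continuous smooth_wave test_smooth[OF w] X)
  then have "(LINT p|lborel. (cmod (wave w z X p))\<^sup>2) = (LINT q|lborel. (cmod (wave w z X (place q)))\<^sup>2)"
    by (rule integral_place)
  also have "\<dots> = (LINT q|lborel. (\<lambda>r. (cmod (w (place (r, z))))\<^sup>2) (fst q) * (\<lambda>t. (cmod (X t))\<^sup>2) (snd q))"
  proof -
    have "wave w z X (place q) = w (place (fst q, z)) * X (snd q)" for q
      using slice_place[of z "fst q" "snd q"] by (simp add: wave_def place_coordinates)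
    then show ?thesis by (simp add: norm_mult power_mult_distrib)
  qed
  also have "\<dots> = (LINT r|lborel. (cmod (w (place (r, z))))\<^sup>2) * (LINT t|lborel. (cmod (X t))\<^sup>2)"
  proof (rule integral_product_compact[OF _ L(1) _ _ compact_Icc])
    show "continuous_on UNIV (\<lambda>r. (cmod (w (place (r, z))))\<^sup>2)"
      by (intro continuous_intros continuous_on_compose2[OF test_continuous[OF w, of UNIV]]
          continuous_on_compose2[OF continuous_place[of UNIV]]) auto
    show "continuous_on UNIV (\<lambda>t. (cmod (X t))\<^sup>2)" by (intro continuous_intros smooth_continuous X)
  qed (use L(2) supp in auto)
  finally show ?thesis .
qed

lemma slice_power2_integrable:
  assumes w: "w \<in> test_functions layer"
  shows "integrable lborel (\<lambda>r. (cmod (w (place (r, z))))\<^sup>2)"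
proof -
  obtain L where L: "compact L" "\<And>r. r \<notin> L \<Longrightarrow> w (place (r, z)) = 0"
    using slice_support[OF w, of z] by auto
  show ?thesis
  proof (rule integrable_compact_support[OF _ L(1)])
    show "continuous_on UNIV (\<lambda>r. (cmod (w (place (r, z))))\<^sup>2)"
      by (intro continuous_intros continuous_on_compose2[OF test_continuous[OF w, of UNIV]]
          continuous_on_compose2[OF continuous_place[of UNIV]]) auto
  qed (use L(2) in auto)
qed

text \<open>By Fubini, energy minus c times mass is the integral over the height of the same
  quantity on slices, so a negative total forces a negative slice. The integrand vanishes up to
  height 1, hence 1 < z.\<close>

lemma exists_good_slice:
  assumes "c \<notin> far_bounds"
  obtains w z where "w \<in> test_functions layer" "1 < z"
    "(LINT r|lborel. (cmod (pd e1 w (place (r, z))))\<^sup>2) + (LINT r|lborel. (cmod (pd e2 w (place (r, z))))\<^sup>2) <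
      c * (LINT r|lborel. (cmod (w (place (r, z))))\<^sup>2)"
proof -
  obtain w where w: "w \<in> test_functions layer" and less: "far_energy w < c * far_mass w"
    using assms by (auto simp: far_bounds_def not_le)
  note i = test_indicator_power2_integrable[OF test_pd[OF w] far_borel, of e1]
    test_indicator_power2_integrable[OF test_pd[OF w] far_borel, of e2] test_indicator_power2_integrable[OF w far_borel]
  define k where "k p = indicator far p * (cmod (pd e1 w p))\<^sup>2 + indicator far p * (cmod (pd e2 w p))\<^sup>2
    - c * (indicator far p * (cmod (w p))\<^sup>2)" for p
  have ik: "integrable lborel k"
    unfolding k_def by (intro Bochner_Integration.integrable_diff Bochner_Integration.integrable_add integrable_mult_right i)
  have "(LINT p|lborel. k p) = far_energy w - c * far_mass w"
    unfolding k_def far_energy_def far_mass_def distrib_left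
    by (simp only: Bochner_Integration.integral_diff Bochner_Integration.integral_add
        Bochner_Integration.integrable_add integrable_mult_right integral_mult_right_zero i)
  then have neg: "(LINT p|lborel. k p) < 0" using less by simp
  have km: "k \<in> borel_measurable borel" using ik by auto
  have int: "integrable (lborel \<Otimes>\<^sub>M lborel) (case_prod (\<lambda>r z. k (place (r, z))))"
    using ik integrable_place[OF km] by (simp add: lborel_prod case_prod_beta')
  have "(LINT z|lborel. (LINT r|lborel. k (place (r, z)))) = (LINT q|lborel. k (place q))"
    using lborel_pair.integral_snd[OF int] by (simp add: lborel_prod case_prod_beta')
  then have "(LINT z|lborel. (LINT r|lborel. k (place (r, z)))) < 0"
    using neg integral_place[OF km] by simp
  then have "\<not> (\<forall>z. 0 \<le> (LINT r|lborel. k (place (r, z))))"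
    by (metis (mono_tags, lifting) AE_I2 integral_nonneg_AE not_le)
  then obtain z where z: "(LINT r|lborel. k (place (r, z))) < 0" by (auto simp: not_le)
  have "1 < z"
  proof (rule ccontr)
    assume "\<not> 1 < z"
    then have "k (place (r, z)) = 0" for r by (simp add: k_def far_def place_coordinates)
    then show False using z by simp
  qed
  then have kz: "k (place (r, z)) = (cmod (pd e1 w (place (r, z))))\<^sup>2 + (cmod (pd e2 w (place (r, z))))\<^sup>2 - c * (cmod (w (place (r, z))))\<^sup>2" for r
    by (simp add: k_def far_def place_coordinates)
  note j = slice_power2_integrable[OF test_pd[OF w, of e1], of z] slice_power2_integrable[OF test_pd[OF w, of e2], of z]
    slice_power2_integrable[OF w, of z]
  have "(LINT r|lborel. k (place (r, z))) = (LINT r|lborel. (cmod (pd e1 w (place (r, z))))\<^sup>2) +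
     (LINT r|lborel. (cmod (pd e2 w (place (r, z))))\<^sup>2) - c * (LINT r|lborel. (cmod (w (place (r, z))))\<^sup>2)"
    unfolding kz by (simp only: Bochner_Integration.integral_diff Bochner_Integration.integral_add
        Bochner_Integration.integrable_add integrable_mult_right integral_mult_right_zero j)
  then show ?thesis using z that[OF w \<open>1 < z\<close>] by simp
qed

text \<open>Membership in \<open>far_bounds\<close> says that energy minus c times mass is a
  nonnegative quadratic form on test functions; evaluating it at v + a f for all complex a gives the
  inequality for its polarisation.\<close>

lemma far_cauchy_schwarz:
  assumes c: "c \<in> far_bounds" and v: "v \<in> test_functions layer" and f: "f \<in> test_functions layer"
  shows "cmod (LINT p|lborel. indicator far p *\<^sub>R (pd e1 v p * cnj (pd e1 f p) + pd e2 v p * cnj (pd e2 f p)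
      - of_real c * (v p * cnj (f p)))) \<le>
    sqrt (far_energy v - c * far_mass v) * sqrt (far_energy f - c * far_mass f)"
proof (rule quadratic_form_cauchy_schwarz)
  let ?Z = "\<lambda>p. pd e1 v p * cnj (pd e1 f p) + pd e2 v p * cnj (pd e2 f p) - of_real c * (v p * cnj (f p))"
  let ?q = "\<lambda>h p. (cmod (pd e1 h p))\<^sup>2 + (cmod (pd e2 h p))\<^sup>2 - c * (cmod (h p))\<^sup>2"
  have q: "far_energy h - c * far_mass h = (LINT p|lborel. indicator far p * ?q h p)"
    "integrable lborel (\<lambda>p. indicator far p * ?q h p)" if h: "h \<in> test_functions layer" for h
  proof -
    note i = test_indicator_power2_integrable[OF test_pd[OF h] far_borel, of e1]
      test_indicator_power2_integrable[OF test_pd[OF h] far_borel, of e2] test_indicator_power2_integrable[OF h far_borel]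
    have eq: "indicator far p * ?q h p = indicator far p * (cmod (pd e1 h p))\<^sup>2 + indicator far p * (cmod (pd e2 h p))\<^sup>2
      - c * (indicator far p * (cmod (h p))\<^sup>2)" for p by (simp add: algebra_simps)
    show "integrable lborel (\<lambda>p. indicator far p * ?q h p)"
      unfolding eq by (intro Bochner_Integration.integrable_diff Bochner_Integration.integrable_add integrable_mult_right i)
    show "far_energy h - c * far_mass h = (LINT p|lborel. indicator far p * ?q h p)"
      unfolding eq far_energy_def far_mass_def distrib_left
      by (simp only: Bochner_Integration.integral_diff Bochner_Integration.integral_add
        Bochner_Integration.integrable_add integrable_mult_right integral_mult_right_zero i)
  qed
  have prod: "integrable lborel (\<lambda>p. g p * cnj (h p))" if "g \<in> test_functions layer" "h \<in> test_functions layer" for g h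
    by (intro test_integrable[OF test_mult[OF that(1) test_smooth[OF test_cnj[OF that(2)]]]])
  have "integrable lborel ?Z"
    by (intro Bochner_Integration.integrable_diff Bochner_Integration.integrable_add integrable_mult_right prod test_pd v f)
  then have iZ: "integrable lborel (\<lambda>p. indicator far p *\<^sub>R ?Z p)"
    using far_borel by (intro integrable_mult_indicator) auto
  fix a :: complex
  let ?g = "\<lambda>p. v p + a * f p"
  have g: "?g \<in> test_functions layer" by (rule test_lincomb[OF v f])
  have expand: "indicator far p * ?q ?g p = indicator far p * ?q v p + 2 * Re (cnj a * (indicator far p *\<^sub>R ?Z p))
    + (cmod a)\<^sup>2 * (indicator far p * ?q f p)" for p
    unfolding pd_lincomb[OF test_smooth[OF v] test_smooth[OF f]] cmod_lincomb_power2
    by (simp add: indicator_def algebra_simps)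
  have ReZ: "integrable lborel (\<lambda>p. Re (cnj a * (indicator far p *\<^sub>R ?Z p)))"
    by (intro integrable_Re integrable_mult_right iZ)
  have "0 \<le> far_energy ?g - c * far_mass ?g" using c g by (simp add: far_bounds_def)
  also have "\<dots> = (LINT p|lborel. indicator far p * ?q v p + 2 * Re (cnj a * (indicator far p *\<^sub>R ?Z p))
    + (cmod a)\<^sup>2 * (indicator far p * ?q f p))"
    unfolding q(1)[OF g] expand ..
  also have "\<dots> = (LINT p|lborel. indicator far p * ?q v p) + 2 * (LINT p|lborel. Re (cnj a * (indicator far p *\<^sub>R ?Z p)))
    + (cmod a)\<^sup>2 * (LINT p|lborel. indicator far p * ?q f p)"
    by (simp only: Bochner_Integration.integral_add Bochner_Integration.integrable_add integrable_mult_right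
        integral_mult_right_zero ReZ q(2)[OF v] q(2)[OF f])
  also have "(LINT p|lborel. Re (cnj a * (indicator far p *\<^sub>R ?Z p))) = Re (cnj a * (LINT p|lborel. indicator far p *\<^sub>R ?Z p))"
    unfolding integral_mult_right_zero[symmetric] by (rule integral_Re[OF integrable_mult_right[OF iZ]])
  finally show "0 \<le> far_energy v - c * far_mass v + 2 * Re (cnj a * (LINT p|lborel. indicator far p *\<^sub>R ?Z p)) +
    (cmod a)\<^sup>2 * (far_energy f - c * far_mass f)"
    unfolding q(1)[OF v] q(1)[OF f] .
qed (use c f in \<open>simp add: far_bounds_def\<close>)

end

subsection \<open>Wave packets\<close>

definition modulate :: "real \<Rightarrow> (real \<Rightarrow> real) \<Rightarrow> real \<Rightarrow> complex" where
  "modulate k b t = complex_of_real (b t) * exp (\<i> * of_real (k * t))"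

lemma smooth_plane_wave: "smooth (\<lambda>t. exp (\<i> * complex_of_real (k * t)))"
proof -
  let ?F = "\<lambda>n t. (\<i> * complex_of_real k) ^ n * exp (\<i> * complex_of_real (k * t))"
  have "(?F n has_vector_derivative ?F (Suc n) t) (at t)" for n t
    by (rule derivative_eq_intros has_vector_derivative_real_field refl | simp)+
  then have "smooth (\<lambda>t. ?F 0 t)"
    by (rule smooth_real_compose[where F = ?F and g = "\<lambda>t. t" and n = 0]) (intro smooth_linear bounded_linear_ident)
  then show ?thesis by simp
qed

lemma plane_wave_derivative:
  "pd 1 (\<lambda>t. exp (\<i> * complex_of_real (k * t))) t = \<i> * of_real k * exp (\<i> * of_real (k * t))"
proof (rule pd_eq_line[OF smooth_plane_wave])
  show "((\<lambda>s. exp (\<i> * complex_of_real (k * (t + s *\<^sub>R 1)))) has_vector_derivative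
      \<i> * of_real k * exp (\<i> * of_real (k * t))) (at 0)"
    by (rule derivative_eq_intros has_vector_derivative_real_field refl | simp)+
qed

lemma smooth_modulate: "smooth b \<Longrightarrow> smooth (modulate k b)"
  unfolding modulate_def[abs_def]
  by (intro smooth_mult smooth_linear_compose[OF bounded_linear_of_real] smooth_plane_wave)

lemma modulate_derivative:
  assumes "smooth b"
  shows "pd 1 (modulate k b) = (\<lambda>t. modulate k (pd 1 b) t + \<i> * of_real k * modulate k b t)"
proof
  fix t
  have 1: "smooth (\<lambda>t. complex_of_real (b t))" by (intro smooth_linear_compose[OF bounded_linear_of_real] assms)
  have "pd 1 (\<lambda>t. complex_of_real (b t)) t = of_real (pd 1 b t)"
    by (rule pd_eqI[OF bounded_linear.has_derivative[OF bounded_linear_of_real smooth_has_derivative[OF assms]]])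
  then show "pd 1 (modulate k b) t = modulate k (pd 1 b) t + \<i> * of_real k * modulate k b t"
    unfolding modulate_def[abs_def] pd_mult[OF 1 smooth_plane_wave] plane_wave_derivative by (simp add: mult_ac)
qed

text \<open>The carrier exp(i k t) solves X'' + k^2 X = 0, so only terms with a derivative of the
  envelope b remain.\<close>

lemma modulate_second_derivative:
  assumes "smooth b"
  shows "pd 1 (pd 1 (modulate k b)) t + of_real (k\<^sup>2) * modulate k b t =
    modulate k (pd 1 (pd 1 b)) t + 2 * \<i> * of_real k * modulate k (pd 1 b) t"
proof -
  have "pd 1 (pd 1 (modulate k b)) t = pd 1 (modulate k (pd 1 b)) t + \<i> * of_real k * pd 1 (modulate k b) t"
    unfolding modulate_derivative[OF assms]
    by (rule pd_lincomb[OF smooth_modulate[OF smooth_pd[OF assms]] smooth_modulate[OF assms]])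
  then show ?thesis
    using fun_cong[OF modulate_derivative[OF assms], of k t] fun_cong[OF modulate_derivative[OF smooth_pd[OF assms]], of k 1 t]
    by (simp add: algebra_simps power2_eq_square)
qed

lemma norm_modulate: "cmod (modulate k b t) = \<bar>b t\<bar>"
  by (simp add: modulate_def norm_mult)

lemma pd_rescale:
  fixes a :: "real \<Rightarrow> real"
  assumes "smooth a"
  shows "pd 1 (\<lambda>t. c * a ((t - m) / r)) = (\<lambda>t. c / r * pd 1 a ((t - m) / r))"
proof (rule ext, rule pd_eq_line)
  show "smooth (\<lambda>t. c * a ((t - m) / r))" by (intro smooth_mult smooth_const smooth_rescale assms)
  fix t
  have "((\<lambda>s. c * a ((t + s - m) / r)) has_real_derivative c * (pd 1 a ((t - m) / r) / r)) (at 0)"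
    by (intro DERIV_cmult rescale_has_derivative assms)
  then show "((\<lambda>s. c * a ((t + s *\<^sub>R 1 - m) / r)) has_vector_derivative c / r * pd 1 a ((t - m) / r)) (at 0)"
    by (simp add: has_real_derivative_iff_has_vector_derivative)
qed

text \<open>For an envelope of width R the mass grows like R, while the residual is O(1 / R) on an
  interval of length 2 R, so its square integrates to O(1 / R). The support starts at 2 to stay
  above height 1.\<close>

lemma wave_packet:
  "\<exists>I0 M :: real. 0 < I0 \<and> 0 \<le> M \<and>
    (\<forall>R\<ge>1. \<exists>X. smooth X \<and> (\<forall>t. t \<notin> {2..2 * R + 2} \<longrightarrow> X t = 0) \<and>
       (LINT t|lborel. (cmod (X t))\<^sup>2) = R * I0 \<and>
       (LINT t|lborel. (cmod (pd 1 (pd 1 X) t + of_real (k\<^sup>2) * X t))\<^sup>2) \<le> M / R)"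
proof -
  define \<beta> where "\<beta> = bump (1 / 40)"
  have sm: "smooth \<beta>" unfolding \<beta>_def by (rule smooth_bump_id) simp
  define I0 where "I0 = (LINT t|lborel. (\<beta> t)\<^sup>2)"
  define F where "F s = (\<bar>pd 1 (pd 1 \<beta>) s\<bar> + 2 * \<bar>k\<bar> * \<bar>pd 1 \<beta> s\<bar>)\<^sup>2" for s
  define M where "M = (LINT s|lborel. F s)"
  have "1 \<le> I0" using bump_power2_integrals(2)[of "1 / 40"] by (simp add: I0_def \<beta>_def)
  have z: "\<beta> t = 0" "pd 1 \<beta> t = 0" "pd 1 (pd 1 \<beta>) t = 0" if "t \<notin> {-1..1}" for t
  proof -
    have "\<beta> s = 0" if "s \<notin> {-1..1}" for s using that bump_eq_0[of s] by (auto simp: \<beta>_def)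
    from pd_eq_0[OF compact_Icc this] show "\<beta> t = 0" "pd 1 \<beta> t = 0" "pd 1 (pd 1 \<beta>) t = 0"
      using that \<open>\<And>s. s \<notin> {-1..1} \<Longrightarrow> \<beta> s = 0\<close> pd_eq_0[OF compact_Icc, of "-1" 1 "pd 1 \<beta>" t 1] by auto
  qed
  have Fc: "continuous_on UNIV F" unfolding F_def
    by (intro continuous_intros smooth_continuous smooth_pd sm)
  have "0 \<le> M" unfolding M_def F_def by (intro integral_nonneg_AE) auto
  moreover have "\<exists>X. smooth X \<and> (\<forall>t. t \<notin> {2..2 * R + 2} \<longrightarrow> X t = 0) \<and>
       (LINT t|lborel. (cmod (X t))\<^sup>2) = R * I0 \<and>
       (LINT t|lborel. (cmod (pd 1 (pd 1 X) t + of_real (k\<^sup>2) * X t))\<^sup>2) \<le> M / R" if R: "1 \<le> R" for R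
  proof -
    define m where "m = R + 2"
    define b where "b t = 1 * \<beta> ((t - m) / R)" for t
    have sb: "smooth b" unfolding b_def by (intro smooth_mult smooth_const smooth_rescale sm)
    have b1: "pd 1 b = (\<lambda>t. 1 / R * pd 1 \<beta> ((t - m) / R))" unfolding b_def by (rule pd_rescale[OF sm])
    have b2: "pd 1 (pd 1 b) = (\<lambda>t. 1 / R / R * pd 1 (pd 1 \<beta>) ((t - m) / R))"
      unfolding b1 by (rule pd_rescale[OF smooth_pd[OF sm]])
    let ?X = "modulate k b"
    have off: "(t - m) / R \<notin> {-1..1}" if "t \<notin> {2..2 * R + 2}" for t
      using that R by (auto simp: m_def field_simps)
    have 1: "\<forall>t. t \<notin> {2..2 * R + 2} \<longrightarrow> ?X t = 0"
      using z(1)[OF off] by (simp add: modulate_def b_def del: atLeastAtMost_iff)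
    have 2: "(LINT t|lborel. (cmod (?X t))\<^sup>2) = R * I0"
      using integral_rescale[of R "\<lambda>t. (\<beta> t)\<^sup>2" m] R by (simp add: norm_modulate b_def I0_def)
    let ?Y = "\<lambda>t. modulate k (pd 1 (pd 1 b)) t + 2 * \<i> * of_real k * modulate k (pd 1 b) t"
    have bound: "(cmod (?Y t))\<^sup>2 \<le> 1 / R\<^sup>2 * F ((t - m) / R)" for t
    proof -
      have "cmod (?Y t) \<le> \<bar>pd 1 (pd 1 b) t\<bar> + 2 * \<bar>k\<bar> * \<bar>pd 1 b t\<bar>"
        by (rule order_trans[OF norm_triangle_ineq]) (simp add: norm_mult norm_modulate)
      \<comment> \<open>The second derivative carries 1 / R^2, weakened to 1 / R by R \<ge> 1 so
        that the single profile F serves both terms.\<close>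
      also have "\<dots> \<le> 1 / R * (\<bar>pd 1 (pd 1 \<beta>) ((t - m) / R)\<bar> + 2 * \<bar>k\<bar> * \<bar>pd 1 \<beta> ((t - m) / R)\<bar>)"
      proof -
        have "\<bar>1 / R / R * pd 1 (pd 1 \<beta>) ((t - m) / R)\<bar> \<le> 1 / R * \<bar>pd 1 (pd 1 \<beta>) ((t - m) / R)\<bar>"
          using R by (simp add: abs_mult) (rule divide_left_mono, auto simp: mult_le_cancel_left1)
        moreover have "2 * \<bar>k\<bar> * \<bar>1 / R * pd 1 \<beta> ((t - m) / R)\<bar> = 1 / R * (2 * \<bar>k\<bar> * \<bar>pd 1 \<beta> ((t - m) / R)\<bar>)"
          using R by (simp add: abs_mult)
        ultimately show ?thesis unfolding fun_cong[OF b2, of t] fun_cong[OF b1, of t] distrib_left by linarith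
      qed
      finally have "(cmod (?Y t))\<^sup>2 \<le> (1 / R * (\<bar>pd 1 (pd 1 \<beta>) ((t - m) / R)\<bar> + 2 * \<bar>k\<bar> * \<bar>pd 1 \<beta> ((t - m) / R)\<bar>))\<^sup>2"
        by (intro power_mono) auto
      then show ?thesis by (simp add: F_def power_mult_distrib power_divide)
    qed
    have off1: "(t - m) / R \<notin> {-1..1}" if "t \<notin> {m - R..m + R}" for t
      using that R by (auto simp: field_simps)
    have iF: "integrable lborel (\<lambda>t. 1 / R\<^sup>2 * F ((t - m) / R))"
    proof (rule integrable_compact_support[OF _ compact_Icc[of "m - R" "m + R"]])
      show "continuous_on UNIV (\<lambda>t. 1 / R\<^sup>2 * F ((t - m) / R))"
        using R by (intro continuous_intros continuous_on_compose2[OF Fc]) auto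
    qed (use z[OF off1] in \<open>simp add: F_def del: atLeastAtMost_iff\<close>)
    have "(LINT t|lborel. (cmod (?Y t))\<^sup>2) \<le> (LINT t|lborel. 1 / R\<^sup>2 * F ((t - m) / R))"
    proof (rule integral_mono_AE'[OF iF])
      show "AE t in lborel. 0 \<le> 1 / R\<^sup>2 * F ((t - m) / R)" by (simp add: F_def)
    qed (use bound in simp)
    also have "\<dots> = M / R"
      using integral_rescale[of R F m] R by (simp add: M_def power2_eq_square)
    finally have 3: "(LINT t|lborel. (cmod (pd 1 (pd 1 ?X) t + of_real (k\<^sup>2) * ?X t))\<^sup>2) \<le> M / R"
      unfolding modulate_second_derivative[OF sb] .
    show ?thesis using smooth_modulate[OF sb] 1 2 3 by blast
  qed
  ultimately show ?thesis using \<open>1 \<le> I0\<close> by (intro exI[of _ I0] exI[of _ M]) simp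
qed

lemma test_L2_norm:
  assumes "open \<Omega>" "f \<in> test_functions \<Omega>"
  shows "L2_norm \<Omega> f = sqrt (LINT x|lborel. (cmod (f x))\<^sup>2)"
  using test_L2_inner(2)[OF assms assms(2)] L2_norm_nonneg[of \<Omega> f] by (metis real_sqrt_unique)

section \<open>Weyl's criterion for waves along the edge, and the conclusion\<close>

context wedge
begin

lemma far_wave:
  assumes w: "w \<in> test_functions layer" and X: "smooth X"
    and supp: "\<And>t. t \<notin> {a..b} \<Longrightarrow> X t = 0" and a: "1 < a"
  shows "far_mass (wave w z X) = (LINT r|lborel. (cmod (w (place (r, z))))\<^sup>2) * (LINT t|lborel. (cmod (X t))\<^sup>2)"
    and "1 < z \<Longrightarrow> far_energy (wave w z X) = ((LINT r|lborel. (cmod (pd e1 w (place (r, z))))\<^sup>2) +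
        (LINT r|lborel. (cmod (pd e2 w (place (r, z))))\<^sup>2)) * (LINT t|lborel. (cmod (X t))\<^sup>2)"
proof -
  have ind: "indicator far p * (cmod (wave u z X p))\<^sup>2 = (cmod (wave u z X p))\<^sup>2" for u p
    using supp[of "e3 \<bullet> (p - V)"] a by (auto simp: wave_def far_def indicator_def)
  show "far_mass (wave w z X) = (LINT r|lborel. (cmod (w (place (r, z))))\<^sup>2) * (LINT t|lborel. (cmod (X t))\<^sup>2)"
    unfolding far_mass_def ind by (rule wave_norm_integral[OF w X supp])
  assume z: "1 < z"
  note t = test_wave[OF test_pd[OF w] z X supp a]
  have e: "(LINT p|lborel. (cmod (wave (pd v w) z X p))\<^sup>2) =
    (LINT r|lborel. (cmod (pd v w (place (r, z))))\<^sup>2) * (LINT t|lborel. (cmod (X t))\<^sup>2)" for v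
    by (rule wave_norm_integral[OF test_pd[OF w] X supp])
  have i: "integrable lborel (\<lambda>p. (cmod (wave (pd v w) z X p))\<^sup>2)" for v
    by (rule test_power2_integrable[OF t])
  show "far_energy (wave w z X) = ((LINT r|lborel. (cmod (pd e1 w (place (r, z))))\<^sup>2) +
        (LINT r|lborel. (cmod (pd e2 w (place (r, z))))\<^sup>2)) * (LINT t|lborel. (cmod (X t))\<^sup>2)"
    unfolding far_energy_def distrib_left fun_cong[OF pd_wave(1)[OF test_smooth[OF w] X]]
      fun_cong[OF pd_wave(2)[OF test_smooth[OF w] X]] ind
    unfolding Bochner_Integration.integral_add[OF i i] e by (simp add: distrib_right)
qed

text \<open>The residual splits in two. The cross-sectional part is controlled by
  \<open>far_cauchy_schwarz\<close> and is small when w is nearly minimal at height z. Integration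
  by parts along \<open>e3\<close> leaves the product of v with the wave of profile Y, small when X
  nearly solves X'' + k^2 X = 0. The last factor is the H1 norm of v.\<close>

lemma weyl_estimate:
  fixes k :: real
  assumes c: "c \<in> far_bounds" "0 \<le> c" and w: "w \<in> test_functions layer" and z: "1 < z"
    and X: "smooth X" and supp: "\<And>t. t \<notin> {a..b} \<Longrightarrow> X t = 0" and a: "1 < a"
    and v: "v \<in> test_functions layer"
  defines "f \<equiv> wave w z X" and "Y \<equiv> \<lambda>t. pd 1 (pd 1 X) t + of_real (k\<^sup>2) * X t"
  shows "cmod (LINT p|lborel. (\<Sum>b\<in>Basis. pd b v p * cnj (pd b f p)) - of_real (c + k\<^sup>2) * (v p * cnj (f p))) \<le>
    (sqrt (far_energy f - c * far_mass f) + sqrt ((LINT r|lborel. (cmod (w (place (r, z))))\<^sup>2) * (LINT t|lborel. (cmod (Y t))\<^sup>2))) *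
    sqrt ((LINT p|lborel. (cmod (v p))\<^sup>2) + (LINT p|lborel. (\<Sum>b\<in>Basis. (cmod (pd b v p))\<^sup>2)))"
proof -
  note smw = test_smooth[OF w] and smv = test_smooth[OF v]
  have f: "f \<in> test_functions layer" unfolding f_def by (rule test_wave[OF w z X supp a])
  note smf = test_smooth[OF f]
  have suppX: "pd 1 X t = 0" "pd 1 (pd 1 X) t = 0" if "t \<notin> {a..b}" for t
  proof -
    have "pd 1 X s = 0" if "s \<notin> {a..b}" for s by (rule pd_eq_0[OF compact_Icc supp that])
    from this pd_eq_0[OF compact_Icc this that] show "pd 1 X t = 0" "pd 1 (pd 1 X) t = 0" using that by auto
  qed
  have smY: "smooth Y" unfolding Y_def by (intro smooth_add smooth_mult smooth_const smooth_pd X)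
  have suppY: "Y t = 0" if "t \<notin> {a..b}" for t using suppX(2)[OF that] supp[OF that] by (simp add: Y_def)
  define g where "g = wave w z Y"
  have g: "g \<in> test_functions layer" unfolding g_def by (rule test_wave[OF w z smY suppY a])
  have fg: "g p = pd e3 (pd e3 f) p + of_real (k\<^sup>2) * f p" for p
    unfolding g_def f_def pd_wave(3)[OF smw X] fun_cong[OF pd_wave(3)[OF smw smooth_pd[OF X]]]
    by (simp add: wave_def Y_def distrib_left)
  let ?Z = "\<lambda>p. pd e1 v p * cnj (pd e1 f p) + pd e2 v p * cnj (pd e2 f p) - of_real c * (v p * cnj (f p))"
  \<comment> \<open>X is supported above height 1, so restricting to \<open>far\<close> loses
    nothing.\<close>
  have farZ: "indicator far p *\<^sub>R ?Z p = ?Z p" for p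
  proof (cases "p \<in> far")
    case False
    then have "X (e3 \<bullet> (p - V)) = 0" using a by (intro supp) (auto simp: far_def)
    then have "f p = 0" "pd e1 f p = 0" "pd e2 f p = 0"
      unfolding f_def fun_cong[OF pd_wave(1)[OF smw X]] fun_cong[OF pd_wave(2)[OF smw X]] by (simp_all add: wave_def)
    then show ?thesis by simp
  qed simp
  have prod: "integrable lborel (\<lambda>p. g p * cnj (h p))" if "g \<in> test_functions layer" "h \<in> test_functions layer" for g h
    by (intro test_integrable[OF test_mult[OF that(1) test_smooth[OF test_cnj[OF that(2)]]]])
  have iZ: "integrable lborel ?Z"
    by (intro Bochner_Integration.integrable_diff Bochner_Integration.integrable_add integrable_mult_right prod test_pd v f)
  note i3 = prod[OF test_pd[OF v] test_pd[OF f], of e3 e3] and i33 = prod[OF v test_pd[OF test_pd[OF f]], of e3 e3]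
  have parts: "(LINT p|lborel. v p * cnj (pd e3 (pd e3 f) p)) = - (LINT p|lborel. pd e3 v p * cnj (pd e3 f p))"
    using integral_by_parts[OF v test_smooth[OF test_cnj[OF test_pd[OF f]]], of e3 e3]
    unfolding pd_cnj[OF smooth_pd[OF smf]] .
  have "(LINT p|lborel. (\<Sum>b\<in>Basis. pd b v p * cnj (pd b f p)) - of_real (c + k\<^sup>2) * (v p * cnj (f p))) =
    (LINT p|lborel. ?Z p + (pd e3 v p * cnj (pd e3 f p) + v p * cnj (pd e3 (pd e3 f) p)) - v p * cnj (g p))"
    unfolding gradient_inner_frame[OF smv smf] fg by (simp add: algebra_simps)
  also have "\<dots> = (LINT p|lborel. ?Z p) + ((LINT p|lborel. pd e3 v p * cnj (pd e3 f p)) + (LINT p|lborel. v p * cnj (pd e3 (pd e3 f) p)))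
     - (LINT p|lborel. v p * cnj (g p))"
    by (simp only: Bochner_Integration.integral_diff Bochner_Integration.integral_add
        Bochner_Integration.integrable_add Bochner_Integration.integrable_diff iZ i3 i33 prod[OF v g])
  finally have eq: "(LINT p|lborel. (\<Sum>b\<in>Basis. pd b v p * cnj (pd b f p)) - of_real (c + k\<^sup>2) * (v p * cnj (f p))) =
    (LINT p|lborel. ?Z p) - (LINT p|lborel. v p * cnj (g p))"
    unfolding parts by simp
  let ?NV = "LINT p|lborel. (cmod (v p))\<^sup>2" and ?GV = "LINT p|lborel. (\<Sum>b\<in>Basis. (cmod (pd b v p))\<^sup>2)"
  have NV: "0 \<le> ?NV" and GV: "0 \<le> ?GV" by (auto intro!: integral_nonneg_AE sum_nonneg)
  have "far_energy v \<le> ?GV"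
    unfolding far_energy_def
  proof (rule integral_mono)
    show "integrable lborel (\<lambda>x. indicator far x * ((cmod (pd e1 v x))\<^sup>2 + (cmod (pd e2 v x))\<^sup>2))"
      unfolding distrib_left
      by (intro Bochner_Integration.integrable_add test_indicator_power2_integrable[OF test_pd[OF v]] far_borel)
    show "integrable lborel (\<lambda>x. \<Sum>b\<in>Basis. (cmod (pd b v x))\<^sup>2)"
      by (intro Bochner_Integration.integrable_sum test_power2_integrable[OF test_pd[OF v]])
  qed (auto simp: gradient_norm_frame[OF smv] indicator_def)
  moreover have "0 \<le> c * far_mass v" using c(2) far_mass_nonneg by simp
  ultimately have "far_energy v - c * far_mass v \<le> ?NV + ?GV" using NV by linarith
  then have s1: "sqrt (far_energy v - c * far_mass v) \<le> sqrt (?NV + ?GV)" by simp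
  have "cmod (LINT p|lborel. ?Z p) \<le> sqrt (far_energy v - c * far_mass v) * sqrt (far_energy f - c * far_mass f)"
    using far_cauchy_schwarz[OF c(1) v f] unfolding farZ .
  also have "\<dots> \<le> sqrt (?NV + ?GV) * sqrt (far_energy f - c * far_mass f)"
    using c(1) f s1 by (intro mult_right_mono) (auto simp: far_bounds_def)
  finally have A: "cmod (LINT p|lborel. ?Z p) \<le> sqrt (?NV + ?GV) * sqrt (far_energy f - c * far_mass f)" .
  have "cmod (LINT p|lborel. v p * cnj (g p)) \<le> sqrt ?NV * sqrt (LINT p|lborel. (cmod (g p))\<^sup>2)"
    using L2_cauchy_schwarz[OF test_in_L2[OF open_layer v] test_in_L2[OF open_layer g]]
    unfolding test_L2_inner(1)[OF open_layer v g] test_L2_norm[OF open_layer v] test_L2_norm[OF open_layer g] .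
  also have "\<dots> \<le> sqrt (?NV + ?GV) * sqrt (LINT p|lborel. (cmod (g p))\<^sup>2)"
    using GV by (intro mult_right_mono) (auto intro!: integral_nonneg_AE)
  also have "(LINT p|lborel. (cmod (g p))\<^sup>2) = (LINT r|lborel. (cmod (w (place (r, z))))\<^sup>2) * (LINT t|lborel. (cmod (Y t))\<^sup>2)"
    unfolding g_def by (rule wave_norm_integral[OF w smY suppY])
  finally have B: "cmod (LINT p|lborel. v p * cnj (g p)) \<le>
    sqrt (?NV + ?GV) * sqrt ((LINT r|lborel. (cmod (w (place (r, z))))\<^sup>2) * (LINT t|lborel. (cmod (Y t))\<^sup>2))" .
  have "cmod ((LINT p|lborel. ?Z p) - (LINT p|lborel. v p * cnj (g p))) \<le>
    sqrt (?NV + ?GV) * sqrt (far_energy f - c * far_mass f) + sqrt (?NV + ?GV) *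
      sqrt ((LINT r|lborel. (cmod (w (place (r, z))))\<^sup>2) * (LINT t|lborel. (cmod (Y t))\<^sup>2))"
    using norm_triangle_ineq4[of "LINT p|lborel. ?Z p" "LINT p|lborel. v p * cnj (g p)"] A B by linarith
  then show ?thesis unfolding eq distrib_right mult.commute[of "sqrt (?NV + ?GV)"] .
qed

text \<open>The surplus \<mu> - c = k^2 is taken up by oscillation along the edge, while the
  cross-section contributes c up to an arbitrarily small error.\<close>

lemma above_strip_bottom_in_spectrum:
  assumes c: "c \<in> far_bounds" "0 \<le> c" "\<And>\<epsilon>. 0 < \<epsilon> \<Longrightarrow> c + \<epsilon> \<notin> far_bounds" and \<mu>: "c < \<mu>"
  shows "complex_of_real \<mu> \<in> op_spectrum layer (dirichlet_laplacian layer)"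
proof (rule weyl_criterion[OF open_layer])
  fix \<epsilon> :: real assume \<epsilon>: "\<epsilon> > 0"
  define k where "k = sqrt (\<mu> - c)"
  have k: "\<mu> = c + k\<^sup>2" using \<mu> by (simp add: k_def)
  obtain I0 M :: real where IM: "0 < I0" "0 \<le> M" and packet: "\<And>R. 1 \<le> R \<Longrightarrow> \<exists>X. smooth X \<and> (\<forall>t. t \<notin> {2..2 * R + 2} \<longrightarrow> X t = 0) \<and>
       (LINT t|lborel. (cmod (X t))\<^sup>2) = R * I0 \<and>
       (LINT t|lborel. (cmod (pd 1 (pd 1 X) t + of_real (k\<^sup>2) * X t))\<^sup>2) \<le> M / R"
    using wave_packet[of k] by auto
  \<comment> \<open>A slice within \<delta> of optimal contributes sqrt \<delta> = \<epsilon> / 2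
    times the norm of f to the residual.\<close>
  define \<delta> where "\<delta> = (\<epsilon> / 2)\<^sup>2"
  have \<delta>: "\<delta> > 0" using \<epsilon> by (simp add: \<delta>_def)
  obtain w z where w: "w \<in> test_functions layer" and z: "1 < z" and
    less: "(LINT r|lborel. (cmod (pd e1 w (place (r, z))))\<^sup>2) + (LINT r|lborel. (cmod (pd e2 w (place (r, z))))\<^sup>2) <
      (c + \<delta>) * (LINT r|lborel. (cmod (w (place (r, z))))\<^sup>2)"
    by (rule exists_good_slice[OF c(3)[OF \<delta>]])
  define N where "N = (LINT r|lborel. (cmod (w (place (r, z))))\<^sup>2)"
  define E where "E = (LINT r|lborel. (cmod (pd e1 w (place (r, z))))\<^sup>2) + (LINT r|lborel. (cmod (pd e2 w (place (r, z))))\<^sup>2)"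
  have "0 \<le> E" "0 \<le> N" unfolding E_def N_def by (auto intro!: integral_nonneg_AE add_nonneg_nonneg)
  have EN: "E < (c + \<delta>) * N" using less by (simp add: E_def N_def)
  then have "N \<noteq> 0" using \<open>0 \<le> E\<close> by auto
  then have "N > 0" using \<open>0 \<le> N\<close> by simp
  \<comment> \<open>The residual along the edge is at most sqrt (M / I0) / R times the norm of f;
    this R makes it at most \<epsilon> / 2 times that norm, whatever the slice.\<close>
  define R where "R = max 1 (2 * sqrt (M / I0) / \<epsilon>)"
  have R: "1 \<le> R" "2 * sqrt (M / I0) / \<epsilon> \<le> R" by (simp_all add: R_def)
  obtain X where X: "smooth X" "\<And>t. t \<notin> {2..2 * R + 2} \<Longrightarrow> X t = 0" "(LINT t|lborel. (cmod (X t))\<^sup>2) = R * I0"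
       "(LINT t|lborel. (cmod (pd 1 (pd 1 X) t + of_real (k\<^sup>2) * X t))\<^sup>2) \<le> M / R"
    using packet[OF R(1)] by auto
  define f where "f = wave w z X"
  have f: "f \<in> test_functions layer" unfolding f_def by (rule test_wave[where a = 2 and b = "2 * R + 2", OF w z X(1,2)]) simp_all
  have mass: "(LINT p|lborel. (cmod (f p))\<^sup>2) = N * (R * I0)"
    unfolding f_def N_def X(3)[symmetric] by (rule wave_norm_integral[where a = 2 and b = "2 * R + 2", OF w X(1,2)])
  have far: "far_mass f = N * (R * I0)" "far_energy f = E * (R * I0)"
    unfolding f_def N_def E_def X(3)[symmetric]
    using far_wave(1)[where a = 2 and b = "2 * R + 2", OF w X(1,2), of z]
      far_wave(2)[where a = 2 and b = "2 * R + 2", OF w X(1,2) _ z] by (simp_all del: atLeastAtMost_iff)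
  have RI: "0 < R * I0" using R(1) IM(1) by simp
  have "far_energy f - c * far_mass f = (E - c * N) * (R * I0)" unfolding far by (simp add: algebra_simps)
  also have "\<dots> \<le> (\<delta> * N) * (R * I0)" using EN RI by (intro mult_right_mono) (auto simp: algebra_simps)
  finally have "sqrt (far_energy f - c * far_mass f) \<le> sqrt (\<delta> * (N * (R * I0)))" by (simp add: mult_ac)
  also have "\<dots> = \<epsilon> / 2 * sqrt (N * (R * I0))" using \<epsilon> by (simp add: real_sqrt_mult \<delta>_def)
  finally have A: "sqrt (far_energy f - c * far_mass f) \<le> \<epsilon> / 2 * sqrt (N * (R * I0))" .
  have "sqrt (N * (LINT t|lborel. (cmod (pd 1 (pd 1 X) t + of_real (k\<^sup>2) * X t))\<^sup>2)) \<le> sqrt (N * (M / R))"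
    using mult_left_mono[OF X(4) \<open>0 \<le> N\<close>] by (rule real_sqrt_le_mono)
  also have "N * (M / R) = (sqrt (M / I0) / R)\<^sup>2 * (N * (R * I0))"
    using IM R(1) by (simp add: power_divide power2_eq_square field_simps)
  also have "sqrt \<dots> = sqrt (M / I0) / R * sqrt (N * (R * I0))"
    using IM R(1) by (simp add: real_sqrt_mult)
  also have "\<dots> \<le> \<epsilon> / 2 * sqrt (N * (R * I0))"
  proof (rule mult_right_mono)
    show "sqrt (M / I0) / R \<le> \<epsilon> / 2" using R \<epsilon> by (simp add: field_simps)
    show "0 \<le> sqrt (N * (R * I0))" using \<open>N > 0\<close> RI by simp
  qed
  finally have B: "sqrt (N * (LINT t|lborel. (cmod (pd 1 (pd 1 X) t + of_real (k\<^sup>2) * X t))\<^sup>2)) \<le> \<epsilon> / 2 * sqrt (N * (R * I0))" .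
  show "\<exists>\<phi>\<in>test_functions layer. 0 < (LINT x|lborel. (cmod (\<phi> x))\<^sup>2) \<and>
      (\<forall>v\<in>test_functions layer.
        cmod (LINT x|lborel. (\<Sum>b\<in>Basis. pd b v x * cnj (pd b \<phi> x)) - of_real \<mu> * (v x * cnj (\<phi> x))) \<le>
        \<epsilon> * sqrt (LINT x|lborel. (cmod (\<phi> x))\<^sup>2) *
          sqrt ((LINT x|lborel. (cmod (v x))\<^sup>2) + (LINT x|lborel. (\<Sum>b\<in>Basis. (cmod (pd b v x))\<^sup>2))))"
  proof (intro bexI[OF _ f] conjI ballI)
    show "0 < (LINT x|lborel. (cmod (f x))\<^sup>2)" unfolding mass using \<open>N > 0\<close> RI by simp
    fix v assume v: "v \<in> test_functions layer"
    let ?S = "sqrt ((LINT x|lborel. (cmod (v x))\<^sup>2) + (LINT x|lborel. (\<Sum>b\<in>Basis. (cmod (pd b v x))\<^sup>2)))"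
    have "0 \<le> ?S" by (auto intro!: add_nonneg_nonneg integral_nonneg_AE sum_nonneg)
    have "cmod (LINT x|lborel. (\<Sum>b\<in>Basis. pd b v x * cnj (pd b f x)) - of_real \<mu> * (v x * cnj (f x))) \<le>
      (sqrt (far_energy f - c * far_mass f) + sqrt (N * (LINT t|lborel. (cmod (pd 1 (pd 1 X) t + of_real (k\<^sup>2) * X t))\<^sup>2))) * ?S"
      unfolding k f_def N_def by (rule weyl_estimate[where a = 2 and b = "2 * R + 2", OF c(1,2) w z X(1,2) _ v]) simp_all
    also have "\<dots> \<le> (\<epsilon> / 2 * sqrt (N * (R * I0)) + \<epsilon> / 2 * sqrt (N * (R * I0))) * ?S"
      using A B \<open>0 \<le> ?S\<close> by (intro mult_right_mono add_mono)
    finally show "cmod (LINT x|lborel. (\<Sum>b\<in>Basis. pd b v x * cnj (pd b f x)) - of_real \<mu> * (v x * cnj (f x))) \<le>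
      \<epsilon> * sqrt (LINT x|lborel. (cmod (f x))\<^sup>2) * ?S"
      unfolding mass by simp
  qed
qed

lemma no_eigenvalue_below_threshold:
  assumes narrow: "si \<le> 1 / 160"
    and ev: "is_eigenvalue layer (dirichlet_laplacian layer) (complex_of_real \<mu>)"
  shows "ess_threshold layer (dirichlet_laplacian layer) \<le> ereal \<mu>"
proof -
  obtain f0 where f0: "f0 \<in> test_functions layer" "far_energy f0 < 4 * far_mass f0"
    using narrow_angle_test_function[OF narrow] by blast
  note bottom = strip_bottom[OF f0]
  have "ess_threshold layer (dirichlet_laplacian layer) \<le> ereal strip_bottom"
    by (intro ess_threshold_le above_strip_bottom_in_spectrum[OF bottom(3,1,4)])
  also have "strip_bottom \<le> \<mu>"
    by (rule eigenvalue_lower_bound[OF open_layer layer_poincare[OF bottom(3,2)] ev])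
  finally show ?thesis by simp
qed

end

theorem theorem2:
  "\<exists>\<alpha>\<^sub>0>0. \<forall>\<alpha>\<in>{0<..<pi / 2}. \<alpha> < \<alpha>\<^sub>0 \<longrightarrow>
     (\<forall>(V :: real^3) (P :: 3 \<Rightarrow> real^3).
        is_trihedral V P \<and>
        (\<exists>j. vertex_angle V P j = \<alpha> \<and>
             vertex_angle V P (j + 1) = pi / 2 \<and> vertex_angle V P (j + 2) = pi / 2) \<longrightarrow>
        \<not> (\<exists>\<mu>::real.
             is_eigenvalue (unit_layer V P) (dirichlet_laplacian (unit_layer V P)) (complex_of_real \<mu>) \<and>
             ereal \<mu> < ess_threshold (unit_layer V P) (dirichlet_laplacian (unit_layer V P))))"
proof (intro exI[of _ "1 / 80"] conjI ballI impI allI notI)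
  fix \<alpha> :: real and V :: "real^3" and P :: "3 \<Rightarrow> real^3"
  assume \<alpha>: "\<alpha> \<in> {0<..<pi / 2}" "\<alpha> < 1 / 80"
    and P: "is_trihedral V P \<and> (\<exists>j. vertex_angle V P j = \<alpha> \<and>
             vertex_angle V P (j + 1) = pi / 2 \<and> vertex_angle V P (j + 2) = pi / 2)"
    and ev: "\<exists>\<mu>::real.
             is_eigenvalue (unit_layer V P) (dirichlet_laplacian (unit_layer V P)) (complex_of_real \<mu>) \<and>
             ereal \<mu> < ess_threshold (unit_layer V P) (dirichlet_laplacian (unit_layer V P))"
  obtain j where j: "is_trihedral V P" "vertex_angle V P j = \<alpha>"
      "vertex_angle V P (j + 1) = pi / 2" "vertex_angle V P (j + 2) = pi / 2"
    using P by blast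
  obtain e1 e2 e3 where wedge: "wedge e1 e2 e3 \<alpha>" and layer: "unit_layer V P = wedge.layer V e1 e2 e3 \<alpha>"
    by (rule trihedral_wedge[OF j(1) _ _ j(2-4)]) (use \<alpha> in auto)
  interpret wedge V e1 e2 e3 \<alpha> by (rule wedge)
  \<comment> \<open>The value 1 / 80 is twice the bound 1 / 160 on sin (\<alpha> / 2) required by
    \<open>narrow_angle_test_function\<close>.\<close>
  have "si \<le> \<alpha> / 2" using \<alpha> by (intro sin_x_le_x) auto
  then have "si \<le> 1 / 160" using \<alpha> by simp
  then show False
    using ev no_eigenvalue_below_threshold unfolding layer by (meson not_le)
qed simp

end
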